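(* Let $d,q\ge1$ be integers, let $c,C>1$ be constants, let $(p_k)_{k\ge1}$ be a sequence of primes with $cp_k\le p_{k+1}<Cp_k$ for all $k$, and let $(\vec a_k)_{k\ge1}\subset\mathbb{Z}^d$ satisfy $|\vec a_{k-1}|+p_{k-1}^q<|\vec a_k|\le Cp_k^q$ for all $k$ (the left inequality for $k\ge 2$). For $0\le j<p_k$ define $$x_{k,j}=\left(\sum_{i=1}^q p_k^{i-1}[j^i]_{p_k},\ \sum_{i=1}^q p_k^{i-1}[j^{q+i}]_{p_k},\ \dots,\ \sum_{i=1}^q p_k^{i-1}[j^{(d-1)q+i}]_{p_k}\right)\in\mathbb{Z}^d,$$ and let $S_k=\{\vec a_k+x_{k,j}:0\le j<p_k\}$. Then the maximal function $$Mf(\vec n)=\sup_N\frac1{\#\left(\bigcup_{k=1}^NS_k\right)}\sum_{\vec m\in\bigcup_{k=1}^NS_k}|f(\vec n+\vec m)|$$ satisfies a weak-$(1,1)$ inequality; that is, there is a constant $C'$ so that for any $f\in\ell^1(\mathbb{Z}^d)$ and any $\lambda>0$, $$\#\{\vec n\in\mathbb{Z}^d:Mf(\vec n)>\lambda\}\le\frac{C'}\lambda\|f\|_{\ell^1(\mathbb{Z}^d)}.$$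
   Context: $[n]_p\in\{0,\dots,p-1\}$ denotes the residue of $n$ modulo $p$; $|\cdot|$ is the Euclidean norm on $\mathbb{Z}^d$. *)

theory Defs
  imports "HOL-Analysis.Analysis" "HOL-Computational_Algebra.Primes"
begin

text \<open>
  The coordinates of a vector in the statement are ordered (the \<open>r\<close>-th one involves the exponents
  \<open>r * q + 1, \<dots>, r * q + q\<close>), so \<open>\<int>\<^sup>d\<close> is taken as the set of integer sequences vanishing from
  index \<open>d\<close> on, with coordinates numbered \<open>0, \<dots>, d - 1\<close>. It is closed under pointwise addition.
\<close>

definition int_lattice :: "nat \<Rightarrow> (nat \<Rightarrow> int) set" where
  "int_lattice d = {v. \<forall>r\<ge>d. v r = 0}"

definition vec_add :: "(nat \<Rightarrow> int) \<Rightarrow> (nat \<Rightarrow> int) \<Rightarrow> nat \<Rightarrow> int" where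
  "vec_add u v = (\<lambda>r. u r + v r)"

definition euclid_norm :: "nat \<Rightarrow> (nat \<Rightarrow> int) \<Rightarrow> real" where
  "euclid_norm d v = L2_set (\<lambda>r. real_of_int (v r)) {..<d}"

definition residue_point :: "nat \<Rightarrow> nat \<Rightarrow> nat \<Rightarrow> nat \<Rightarrow> nat \<Rightarrow> int" where
  "residue_point d q P j =
     (\<lambda>r. if r < d then int (\<Sum>i=1..q. P ^ (i - 1) * (j ^ (r * q + i) mod P)) else 0)"

definition block :: "nat \<Rightarrow> nat \<Rightarrow> (nat \<Rightarrow> nat) \<Rightarrow> (nat \<Rightarrow> nat \<Rightarrow> int) \<Rightarrow> nat \<Rightarrow> (nat \<Rightarrow> int) set" where
  "block d q p a k = {vec_add (a k) (residue_point d q (p k) j) | j. j < p k}"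

text \<open>
  For the maximal function along the unions of the sets \<open>S 1, S 2, \<dots>\<close>, the supremum is taken in
  the extended reals, so it is meaningful without any boundedness assumption.
\<close>

definition maximal_fun ::
    "(nat \<Rightarrow> (nat \<Rightarrow> int) set) \<Rightarrow> ((nat \<Rightarrow> int) \<Rightarrow> complex) \<Rightarrow> (nat \<Rightarrow> int) \<Rightarrow> ereal" where
  "maximal_fun S f n =
     (SUP N\<in>{1..}. ereal (1 / real (card (\<Union>k\<in>{1..N}. S k)) *
        (\<Sum>m\<in>(\<Union>k\<in>{1..N}. S k). cmod (f (vec_add n m)))))"

end

theory Submission
  imports Defs "Berlekamp_Zassenhaus.Distinct_Degree_Factorization"
begin

text \<open>
  Since \<open>p k\<close> grows geometrically, an average over a union of blocks is dominated by a constant times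
  the largest average over a single block. At scale \<open>k\<close> split \<open>f\<close> at height \<open>t * p k\<close>. The values above
  are seen from few points, because the sum over \<open>k\<close> of \<open>p k * card {f > t * p k}\<close> is \<open>O(\<parallel>f\<parallel> / t)\<close>. For
  the values below, write lattice points in base \<open>p k\<close>: up to carries, the block becomes the moment curve
  \<open>(j, j^2, \<dots>, j^(d * q))\<close> modulo \<open>p k\<close>, and as \<open>f \<ge> 0\<close> one may sum over all carry patterns. By the Weil
  bound, averaging over the moment curve differs from the mean over the whole box by an operator on
  \<open>l^2\<close> of norm \<open>O(p k powr (- 1 / 2))\<close>. The box means are controlled by the Hardy--Littlewood
  inequality; the errors by Chebyshev's inequality, because the sum over \<open>k\<close> of \<open>f^2 / p k\<close> restricted to
  \<open>f \<le> t * p k\<close> is \<open>O(t * f)\<close> pointwise.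

  For the Weil bound, let \<open>c m\<close> be the sum of \<open>\<psi> (\<Sum> f (root of h))\<close> over the monic \<open>h\<close> of degree \<open>m\<close>. It
  vanishes for \<open>m \<ge> degree f\<close>, and unique factorization gives Newton's identities between the \<open>c m\<close> and the
  sums \<open>S n\<close> of \<open>\<psi> \<circ> trace \<circ> f\<close> over the field with \<open>p^n\<close> elements, so \<open>S n\<close> is minus the sum of the
  \<open>n\<close>-th powers of \<open>degree f - 1\<close> complex numbers. Stepanov's method bounds \<open>S (2 * m)\<close> by a constant times
  \<open>p^m\<close>, which forces these numbers to have modulus at most \<open>sqrt p\<close>. The fields with \<open>p^n\<close>
  elements never appear: their points are represented by the irreducible polynomials over the prime field.
\<close>

section \<open>Stepanov's method\<close>

text \<open>The height \<open>t * p k\<close> is forced from both sides. An average at scale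
  \<open>k\<close> has \<open>p k\<close> terms, so a value above \<open>t * p k\<close> alone lifts
  it above \<open>t\<close>, and is sampled from at most \<open>p k\<close> positions. Below that
  height, square-root cancellation gains only \<open>1 / p k\<close> in the squared l^2 norm. Since
  \<open>p k\<close> grows geometrically, both sums over \<open>k\<close> are governed by the scales
  with \<open>p k\<close> near \<open>f / t\<close>, and nothing is lost in summing.

  A point of the field with \<open>p^n\<close> elements is a root of a prime polynomial
  \<open>P\<close> with \<open>degree P\<close> dividing \<open>n\<close>, and \<open>P\<close>
  accounts for \<open>degree P\<close> such points; the trace of \<open>f\<close> there is
  \<open>n div degree P\<close> times the sum of \<open>f\<close> over the roots of
  \<open>P\<close>. Stepanov's polynomial only bounds from above how often the trace takes a given
  value. Added over all \<open>p\<close> values, these bounds exceed the total \<open>p^n\<close> by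
  the error terms alone, so they control the character sum as well. The factor \<open>p\<close> lost
  there is harmless: only the exponential rate of the power sums matters.\<close>

lemma sum_power_CARD_poly:
  fixes g :: "'b \<Rightarrow> 'a :: prime_card mod_ring poly"
  shows "(\<Sum>i\<in>A. g i) ^ (CARD('a) ^ n) = (\<Sum>i\<in>A. g i ^ (CARD('a) ^ n))"
proof (induction A rule: infinite_finite_induct)
  case (insert x F)
  then show ?case by (simp add: add_power_prime_poly_mod_ring)
qed (simp_all add: power_0_left)

lemma smult_power_CARD_poly:
  fixes u :: "'a :: prime_card mod_ring poly"
  shows "(Polynomial.smult c u) ^ (CARD('a) ^ n) = Polynomial.smult c (u ^ (CARD('a) ^ n))"
  by (metis fermat_theorem_mod_ring2 smult_power)

text \<open>The coefficients lie in the prime field, so a Frobenius power acts on \<open>u\<close>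
  only through its variable.\<close>

lemma dvd_power_CARD_minus_self:
  fixes P u :: "'a :: prime_card mod_ring poly"
  assumes "P dvd monom 1 1 ^ (CARD('a) ^ e) - monom 1 1"
  shows "P dvd u ^ (CARD('a) ^ e) - u"
proof (induction u)
  case 0
  then show ?case by (simp add: power_0_left)
next
  case (pCons c u)
  let ?X = "monom 1 1 :: 'a mod_ring poly" and ?q = "CARD('a) ^ e"
  have eq: "pCons c u = [:c:] + ?X * u"
    by (simp add: monom_altdef)
  have "(pCons c u) ^ ?q - pCons c u = ?X ^ ?q * (u ^ ?q - u) + (?X ^ ?q - ?X) * u"
    unfolding eq add_power_prime_poly_mod_ring power_mult_distrib fermat_theorem_power_poly
    by (simp add: algebra_simps)
  then show ?case using assms pCons.IH by simp
qed

text \<open>The summand of largest degree has nothing to cancel against.\<close>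

lemma sum_poly_nonzero:
  fixes f :: "'b \<Rightarrow> 'c :: comm_ring_1 poly"
  assumes "finite A" and "inj_on (\<lambda>i. degree (f i)) {i \<in> A. f i \<noteq> 0}" and "i \<in> A" and "f i \<noteq> 0"
  shows "sum f A \<noteq> 0"
proof -
  let ?B = "{i \<in> A. f i \<noteq> 0}"
  let ?n = "Max ((\<lambda>i. degree (f i)) ` ?B)"
  have "?n \<in> (\<lambda>i. degree (f i)) ` ?B" using assms by (intro Max_in) auto
  then obtain k where k: "k \<in> ?B" "?n = degree (f k)" by auto
  have z: "coeff (f j) (degree (f k)) = 0" if "j \<in> A - {k}" for j
  proof (cases "f j = 0")
    case False
    have "degree (f j) \<le> ?n" using that False assms(1) by (intro Max_ge) auto
    moreover have "degree (f j) \<noteq> degree (f k)"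
      using assms(2) that False k(1) unfolding inj_on_def by auto
    ultimately show ?thesis using k(2) by (intro coeff_eq_0) auto
  qed auto
  have "coeff (sum f A) (degree (f k)) = (\<Sum>j\<in>A. coeff (f j) (degree (f k)))"
    by (simp add: coeff_sum)
  also have "\<dots> = coeff (f k) (degree (f k))"
    using k(1) assms(1) z by (subst sum.remove[of _ k]) auto
  finally show ?thesis using k(1) by auto
qed

lemma degree_sum_power_CARD:
  fixes f :: "'a :: prime_card mod_ring poly"
  assumes "degree f > 0"
  shows "degree (\<Sum>i<Suc m. f ^ (CARD('a) ^ i)) = degree f * CARD('a) ^ m"
proof (induction m)
  case 0
  then show ?case by simp
next
  case (Suc m)
  have p: "1 < CARD('a)" using prime_gt_1_nat[OF prime_card[where ?'a = 'a]] by simp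
  have f0: "f \<noteq> 0" using assms by auto
  have d: "degree (f ^ (CARD('a) ^ Suc m)) = degree f * CARD('a) ^ Suc m"
    using f0 by (simp add: degree_power_eq mult.commute)
  have "degree (\<Sum>i<Suc m. f ^ (CARD('a) ^ i)) < degree (f ^ (CARD('a) ^ Suc m))"
    unfolding Suc d using assms p by simp
  then show ?case
    by (subst sum.lessThan_Suc) (simp only: degree_add_eq_right d)
qed

text \<open>These are the degrees of Stepanov's products. The remainder modulo \<open>r\<close>
  gives \<open>i\<close>; after division by \<open>r\<close>, the remainder modulo \<open>p\<close>
  gives \<open>v\<close>, because \<open>0 < d < p\<close> makes \<open>d\<close> invertible
  there.\<close>

lemma stepanov_index_inj:
  fixes d p r :: nat
  assumes "prime p" and "0 < d" and "d < p" and "0 < r"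
    and "i < r" "i' < r" "v < p" "v' < p"
    and eq: "i + r * p * j + v * (d * r) = i' + r * p * j' + v' * (d * r)"
  shows "i = i' \<and> j = j' \<and> v = v'"
proof -
  have e: "i + r * (p * j + v * d) = i' + r * (p * j' + v' * d)"
    using eq by (simp add: algebra_simps)
  have "(i + r * (p * j + v * d)) mod r = i" "(i' + r * (p * j' + v' * d)) mod r = i'"
    using assms by simp_all
  then have i: "i = i'" using e by simp
  then have e2: "p * j + v * d = p * j' + v' * d" using e \<open>0 < r\<close> by simp
  have "[v * d = v' * d] (mod p)"
  proof -
    have "(p * j + v * d) mod p = (p * j' + v' * d) mod p" using e2 by simp
    then show ?thesis by (simp add: Cong.cong_def)
  qed
  moreover have "algebraic_semidom_class.coprime d p"
  proof -
    have "\<not> p dvd d" using assms by (simp add: nat_dvd_not_less)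
    then have "algebraic_semidom_class.coprime p d" using assms(1) by (rule prime_imp_coprime[rotated])
    then show ?thesis by (simp add: algebraic_semidom_class.coprime_commute)
  qed
  ultimately have "[v = v'] (mod p)"
    by (simp add: cong_mult_rcancel_nat)
  then have "v = v'" using assms by (simp add: Cong.cong_def)
  then show ?thesis using e2 i assms by auto
qed

text \<open>Stepanov's auxiliary polynomial \<open>\<phi>\<close> is a combination of the \<open>X^(i + q * j) * t^v\<close>, whose degrees are
  distinct. Modulo \<open>P\<close> its \<open>q\<close>-th power is the same combination of the \<open>X^(i * q + j) * (c0 - t)^v\<close>; these
  have such small degrees that, by counting, the combination can be chosen to vanish identically.\<close>

lemma stepanov_auxiliary_poly:
  fixes f :: "'a :: prime_card mod_ring poly" and c0 :: "'a mod_ring" and m :: nat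
  defines "p \<equiv> CARD('a)" and "d \<equiv> degree f"
  defines "r \<equiv> p ^ (m - 1)" and "q \<equiv> p ^ m" and "t \<equiv> (\<Sum>i<m. f ^ (p ^ i))"
  assumes d0: "0 < d" and dp: "d < p" and m3: "3 \<le> m"
  obtains \<phi> where "\<phi> \<noteq> 0" and "degree \<phi> \<le> r * q + (2 * d + 1) * q"
    and "\<And>P. prime_elem P \<Longrightarrow> P dvd monom 1 1 ^ (p ^ (2 * m)) - monom 1 1 \<Longrightarrow>
           P dvd t ^ q + t - [:c0:] \<Longrightarrow> P dvd \<phi>"
proof -
  have p1: "1 < p" using prime_gt_1_nat[OF prime_card[where ?'a = 'a]] by (simp add: p_def)
  have primep: "prime p" by (simp add: p_def prime_card)
  have q: "q = r * p" using m3 unfolding q_def r_def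
    by (metis One_nat_def Suc_diff_Suc Suc_le_lessD diff_zero le_trans mult.commute one_le_numeral power_Suc)
  have r0: "0 < r" using p1 by (simp add: r_def)
  have q0: "0 < q" using p1 by (simp add: q_def)
  \<comment> \<open>With \<open>m >= 3\<close>, \<open>r\<close> has at least two factors
    \<open>p\<close>; this is what later gives \<open>J < q\<close>.\<close>
  have rd: "d + 1 < r"
  proof -
    have "d + 1 \<le> p" using dp by simp
    also have "p < p ^ 2" using p1 by (simp add: power2_eq_square)
    also have "p ^ 2 \<le> r" using p1 m3 unfolding r_def by (intro power_increasing) auto
    finally show ?thesis .
  qed
  have degt: "degree t = d * r"
  proof -
    have "m = Suc (m - 1)" using m3 by simp
    then show ?thesis using degree_sum_power_CARD[of f "m - 1"] d0
      unfolding t_def p_def d_def r_def by metis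
  qed
  have t0: "t \<noteq> 0" using degt d0 r0 by force
  \<comment> \<open>There are \<open>q * J\<close> free coefficients and \<open>B\<close>
    conditions; this \<open>J\<close> makes the surplus equal to \<open>q - J\<close>, which is
    positive.\<close>
  define J where "J = r + d + 1"
  define A where "A = {..<r} \<times> {..<J} \<times> {..<p}"
  define B where "B = r * q + d * q + J"
  define u where "u = (\<lambda>(i, j, v). monom 1 (i + q * j) * t ^ v)"
  define w where "w = (\<lambda>(i, j, v). monom 1 (i * q + j) * ([:c0:] - t) ^ v)"
  define \<Phi> where "\<Phi> c = (\<Sum>x\<in>A. Polynomial.smult (c x) (u x))" for c
  define \<Psi> where "\<Psi> c = (\<Sum>x\<in>A. Polynomial.smult (c x) (w x))" for c :: "nat \<times> nat \<times> nat \<Rightarrow> 'a mod_ring"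
  have finA: "finite A" by (simp add: A_def)
  have u0: "u x \<noteq> 0" for x using t0 by (auto simp: u_def split: prod.splits)
  have degu: "degree (u (i, j, v)) = i + r * p * j + v * (d * r)" for i j v
    using t0 by (simp add: u_def degree_mult_eq degree_monom_eq degree_power_eq degt q)
  have degw: "degree (w x) < B" if "x \<in> A" for x
  proof -
    obtain i j v where x: "x = (i, j, v)" by (cases x) auto
    have b: "i < r" "j < J" "v < p" using that by (auto simp: A_def x)
    have "degree ([:c0:] - t) \<le> d * r"
      using degree_diff_le_max[of "[:c0:]" t] degt by simp
    then have "degree (([:c0:] - t) ^ v) \<le> (d * r) * v"
      using degree_power_le[of "[:c0:] - t" v] by (meson le_trans mult_le_mono1)
    then have "degree (w x) \<le> (i * q + j) + (d * r) * v"
      unfolding w_def x by (simp add: degree_mult_le[THEN le_trans] degree_monom_eq)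
    also have "\<dots> < r * q + d * q + J"
    proof -
      have "i * q \<le> r * q" using b by simp
      moreover have "(d * r) * v \<le> d * q" using b q by simp
      ultimately show ?thesis using b by linarith
    qed
    finally show ?thesis by (simp add: B_def)
  qed
  have deg\<Psi>: "degree (\<Psi> c) < B" for c
    unfolding \<Psi>_def
    by (rule degree_sum_less) (use degw B_def q0 r0 in \<open>auto intro: le_less_trans[OF degree_smult_le]\<close>)
  \<comment> \<open>Pigeonhole in place of linear algebra: \<open>p^(q * J)\<close> coefficient
    families have at most \<open>p^B\<close> values of \<open>\<Psi>\<close>.\<close>
  obtain c c' where c: "c \<in> A \<rightarrow>\<^sub>E UNIV" "c' \<in> A \<rightarrow>\<^sub>E UNIV" "c \<noteq> c'" "\<Psi> c = \<Psi> c'"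
  proof -
    let ?g = "\<lambda>c. restrict (coeff (\<Psi> c)) {..<B}"
    have cardA: "card A = q * J" by (simp add: A_def q)
    have BJ: "B < q * J"
    proof -
      have "q * J = r * q + d * q + q" by (simp add: J_def algebra_simps)
      moreover have "J < q"
      proof -
        have "J < r + r" using rd by (simp add: J_def)
        also have "\<dots> \<le> q" using p1 mult_le_mono2[of 2 p r] unfolding q by linarith
        finally show ?thesis .
      qed
      ultimately show ?thesis by (simp add: B_def)
    qed
    have "card ({..<B} \<rightarrow>\<^sub>E (UNIV :: 'a mod_ring set)) = p ^ B"
      by (simp add: card_PiE p_def)
    moreover have "card (A \<rightarrow>\<^sub>E (UNIV :: 'a mod_ring set)) = p ^ (q * J)"
      using finA by (simp add: card_PiE p_def cardA)
    moreover have "p ^ B < p ^ (q * J)" using BJ p1 by simp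
    moreover have "card (?g ` (A \<rightarrow>\<^sub>E UNIV)) \<le> card ({..<B} \<rightarrow>\<^sub>E (UNIV :: 'a mod_ring set))"
      by (intro card_mono finite_PiE image_subsetI restrict_PiE_iff[THEN iffD2]) auto
    ultimately have "\<not> inj_on ?g (A \<rightarrow>\<^sub>E UNIV)"
      by (intro pigeonhole) simp
    then obtain c c' where *: "c \<in> A \<rightarrow>\<^sub>E UNIV" "c' \<in> A \<rightarrow>\<^sub>E UNIV" "c \<noteq> c'" "?g c = ?g c'"
      unfolding inj_on_def by blast
    have "coeff (\<Psi> c) n = coeff (\<Psi> c') n" for n
    proof (cases "n < B")
      case True
      then show ?thesis using fun_cong[OF *(4), of n] by simp
    next
      case False
      then show ?thesis using deg\<Psi>[of c] deg\<Psi>[of c'] by (simp add: coeff_eq_0)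
    qed
    then show ?thesis using that * by (simp add: poly_eq_iff)
  qed
  define b where "b x = c x - c' x" for x
  have \<Psi>b: "\<Psi> b = 0"
    using c(4) by (simp add: \<Psi>_def b_def smult_diff_left sum_subtractf)
  obtain x0 where x0: "x0 \<in> A" "b x0 \<noteq> 0"
  proof -
    have "\<exists>x. c x \<noteq> c' x"
    proof (rule ccontr)
      assume "\<not> (\<exists>x. c x \<noteq> c' x)"
      then have "c = c'" by (intro ext) blast
      then show False using c(3) by simp
    qed
    then obtain x where "c x \<noteq> c' x" by blast
    moreover have "x \<in> A" using c(1,2) calculation by (metis PiE_arb)
    ultimately show ?thesis using that by (auto simp: b_def)
  qed
  have "\<Phi> b \<noteq> 0"
    unfolding \<Phi>_def
  proof (rule sum_poly_nonzero[OF finA _ x0(1)])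
    show "Polynomial.smult (b x0) (u x0) \<noteq> 0" using x0 u0 by simp
    show "inj_on (\<lambda>i. degree (Polynomial.smult (b i) (u i))) {i \<in> A. Polynomial.smult (b i) (u i) \<noteq> 0}"
    proof (rule inj_onI)
      fix x y
      assume xy: "x \<in> {i \<in> A. Polynomial.smult (b i) (u i) \<noteq> 0}" "y \<in> {i \<in> A. Polynomial.smult (b i) (u i) \<noteq> 0}"
        and eq: "degree (Polynomial.smult (b x) (u x)) = degree (Polynomial.smult (b y) (u y))"
      obtain i j v where x: "x = (i, j, v)" by (cases x) auto
      obtain i' j' v' where y: "y = (i', j', v')" by (cases y) auto
      have "b x \<noteq> 0" "b y \<noteq> 0" using xy by auto
      then have "degree (u x) = degree (u y)" using eq by simp
      then have e: "i + r * p * j + v * (d * r) = i' + r * p * j' + v' * (d * r)"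
        unfolding x y degu .
      have bd: "i < r" "i' < r" "v < p" "v' < p" using xy by (auto simp: A_def x y)
      show "x = y" using stepanov_index_inj[OF primep d0 dp r0 bd e] by (simp add: x y)
    qed
  qed
  moreover have "degree (\<Phi> b) \<le> r * q + (2 * d + 1) * q"
    unfolding \<Phi>_def
  proof (rule degree_sum_le[OF finA])
    fix x assume x: "x \<in> A"
    obtain i j v where xx: "x = (i, j, v)" by (cases x) auto
    have bb: "i < r" "j < J" "v < p" using x by (auto simp: A_def xx)
    have "degree (Polynomial.smult (b x) (u x)) \<le> degree (u x)" by (rule degree_smult_le)
    also have "\<dots> = i + q * j + v * (d * r)" by (simp add: xx degu q)
    also have "\<dots> \<le> r * q + (2 * d + 1) * q"
    proof -
      have "r * 1 \<le> r * p" using p1 by (intro mult_le_mono2) simp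
      then have "i \<le> q" using bb q by linarith
      moreover have "q * j \<le> q * (r + d)" using bb by (simp add: J_def)
      moreover have "v * (d * r) \<le> p * (d * r)" using bb by (intro mult_le_mono1) simp
      moreover have "q * (r + d) = r * q + d * q" "p * (d * r) = d * q" "(2 * d + 1) * q = 2 * (d * q) + q"
        by (simp_all add: q algebra_simps)
      ultimately show ?thesis by linarith
    qed
    finally show "degree (Polynomial.smult (b x) (u x)) \<le> r * q + (2 * d + 1) * q" .
  qed
  moreover have "P dvd \<Phi> b" if P: "prime_elem P" "P dvd monom 1 1 ^ (p ^ (2 * m)) - monom 1 1"
    "P dvd t ^ q + t - [:c0:]" for P
  proof -
    \<comment> \<open>\<open>t^q + t\<close> is the trace over all \<open>2 * m\<close> Frobenius
      powers. The condition on \<open>P\<close> trades \<open>t^q\<close> for \<open>c0 - t\<close>,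
      whose degree is smaller by the factor \<open>q\<close>.\<close>
    have tq: "[t ^ q = [:c0:] - t] (mod P)"
      using P(3) by (simp add: cong_iff_dvd_diff algebra_simps)
    have qq: "q * q = p ^ (2 * m)" by (simp add: q_def power_add[symmetric] mult_2)
    have Xq: "[monom 1 (q * q * j) = monom 1 j] (mod P)" for j
    proof -
      have "[monom 1 1 ^ (q * q) = (monom 1 1 :: 'a mod_ring poly)] (mod P)"
        using P(2) by (simp add: cong_iff_dvd_diff qq)
      then have "[(monom 1 1 ^ (q * q)) ^ j = (monom 1 1 :: 'a mod_ring poly) ^ j] (mod P)"
        by (rule cong_pow)
      then show ?thesis by (simp add: monom_power power_mult[symmetric])
    qed
    have uw: "[(u x) ^ q = w x] (mod P)" for x
    proof -
      obtain i j v where xx: "x = (i, j, v)" by (cases x) auto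
      have "(u x) ^ q = monom 1 (i * q) * monom 1 (q * q * j) * (t ^ q) ^ v"
        by (simp add: xx u_def power_mult_distrib monom_power mult_monom power_mult[symmetric] algebra_simps)
      also have "[\<dots> = monom 1 (i * q) * monom 1 j * ([:c0:] - t) ^ v] (mod P)"
        by (intro cong_mult cong_refl Xq cong_pow tq)
      also have "monom 1 (i * q) * monom 1 j * ([:c0:] - t) ^ v = w x"
        by (simp add: xx w_def mult_monom)
      finally show ?thesis .
    qed
    have "(\<Phi> b) ^ q = (\<Sum>x\<in>A. Polynomial.smult (b x) (u x ^ q))"
      unfolding \<Phi>_def q_def p_def by (simp add: sum_power_CARD_poly smult_power_CARD_poly)
    also have "[\<dots> = \<Psi> b] (mod P)"
      unfolding \<Psi>_def
    proof (rule cong_sum)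
      fix x
      show "[Polynomial.smult (b x) (u x ^ q) = Polynomial.smult (b x) (w x)] (mod P)"
        using cong_mult[OF cong_refl[of "[:b x:]"] uw[of x]] by simp
    qed
    finally have "P dvd (\<Phi> b) ^ q" by (simp add: \<Psi>b cong_0_iff)
    then show ?thesis by (rule prime_elem_dvd_power[OF P(1)])
  qed
  ultimately show ?thesis by (rule that)
qed

section \<open>Power sums of roots\<close>

text \<open>This is \<open>S = - X * H' / H\<close>, which turns products into sums; for a product
  of factors \<open>1 - c i * X\<close>, \<open>S\<close> generates the power sums of the
  \<open>c i\<close>. Multiplied out, it makes sense over any commutative ring, in particular for
  coefficients that are themselves polynomials.\<close>

definition log_deriv_rel :: "'a :: comm_ring_1 fps \<Rightarrow> 'a fps \<Rightarrow> bool" where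
  "log_deriv_rel H S \<longleftrightarrow> H * S = - fps_X * fps_deriv H"

lemma log_deriv_rel_1: "log_deriv_rel 1 0"
  by (simp add: log_deriv_rel_def)

lemma log_deriv_rel_mult:
  assumes "log_deriv_rel H S" and "log_deriv_rel H' S'"
  shows "log_deriv_rel (H * H') (S + S')"
proof -
  have "H * H' * (S + S') = H' * (H * S) + H * (H' * S')" by (simp add: algebra_simps)
  also have "\<dots> = - fps_X * fps_deriv (H * H')"
    using assms by (simp add: log_deriv_rel_def algebra_simps)
  finally show ?thesis by (simp add: log_deriv_rel_def)
qed

lemma log_deriv_rel_linear:
  fixes c :: "'a :: comm_ring_1"
  shows "log_deriv_rel (1 - fps_const c * fps_X) (Abs_fps (\<lambda>k. if k = 0 then 0 else c ^ k))"
proof -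
  define S where "S = Abs_fps (\<lambda>k. if k = 0 then 0 else c ^ k)"
  have "S - fps_const c * (fps_X * S) = fps_const c * fps_X"
  proof (rule fps_ext)
    fix n
    show "fps_nth (S - fps_const c * (fps_X * S)) n = fps_nth (fps_const c * fps_X) n"
    proof (cases n)
      case 0
      then show ?thesis by (simp add: S_def)
    next
      case (Suc m)
      show ?thesis unfolding Suc by (cases m) (simp_all add: S_def)
    qed
  qed
  moreover have "(1 - fps_const c * fps_X) * S = S - fps_const c * (fps_X * S)"
    by (simp only: left_diff_distrib mult_1_left mult.assoc)
  moreover have "fps_deriv (1 - fps_const c * fps_X) = - fps_const c"
    by simp
  ultimately show ?thesis
    unfolding log_deriv_rel_def S_def[symmetric] by (simp only:) (simp only: minus_mult_minus mult.commute)
qed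

lemma log_deriv_rel_prod:
  fixes c :: "'b \<Rightarrow> 'a :: comm_ring_1"
  assumes "finite A"
  shows "log_deriv_rel (\<Prod>i\<in>A. 1 - fps_const (c i) * fps_X)
           (Abs_fps (\<lambda>k. if k = 0 then 0 else \<Sum>i\<in>A. c i ^ k))"
  using assms
proof (induction A)
  case empty
  have "Abs_fps (\<lambda>k. if k = 0 then 0 else \<Sum>i\<in>{}. c i ^ k) = 0"
    by (rule fps_ext) simp
  then show ?case by (simp add: log_deriv_rel_1)
next
  case (insert x F)
  have eq: "Abs_fps (\<lambda>k. if k = 0 then 0 else \<Sum>i\<in>insert x F. c i ^ k) =
      Abs_fps (\<lambda>k. if k = 0 then 0 else c x ^ k) + Abs_fps (\<lambda>k. if k = 0 then 0 else \<Sum>i\<in>F. c i ^ k)"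
    using insert by (intro fps_ext) simp
  show ?case
    unfolding prod.insert[OF insert.hyps] eq
    by (rule log_deriv_rel_mult[OF log_deriv_rel_linear insert.IH])
qed

text \<open>Newton's recursion for power sums. It never divides by \<open>k\<close>, so it can be
  used in characteristic \<open>p\<close>.\<close>

lemma log_deriv_rel_nth:
  assumes "log_deriv_rel H S" and "fps_nth H 0 = 1"
  shows "fps_nth S k = - of_nat k * fps_nth H k - (\<Sum>i=1..k. fps_nth H i * fps_nth S (k - i))"
proof -
  have "fps_nth (H * S) k = fps_nth (- fps_X * fps_deriv H) k"
    using assms(1) by (simp only: log_deriv_rel_def)
  moreover have "fps_nth (- fps_X * fps_deriv H) k = - of_nat k * fps_nth H k"
  proof (cases k)
    case (Suc m)
    have "fps_nth (- fps_X * fps_deriv H) (Suc m) = - fps_nth (fps_X * fps_deriv H) (Suc m)"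
      by (simp only: mult_minus_left fps_neg_nth)
    also have "fps_nth (fps_X * fps_deriv H) (Suc m) = of_nat (Suc m) * fps_nth H (Suc m)"
      by simp
    finally show ?thesis unfolding Suc by (simp only: mult_minus_left)
  qed simp
  moreover have "fps_nth (H * S) k = fps_nth S k + (\<Sum>i=1..k. fps_nth H i * fps_nth S (k - i))"
    using sum.atLeast_Suc_atMost[of 0 k "\<lambda>i. fps_nth H i * fps_nth S (k - i)"]
    by (simp add: fps_mult_nth assms(2))
  ultimately show ?thesis by (simp add: algebra_simps)
qed

text \<open>Newton's recursion computes the coefficients of \<open>S\<close> from those of
  \<open>H\<close> by ring operations, which respect congruences. With \<open>P = 0\<close> the
  congruences are equalities.\<close>

lemma log_deriv_rel_cong:
  fixes H H' :: "'a :: comm_ring_1 fps"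
  assumes "log_deriv_rel H S" and "fps_nth H 0 = 1" and "log_deriv_rel H' S'" and "fps_nth H' 0 = 1"
    and "\<And>i. i \<le> n \<Longrightarrow> P dvd fps_nth H i - fps_nth H' i" and "k \<le> n"
  shows "P dvd fps_nth S k - fps_nth S' k"
  using \<open>k \<le> n\<close>
proof (induction k rule: less_induct)
  case (less k)
  have eq: "fps_nth S k - fps_nth S' k =
     - (of_nat k * (fps_nth H k - fps_nth H' k)) -
       (\<Sum>i=1..k. (fps_nth H i - fps_nth H' i) * fps_nth S (k - i) +
                   fps_nth H' i * (fps_nth S (k - i) - fps_nth S' (k - i)))"
    unfolding log_deriv_rel_nth[OF assms(1,2), of k] log_deriv_rel_nth[OF assms(3,4), of k]
    by (simp add: algebra_simps sum.distrib sum_subtractf)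
  have "P dvd (fps_nth H i - fps_nth H' i) * fps_nth S (k - i) +
                   fps_nth H' i * (fps_nth S (k - i) - fps_nth S' (k - i))" if "i \<in> {1..k}" for i
    using that less assms(5)[of i] by (intro dvd_add dvd_mult dvd_mult2) auto
  then have "P dvd (\<Sum>i=1..k. (fps_nth H i - fps_nth H' i) * fps_nth S (k - i) +
                   fps_nth H' i * (fps_nth S (k - i) - fps_nth S' (k - i)))"
    by (rule dvd_sum)
  moreover have "P dvd - (of_nat k * (fps_nth H k - fps_nth H' k))"
    using assms(5)[OF less.prems] by (subst dvd_minus_iff) (rule dvd_mult)
  ultimately show ?case unfolding eq by (rule dvd_diff[rotated])
qed

lemma log_deriv_rel_unique:
  fixes H :: "'a :: idom fps"
  assumes "log_deriv_rel H S" and "fps_nth H 0 = 1" and "log_deriv_rel H S'"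
  shows "S = S'"
proof -
  have "H * (S - S') = 0" using assms by (simp add: log_deriv_rel_def right_diff_distrib)
  moreover have "H \<noteq> 0" using assms(2) by auto
  ultimately show ?thesis by simp
qed

lemma fps_of_poly_reflect_linear:
  fixes x :: "'a :: comm_ring_1"
  shows "fps_of_poly (reflect_poly [:- x, 1:]) = 1 - fps_const x * fps_X"
proof (rule fps_ext)
  fix i :: nat
  consider "i = 0" | "i = 1" | "i \<ge> 2" by linarith
  then show "fps_nth (fps_of_poly (reflect_poly [:- x, 1:])) i = fps_nth (1 - fps_const x * fps_X) i"
    by cases (auto simp: coeff_reflect_poly)
qed

text \<open>The \<open>k\<close>-th coefficient is the sum of the \<open>k\<close>-th powers of the roots of \<open>h\<close>.\<close>

definition root_power_sums :: "'a :: field poly \<Rightarrow> 'a fps" where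
  "root_power_sums h = - fps_X * fps_deriv (fps_of_poly (reflect_poly h)) / fps_of_poly (reflect_poly h)"

lemma root_power_sums_rel:
  fixes h :: "'a :: field poly"
  assumes "monic h"
  shows "log_deriv_rel (fps_of_poly (reflect_poly h)) (root_power_sums h)"
    and "fps_nth (fps_of_poly (reflect_poly h)) 0 = 1"
proof -
  show *: "fps_nth (fps_of_poly (reflect_poly h)) 0 = 1" using assms by simp
  let ?H = "fps_of_poly (reflect_poly h)"
  have "?H * (- fps_X * fps_deriv ?H * inverse ?H) = - fps_X * fps_deriv ?H * (?H * inverse ?H)"
    by (simp only: mult.assoc mult.left_commute[of ?H])
  also have "?H * inverse ?H = 1" using * by (intro inverse_mult_eq_1') simp
  finally show "log_deriv_rel ?H (root_power_sums h)"
    using * by (simp add: log_deriv_rel_def root_power_sums_def fps_divide_unit)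
qed

lemma root_power_sums_mult:
  fixes g h :: "'a :: field poly"
  assumes "monic g" and "monic h"
  shows "root_power_sums (g * h) = root_power_sums g + root_power_sums h"
proof -
  note g = root_power_sums_rel[OF assms(1)] and h = root_power_sums_rel[OF assms(2)]
  have m: "monic (g * h)" using assms by (simp add: lead_coeff_mult)
  have "log_deriv_rel (fps_of_poly (reflect_poly (g * h))) (root_power_sums g + root_power_sums h)"
    using log_deriv_rel_mult[OF g(1) h(1)] by (simp add: reflect_poly_mult fps_of_poly_mult)
  then show ?thesis
    using log_deriv_rel_unique[OF root_power_sums_rel[OF m]] by blast
qed

text \<open>For monic \<open>h\<close> and \<open>f\<close> without constant term, this is the sum
  of \<open>f\<close> over the roots of \<open>h\<close> in a splitting field, with multiplicity.
  Going through power sums keeps everything in the ground field.\<close>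

definition root_sum :: "'a :: field poly \<Rightarrow> 'a poly \<Rightarrow> 'a" where
  "root_sum f h = (\<Sum>i=1..degree f. coeff f i * fps_nth (root_power_sums h) i)"

lemma root_sum_mult:
  assumes "monic g" and "monic h"
  shows "root_sum f (g * h) = root_sum f g + root_sum f h"
  by (simp add: root_sum_def root_power_sums_mult[OF assms] algebra_simps sum.distrib)

lemma root_sum_1: "root_sum f 1 = 0"
  by (simp add: root_sum_def root_power_sums_def)

lemma root_sum_linear: 
  assumes "coeff f 0 = 0"
  shows "root_sum f [:- x, 1:] = poly f x"
proof -
  have "fps_of_poly (reflect_poly [:- x, 1:]) = 1 - fps_const x * fps_X"
    by (rule fps_of_poly_reflect_linear)
  moreover have "monic [:- x, 1:]" by simp
  ultimately have "root_power_sums [:- x, 1:] = Abs_fps (\<lambda>k. if k = 0 then 0 else x ^ k)"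
    using log_deriv_rel_unique root_power_sums_rel log_deriv_rel_linear by metis
  then have "root_sum f [:- x, 1:] = (\<Sum>i=1..degree f. coeff f i * x ^ i)"
    by (simp add: root_sum_def)
  also have "\<dots> = (\<Sum>i\<le>degree f. coeff f i * x ^ i)"
    using assms sum.atLeast_Suc_atMost[of 0 "degree f" "\<lambda>i. coeff f i * x ^ i"]
    by (simp add: atMost_atLeast0)
  finally show ?thesis by (simp add: poly_altdef)
qed

text \<open>The changed coefficient is, up to sign, the elementary symmetric function of index
  \<open>degree f\<close> of the roots. It does not affect the power sums of smaller index and
  shifts that of index \<open>degree f\<close> by \<open>- degree f * b\<close>; no others enter
  \<open>root_sum f\<close>.\<close>

lemma root_sum_add_monom:
  fixes f h :: "'a :: field poly"
  assumes h: "monic h" and d: "0 < degree f" "degree f \<le> degree h"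
  shows "root_sum f (h + monom b (degree h - degree f)) = root_sum f h - of_nat (degree f) * coeff f (degree f) * b"
    and "monic (h + monom b (degree h - degree f))"
    and "degree (h + monom b (degree h - degree f)) = degree h"
proof -
  let ?d = "degree f" and ?h' = "h + monom b (degree h - degree f)"
  have lt: "degree (monom b (degree h - ?d)) < degree h"
    using d degree_monom_le[of b "degree h - ?d"] by linarith
  show deg: "degree ?h' = degree h" by (rule degree_add_eq_left[OF lt])
  show m: "monic ?h'"
    unfolding deg using coeff_eq_0[OF lt] h by simp
  let ?H = "fps_of_poly (reflect_poly h)" and ?H' = "fps_of_poly (reflect_poly ?h')"
  have nth: "fps_nth ?H' i = fps_nth ?H i + (if i = ?d then b else 0)" for i
    using d by (auto simp: coeff_reflect_poly deg)
  note h = root_power_sums_rel[OF h] and h' = root_power_sums_rel[OF m]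
  have eq: "fps_nth (root_power_sums ?h') k = fps_nth (root_power_sums h) k" if "k < ?d" for k
  proof -
    have "0 dvd fps_nth (root_power_sums ?h') k - fps_nth (root_power_sums h) k"
      by (rule log_deriv_rel_cong[OF h' h, of k]) (use that nth in auto)
    then show ?thesis by simp
  qed
  have s0: "fps_nth (root_power_sums h) 0 = 0"
    using log_deriv_rel_nth[OF h, of 0] by simp
  have sd: "fps_nth (root_power_sums ?h') ?d = fps_nth (root_power_sums h) ?d - of_nat ?d * b"
  proof -
    have "(\<Sum>i=1..?d. fps_nth ?H' i * fps_nth (root_power_sums ?h') (?d - i)) =
          (\<Sum>i=1..?d. fps_nth ?H i * fps_nth (root_power_sums h) (?d - i))"
    proof (rule sum.cong)
      fix i assume "i \<in> {1..?d}"
      then show "fps_nth ?H' i * fps_nth (root_power_sums ?h') (?d - i) =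
                 fps_nth ?H i * fps_nth (root_power_sums h) (?d - i)"
        using nth[of i] eq[of "?d - i"] s0 by (cases "i = ?d") auto
    qed simp
    then show ?thesis
      unfolding log_deriv_rel_nth[OF h', of ?d] log_deriv_rel_nth[OF h, of ?d]
      using nth[of ?d] by (simp add: algebra_simps)
  qed
  have "root_sum f ?h' - root_sum f h =
      (\<Sum>i=1..?d. coeff f i * (fps_nth (root_power_sums ?h') i - fps_nth (root_power_sums h) i))"
    by (simp add: root_sum_def algebra_simps sum_subtractf)
  also have "\<dots> = (\<Sum>i\<in>{?d}. coeff f i * (fps_nth (root_power_sums ?h') i - fps_nth (root_power_sums h) i))"
    using d eq by (intro sum.mono_neutral_right) auto
  also have "\<dots> = - (of_nat ?d * coeff f ?d * b)"
    using sd by simp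
  finally show "root_sum f ?h' = root_sum f h - of_nat ?d * coeff f ?d * b"
    by (simp add: algebra_simps)
qed

section \<open>Sums over monic polynomials\<close>

definition monics :: "nat \<Rightarrow> 'a :: comm_semiring_1 poly set" where
  "monics n = {h. monic h \<and> degree h = n}"

lemma monics_0: "monics 0 = {1 :: 'a :: comm_semiring_1 poly}"
proof -
  have "h = 1" if "monic h" "degree h = 0" for h :: "'a poly"
    using that monic_degree_0 by blast
  then show ?thesis by (auto simp: monics_def)
qed

lemma bij_betw_monics:
  "bij_betw (\<lambda>h. restrict (coeff h) {..<n}) (monics n :: 'a :: comm_ring_1 poly set) ({..<n} \<rightarrow>\<^sub>E UNIV)"
proof (rule bij_betwI')
  fix g h :: "'a poly"
  assume gh: "g \<in> monics n" "h \<in> monics n"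
  show "(restrict (coeff g) {..<n} = restrict (coeff h) {..<n}) = (g = h)"
  proof
    assume eq: "restrict (coeff g) {..<n} = restrict (coeff h) {..<n}"
    have "coeff g i = coeff h i" for i
    proof (cases i n rule: linorder_cases)
      case less
      then show ?thesis using fun_cong[OF eq, of i] by simp
    qed (use gh in \<open>auto simp: monics_def coeff_eq_0\<close>)
    then show "g = h" by (simp add: poly_eq_iff)
  qed simp
next
  fix g :: "nat \<Rightarrow> 'a"
  assume g: "g \<in> {..<n} \<rightarrow>\<^sub>E UNIV"
  define h where "h = monom 1 n + (\<Sum>i<n. monom (g i) i)"
  have c: "coeff h i = (if i = n then 1 else if i < n then g i else 0)" for i
    by (auto simp: h_def coeff_sum)
  have "degree h = n"
    by (rule antisym[OF degree_le le_degree]) (auto simp: c)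
  moreover have "restrict (coeff h) {..<n} = g"
    using g by (auto simp: c fun_eq_iff PiE_def extensional_def)
  ultimately show "\<exists>h\<in>monics n. g = restrict (coeff h) {..<n}"
    by (intro bexI[of _ h]) (auto simp: monics_def c)
qed (auto simp: monics_def)

lemma finite_monics: "finite (monics n :: 'a :: {comm_ring_1, finite} poly set)"
  using bij_betw_finite[OF bij_betw_monics[of n, where ?'a = 'a]] by (simp add: finite_PiE)

lemma card_monics: "card (monics n :: 'a :: {comm_ring_1, finite} poly set) = CARD('a) ^ n"
  using bij_betw_same_card[OF bij_betw_monics[of n, where ?'a = 'a]] by (simp add: card_PiE)

lemma prime_poly_monic:
  fixes P :: "'a :: field_gcd poly"
  assumes "prime P"
  shows "monic P"
  using assms by (metis normalize_prime not_prime_0 monic_normalize)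

lemma prime_poly_degree:
  fixes P :: "'a :: field_gcd poly"
  assumes "prime P"
  shows "0 < degree P"
  using assms by (metis gr0I is_unit_iff_degree not_prime_0 not_prime_unit)

text \<open>The analogue of writing \<open>log n\<close> as the sum of the von Mangoldt function
  over the divisors of \<open>n\<close>. The set \<open>I\<close> may contain more pairs than those
  dividing \<open>h\<close>, so one \<open>I\<close> can serve all \<open>h\<close> of a given
  degree.\<close>

lemma degree_eq_sum_prime_powers:
  fixes h :: "'a :: field_gcd poly"
  assumes "monic h" and I: "finite I" "I \<subseteq> {(P, k). prime P \<and> 1 \<le> k}"
    and "\<And>P k. prime P \<Longrightarrow> 1 \<le> k \<Longrightarrow> P ^ k dvd h \<Longrightarrow> (P, k) \<in> I"
  shows "degree h = (\<Sum>(P, k)\<in>I. if P ^ k dvd h then degree P else 0)"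
proof -
  have h0: "h \<noteq> 0" using assms by auto
  have "(\<Sum>(P, k)\<in>I. if P ^ k dvd h then degree P else 0) =
        (\<Sum>(P, k)\<in>(SIGMA P:prime_factors h. {1..multiplicity P h}). degree P)"
  proof (rule sum.mono_neutral_cong_right[OF I(1)])
    show "(SIGMA P:prime_factors h. {1..multiplicity P h}) \<subseteq> I"
      using assms(4) h0 by (auto simp: in_prime_factors_iff multiplicity_dvd') 
    show "\<forall>i\<in>I - (SIGMA P:prime_factors h. {1..multiplicity P h}).
       (case i of (P, k) \<Rightarrow> if P ^ k dvd h then degree P else 0) = 0"
    proof
      fix x assume x: "x \<in> I - (SIGMA P:prime_factors h. {1..multiplicity P h})"
      obtain P k where xx: "x = (P, k)" by (cases x)
      have Pk: "prime P" "1 \<le> k" using I x by (auto simp: xx)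
      have "\<not> P ^ k dvd h"
      proof
        assume d: "P ^ k dvd h"
        have "P dvd P ^ k" using Pk by simp
        then have "P dvd h" using d by (rule dvd_trans)
        moreover have "k \<le> multiplicity P h"
          by (rule multiplicity_geI[OF h0 _ d]) (use Pk not_prime_unit in blast)
        ultimately show False using x Pk h0 by (auto simp: xx in_prime_factors_iff)
      qed
      then show "(case x of (P, k) \<Rightarrow> if P ^ k dvd h then degree P else 0) = 0" by (simp add: xx)
    qed
    show "\<And>x. x \<in> (SIGMA P:prime_factors h. {1..multiplicity P h}) \<Longrightarrow>
         (case x of (P, k) \<Rightarrow> if P ^ k dvd h then degree P else 0) = (case x of (P, k) \<Rightarrow> degree P)"
      by (auto simp: multiplicity_dvd')
  qed
  also have "\<dots> = (\<Sum>P\<in>prime_factors h. multiplicity P h * degree P)"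
    by (subst sum.Sigma[symmetric]) auto
  also have "\<dots> = degree (\<Prod>P\<in>prime_factors h. P ^ multiplicity P h)"
  proof -
    have "P \<noteq> 0" if "P \<in> prime_factors h" for P using that by (auto simp: in_prime_factors_iff)
    then show ?thesis
      by (subst degree_prod_eq_sum_degree) (auto simp: degree_power_eq mult.commute)
  qed
  also have "\<dots> = degree h"
    using prod_prime_factors[OF h0] normalize_monic[OF assms(1)] by simp
  finally show ?thesis by simp
qed

section \<open>Completely multiplicative functions on monic polynomials\<close>

locale monic_character =
  fixes lam :: "'a :: prime_card mod_ring poly \<Rightarrow> complex"
  assumes lam_1: "lam 1 = 1"
    and lam_mult: "monic g \<Longrightarrow> monic h \<Longrightarrow> lam (g * h) = lam g * lam h"
begin

definition monic_sum :: "nat \<Rightarrow> complex" where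
  "monic_sum n = (\<Sum>h\<in>monics n. lam h)"

text \<open>For \<open>n >= 1\<close> this is a coefficient of \<open>X * L' / L\<close>, where
  \<open>L\<close> generates the \<open>monic_sum n\<close>. For
  \<open>lam h = \<psi> (root_sum f h)\<close> it is the character sum over the field with
  \<open>p^n\<close> elements, each \<open>P\<close> standing for its \<open>degree P\<close> roots
  there.\<close>

definition prime_sum :: "nat \<Rightarrow> complex" where
  "prime_sum n = (\<Sum>P | prime P \<and> degree P dvd n. of_nat (degree P) * lam P ^ (n div degree P))"

lemma monic_sum_0: "monic_sum 0 = 1"
  by (simp add: monic_sum_def monics_0 lam_1)

lemma lam_power: "monic g \<Longrightarrow> lam (g ^ k) = lam g ^ k"
  by (induction k) (simp_all add: lam_1 lam_mult monic_power)

end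

lemma finite_primes_dvd:
  assumes "0 < n"
  shows "finite {P :: 'a :: prime_card mod_ring poly. prime P \<and> degree P dvd n}"
proof (rule finite_subset)
  show "{P :: 'a mod_ring poly. prime P \<and> degree P dvd n} \<subseteq> (\<Union>e\<le>n. monics e)"
    using assms by (auto simp: monics_def prime_poly_monic dest: dvd_imp_le)
qed (auto simp: finite_monics)

context monic_character begin

text \<open>Weight each \<open>h\<close> by its degree, expanded over the prime powers
  \<open>P^k\<close> dividing it; the cofactors of \<open>P^k\<close> run through all monic
  polynomials of degree \<open>n - k * degree P\<close>.\<close>

lemma newton_identity:
  "of_nat n * monic_sum n = (\<Sum>k=1..n. prime_sum k * monic_sum (n - k))"
proof -
  define I where "I = {(P, k). prime (P :: 'a mod_ring poly) \<and> 1 \<le> k \<and> k * degree P \<le> n}"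
  have finI: "finite I"
  proof (rule finite_subset)
    show "I \<subseteq> (\<Union>e\<le>n. monics e) \<times> {..n}"
    proof (clarsimp simp: I_def monics_def prime_poly_monic, goal_cases)
      case (1 P k)
      have "0 < degree P" using 1 prime_poly_degree by blast
      then have "k * 1 \<le> k * degree P" "1 * degree P \<le> k * degree P" using 1 by (auto intro!: mult_le_mono1)
      then show ?case using 1 by linarith
    qed
  qed (auto simp: finite_monics)
  have "of_nat n * monic_sum n = (\<Sum>h\<in>monics n. of_nat (degree h) * lam h)"
    by (simp add: monic_sum_def sum_distrib_left monics_def)
  also have "\<dots> = (\<Sum>h\<in>monics n. \<Sum>(P, k)\<in>I. if P ^ k dvd h then of_nat (degree P) * lam h else 0)"
  proof (rule sum.cong[OF refl])
    fix h :: "'a mod_ring poly"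
    assume h: "h \<in> monics n"
    have mh: "monic h" using h unfolding monics_def by blast
    have "degree h = (\<Sum>(P, k)\<in>I. if P ^ k dvd h then degree P else 0)"
    proof (rule degree_eq_sum_prime_powers[OF mh finI])
      show "I \<subseteq> {(P, k). prime P \<and> 1 \<le> k}" by (auto simp: I_def)
      fix P k assume P: "prime P" "1 \<le> k" "P ^ k dvd h"
      have "h \<noteq> 0" using mh by auto
      then have "degree (P ^ k) \<le> n" using P h by (auto simp: monics_def dest: dvd_imp_degree_le)
      moreover have "P \<noteq> 0" using P by auto
      ultimately show "(P, k) \<in> I" using P by (simp add: I_def degree_power_eq mult.commute)
    qed
    then show "of_nat (degree h) * lam h = (\<Sum>(P, k)\<in>I. if P ^ k dvd h then of_nat (degree P) * lam h else 0)"
      by (simp add: sum_distrib_right case_prod_unfold if_distrib[of of_nat] if_distribR cong: if_cong)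
         (intro sum.cong; simp)
  qed
  also have "\<dots> = (\<Sum>(P, k)\<in>I. \<Sum>h\<in>monics n. if P ^ k dvd h then of_nat (degree P) * lam h else 0)"
    by (subst sum.swap) (simp add: case_prod_unfold)
  also have "\<dots> = (\<Sum>(P, k)\<in>I. of_nat (degree P) * lam P ^ k * monic_sum (n - k * degree P))"
  proof (intro sum.cong refl, clarify, goal_cases)
    case (1 P k)
    then have P: "prime P" "1 \<le> k" "k * degree P \<le> n" by (auto simp: I_def)
    have mP: "monic P" using P prime_poly_monic by blast
    have mPk: "monic (P ^ k)" using mP by (simp add: monic_power)
    have P0: "P \<noteq> 0" using P by auto
    have "(\<Sum>h\<in>monics n. if P ^ k dvd h then of_nat (degree P) * lam h else 0) =
          (\<Sum>h\<in>{h\<in>monics n. P ^ k dvd h}. of_nat (degree P) * lam h)"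
      by (simp add: sum.inter_filter finite_monics)
    also have "\<dots> = (\<Sum>g\<in>monics (n - k * degree P). of_nat (degree P) * lam (P ^ k * g))"
    proof (rule sum.reindex_bij_betw[symmetric], rule bij_betw_imageI)
      show "inj_on ((*) (P ^ k)) (monics (n - k * degree P))"
        using P0 by (auto simp: inj_on_def)
      show "(*) (P ^ k) ` monics (n - k * degree P) = {h \<in> monics n. P ^ k dvd h}"
      proof (intro equalityI subsetI)
        fix h assume "h \<in> (*) (P ^ k) ` monics (n - k * degree P)"
        then obtain g where g: "g \<in> monics (n - k * degree P)" "h = P ^ k * g" by auto
        have "g \<noteq> 0" using g by (auto simp: monics_def)
        then show "h \<in> {h \<in> monics n. P ^ k dvd h}"
        proof -
          have "degree h = k * degree P + degree g"
            using g \<open>g \<noteq> 0\<close> P0 by (simp add: degree_mult_eq degree_power_eq mult.commute)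
          moreover have "lead_coeff h = lead_coeff (P ^ k) * lead_coeff g"
            unfolding g(2) by (rule lead_coeff_mult)
          moreover have "lead_coeff g = 1" "degree g = n - k * degree P"
            using g(1) unfolding monics_def by blast+
          ultimately have "degree h = n" "lead_coeff h = 1" using mPk P(3) by (linarith, metis mult_1)
          moreover have "P ^ k dvd h" using g(2) by simp
          ultimately show ?thesis unfolding monics_def by blast
        qed
      next
        fix h assume h: "h \<in> {h \<in> monics n. P ^ k dvd h}"
        then have "P ^ k dvd h" by simp
        then obtain g where g: "h = P ^ k * g" by (rule dvdE)
        have g0: "g \<noteq> 0" using h g by (auto simp: monics_def)
        have "lead_coeff h = lead_coeff (P ^ k) * lead_coeff g" unfolding g by (rule lead_coeff_mult)
        moreover have "lead_coeff h = 1" "degree h = n" using h unfolding monics_def by blast+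
        ultimately have "monic g" using mPk by (metis mult_1)
        have "degree h = k * degree P + degree g"
          using g g0 P0 by (simp add: degree_mult_eq degree_power_eq mult.commute)
        then have "degree g = n - k * degree P" using \<open>degree h = n\<close> by simp
        then have "g \<in> monics (n - k * degree P)"
          using \<open>monic g\<close> unfolding monics_def by blast
        then show "h \<in> (*) (P ^ k) ` monics (n - k * degree P)" using g by blast
      qed
    qed
    also have "\<dots> = (\<Sum>g\<in>monics (n - k * degree P). of_nat (degree P) * lam P ^ k * lam g)"
    proof (rule sum.cong[OF refl])
      fix g :: "'a mod_ring poly" assume "g \<in> monics (n - k * degree P)"
      then have "monic g" unfolding monics_def by blast
      then show "of_nat (degree P) * lam (P ^ k * g) = of_nat (degree P) * lam P ^ k * lam g"
        using mPk mP by (simp add: lam_mult lam_power)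
    qed
    finally show ?case by (simp add: monic_sum_def sum_distrib_left)
  qed
  \<comment> \<open>Collect the pairs with the same \<open>s = k * degree P\<close>;
    \<open>s\<close> and \<open>P\<close> determine \<open>k\<close>.\<close>
  also have "\<dots> = (\<Sum>(s, P)\<in>(SIGMA s:{1..n}. {P. prime P \<and> degree P dvd s}).
      of_nat (degree P) * lam P ^ (s div degree P) * monic_sum (n - s))"
  proof (rule sum.reindex_bij_witness[of _ "\<lambda>(s, P). (P, s div degree P)" "\<lambda>(P, k). (k * degree P, P)"], goal_cases)
    case (1 x)
    then show ?case using prime_poly_degree[of "fst x"] by (auto simp: I_def)
  next
    case (2 x)
    obtain P k where x: "x = (P, k)" by (cases x)
    have "0 < degree P" using 2 prime_poly_degree[of P] by (auto simp: I_def x)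
    then have "0 < k * degree P" using 2 by (auto simp: I_def x)
    then show ?case using 2 by (auto simp: I_def x)
  next
    case (3 x)
    then show ?case by auto
  next
    case (4 x)
    obtain s P where x: "x = (s, P)" by (cases x)
    have "0 < degree P" using 4 prime_poly_degree[of P] by (auto simp: x)
    then show ?case using 4 by (auto simp: I_def x dvd_imp_le div_greater_zero_iff Suc_le_eq)
  next
    case (5 x)
    then show ?case using prime_poly_degree[of "fst x"] by (auto simp: I_def)
  qed
  also have "\<dots> = (\<Sum>k=1..n. prime_sum k * monic_sum (n - k))"
    by (subst sum.Sigma[symmetric]) (auto simp: finite_primes_dvd prime_sum_def sum_distrib_right)
  finally show ?thesis .
qed

end

text \<open>This counts the field with \<open>p^n\<close> elements by minimal polynomials. For the
  constant character \<open>monic_sum k = p^k\<close>, and the identity for \<open>n + 1\<close>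
  minus \<open>p\<close> times the one for \<open>n\<close> isolates
  \<open>prime_sum (n + 1)\<close>.\<close>

lemma sum_degree_primes:
  assumes "0 < n"
  shows "(\<Sum>P | prime (P :: 'a :: prime_card mod_ring poly) \<and> degree P dvd n. degree P) = CARD('a) ^ n"
proof -
  interpret monic_character "\<lambda>_ :: 'a mod_ring poly. 1 :: complex" by unfold_locales auto
  let ?p = "of_nat CARD('a) :: complex"
  have ms: "monic_sum k = ?p ^ k" for k
    by (simp add: monic_sum_def card_monics)
  have "prime_sum (Suc n) = ?p ^ Suc n" for n
  proof -
    have a: "of_nat (Suc n) * ?p ^ Suc n = (\<Sum>k=1..Suc n. prime_sum k * ?p ^ (Suc n - k))"
      using newton_identity[of "Suc n"] by (simp add: ms)
    also have "\<dots> = prime_sum (Suc n) + (\<Sum>k=1..n. prime_sum k * ?p ^ (Suc n - k))"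
      by simp
    also have "(\<Sum>k=1..n. prime_sum k * ?p ^ (Suc n - k)) = ?p * (\<Sum>k=1..n. prime_sum k * ?p ^ (n - k))"
      by (simp add: sum_distrib_left Suc_diff_le algebra_simps)
    also have "(\<Sum>k=1..n. prime_sum k * ?p ^ (n - k)) = of_nat n * ?p ^ n"
      using newton_identity[of n] by (simp add: ms)
    finally show ?thesis by (simp add: algebra_simps)
  qed
  then have "prime_sum n = ?p ^ n" using assms by (metis gr0_implies_Suc)
  then have "of_nat (\<Sum>P | prime (P :: 'a mod_ring poly) \<and> degree P dvd n. degree P) = (of_nat (CARD('a) ^ n) :: complex)"
    by (simp add: prime_sum_def)
  then show ?thesis by (simp only: of_nat_eq_iff)
qed

section \<open>Characters and traces\<close>

locale additive_character =
  fixes \<psi> :: "'a :: prime_card mod_ring \<Rightarrow> complex"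
  assumes psi_add: "\<psi> (x + y) = \<psi> x * \<psi> y"
    and norm_psi: "cmod (\<psi> x) = 1"
    and psi_1: "\<psi> 1 \<noteq> 1"
begin

lemma psi_0: "\<psi> 0 = 1"
proof -
  have "\<psi> 0 * \<psi> 0 = \<psi> 0" using psi_add[of 0 0] by simp
  moreover have "\<psi> 0 \<noteq> 0" using norm_psi[of 0] by auto
  ultimately show ?thesis by simp
qed

lemma psi_of_nat_mult: "\<psi> (of_nat k * x) = \<psi> x ^ k"
  by (induction k) (simp_all add: psi_0 psi_add ring_distribs)

lemma sum_psi: "(\<Sum>x\<in>UNIV. \<psi> x) = 0"
proof -
  have "(\<Sum>x\<in>UNIV. \<psi> x) = (\<Sum>x\<in>UNIV. \<psi> (x + 1))"
    by (rule sum.reindex_bij_witness[of _ "\<lambda>x. x + 1" "\<lambda>x. x - 1"]) auto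
  also have "\<dots> = \<psi> 1 * (\<Sum>x\<in>UNIV. \<psi> x)"
    by (simp add: psi_add sum_distrib_left mult.commute)
  finally have "(1 - \<psi> 1) * (\<Sum>x\<in>UNIV. \<psi> x) = 0" by (simp add: algebra_simps)
  then show ?thesis using psi_1 by simp
qed

lemma monic_character_root_sum: "monic_character (\<lambda>h. \<psi> (root_sum f h))"
  by unfold_locales (simp_all add: root_sum_1 psi_0 root_sum_mult psi_add)

text \<open>Adding a multiple of \<open>X^(m - degree f)\<close> permutes \<open>monics m\<close>.
  The multiple is chosen to raise \<open>root_sum f\<close> by exactly 1, so the sum equals
  \<open>\<psi> 1\<close> times itself. The bound \<open>degree f < p\<close> makes the factor
  \<open>degree f\<close> invertible.\<close>

lemma sum_monics_eq_0:
  assumes "0 < degree f" and "degree f < CARD('a)" and "degree f \<le> m"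
  shows "(\<Sum>h\<in>monics m. \<psi> (root_sum f h)) = 0"
proof -
  have "\<not> CARD('a) dvd degree f" using assms by (simp add: nat_dvd_not_less)
  then have nz: "(of_nat (degree f) :: 'a mod_ring) \<noteq> 0" using of_nat_0_mod_ring_dvd by blast
  define u where "u = of_nat (degree f) * coeff f (degree f)"
  have u: "u \<noteq> 0" using nz assms(1) by (auto simp: u_def)
  define b where "b = - inverse u"
  have mem: "h + monom x (m - degree f) \<in> monics m" if "h \<in> monics m" for h and x :: "'a mod_ring"
  proof -
    have h: "monic h" "degree h = m" using that unfolding monics_def by blast+
    show ?thesis
      using root_sum_add_monom(2,3)[OF h(1) assms(1), of x] assms(3) h(2) unfolding monics_def by auto
  qed
  have "(\<Sum>h\<in>monics m. \<psi> (root_sum f h)) = (\<Sum>h\<in>monics m. \<psi> (root_sum f (h + monom b (m - degree f))))"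
    by (rule sum.reindex_bij_witness[of _ "\<lambda>h. h + monom b (m - degree f)" "\<lambda>h. h + monom (- b) (m - degree f)"])
       (auto simp: mem add_monom add.assoc)
  also have "\<dots> = (\<Sum>h\<in>monics m. \<psi> 1 * \<psi> (root_sum f h))"
  proof (rule sum.cong[OF refl])
    fix h :: "'a mod_ring poly" assume "h \<in> monics m"
    then have h: "monic h" "degree h = m" unfolding monics_def by blast+
    have "root_sum f (h + monom b (m - degree f)) = root_sum f h - u * b"
      using root_sum_add_monom(1)[OF h(1) assms(1), of b] assms(3) h(2) by (simp add: u_def)
    also have "\<dots> = 1 + root_sum f h" using u by (simp add: b_def)
    finally show "\<psi> (root_sum f (h + monom b (m - degree f))) = \<psi> 1 * \<psi> (root_sum f h)"
      by (simp add: psi_add)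
  qed
  finally have "(1 - \<psi> 1) * (\<Sum>h\<in>monics m. \<psi> (root_sum f h)) = 0"
    by (simp add: sum_distrib_left[symmetric] algebra_simps)
  then show ?thesis using psi_1 by simp
qed

end

text \<open>Modulo a prime, a nonzero polynomial of degree below \<open>n\<close> cannot have
  \<open>n\<close> distinct roots. Synthetic division runs this argument without forming the residue
  ring. The degree bound is put as vanishing coefficients, so that \<open>n = 0\<close> means
  \<open>U = 0\<close>.\<close>

lemma const_dvd_of_distinct_roots:
  fixes P :: "'b :: idom" and U :: "'b poly" and \<alpha> :: "nat \<Rightarrow> 'b"
  assumes P: "prime_elem P" and "\<And>i. n \<le> i \<Longrightarrow> coeff U i = 0"
    and "\<And>i j. i < j \<Longrightarrow> j < n \<Longrightarrow> \<not> P dvd \<alpha> j - \<alpha> i" and "\<And>i. i < n \<Longrightarrow> P dvd poly U (\<alpha> i)"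
  shows "[:P:] dvd U"
  using assms(2-)
proof (induction n arbitrary: U)
  case 0
  then have "U = 0" by (intro poly_eqI) simp
  then show ?case by simp
next
  case (Suc n)
  let ?c = "\<alpha> n" let ?V = "synthetic_div U ?c"
  have U: "U = [:- ?c, 1:] * ?V + [:poly U ?c:]" by (rule synthetic_div_correct'[symmetric])
  have "degree U \<le> n" using Suc.prems(1) by (intro degree_le) auto
  have V: "coeff ?V i = 0" if "n \<le> i" for i
  proof (cases "degree U = 0")
    case True
    then show ?thesis by (simp add: synthetic_div_eq_0_iff[THEN iffD2])
  next
    case False
    then show ?thesis using that \<open>degree U \<le> n\<close> by (intro coeff_eq_0) (simp add: degree_synthetic_div)
  qed
  have "[:P:] dvd ?V"
  proof (rule Suc.IH[OF V])
    fix i assume i: "i < n"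
    have "poly U (\<alpha> i) = (\<alpha> i - ?c) * poly ?V (\<alpha> i) + poly U ?c"
      by (subst U) (simp add: algebra_simps)
    then have "(\<alpha> n - \<alpha> i) * poly ?V (\<alpha> i) = poly U ?c - poly U (\<alpha> i)" by (simp add: algebra_simps)
    moreover have "P dvd poly U ?c - poly U (\<alpha> i)" using Suc.prems(3) i by (intro dvd_diff) auto
    ultimately have "P dvd (\<alpha> n - \<alpha> i) * poly ?V (\<alpha> i)" by simp
    moreover have "\<not> P dvd \<alpha> n - \<alpha> i" using Suc.prems(2) i by simp
    ultimately show "P dvd poly ?V (\<alpha> i)" using prime_elem_dvd_multD[OF P] by blast
  qed (use Suc.prems(2) in auto)
  moreover have "[:P:] dvd [:poly U ?c:]"
    using Suc.prems(3)[of n] by (simp add: const_poly_dvd_iff coeff_pCons split: nat.splits)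
  ultimately show ?case by (subst U) (intro dvd_add dvd_mult)
qed

section \<open>Frobenius conjugates and traces modulo a prime polynomial\<close>

lemma const_poly_sum: "[:sum f A:] = (\<Sum>x\<in>A. [:f x:])"
proof (induction A rule: infinite_finite_induct)
  case (insert x F)
  have "[:f x + sum f F:] = [:f x:] + [:sum f F:]" by simp
  then show ?case using insert by simp
qed simp_all

text \<open>\<open>map_poly\<close> reads \<open>u\<close> as a polynomial in a second variable with
  constant coefficients, into which the conjugates of \<open>X\<close> can be substituted.\<close>

lemma poly_map_const_power_CARD:
  fixes u :: "'a :: prime_card mod_ring poly"
  shows "poly (map_poly (\<lambda>c. [:c:]) u) (monom 1 1 ^ (CARD('a) ^ e)) = u ^ (CARD('a) ^ e)"
proof (induction u)
  case 0
  then show ?case by (simp add: power_0_left)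
next
  case (pCons c u)
  have eq: "pCons c u = [:c:] + monom 1 1 * u" by (simp add: monom_altdef)
  have "map_poly (\<lambda>c. [:c:]) (pCons c u) = pCons [:c:] (map_poly (\<lambda>c. [:c:]) u)"
    by (intro poly_eqI) (simp add: coeff_map_poly coeff_pCons split: nat.splits)
  then have "poly (map_poly (\<lambda>c. [:c:]) (pCons c u)) (monom 1 1 ^ (CARD('a) ^ e)) =
        [:c:] + monom 1 1 ^ (CARD('a) ^ e) * u ^ (CARD('a) ^ e)"
    using pCons.IH by simp
  also have "\<dots> = (pCons c u) ^ (CARD('a) ^ e)"
    unfolding eq add_power_prime_poly_mod_ring power_mult_distrib fermat_theorem_power_poly ..
  finally show ?case .
qed

lemma diff_power_CARD_poly:
  fixes u v :: "'a :: prime_card mod_ring poly"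
  shows "(u - v) ^ (CARD('a) ^ e) = u ^ (CARD('a) ^ e) - v ^ (CARD('a) ^ e)"
  using add_power_prime_poly_mod_ring[of "u - v" v e] by simp

text \<open>The difference is the \<open>p^i\<close>-th power of \<open>X^(p^(j - i)) - X\<close>,
  whose irreducible divisors have degree at most \<open>j - i\<close>.\<close>

lemma prime_dvd_frobenius_diff:
  fixes P :: "'a :: prime_card mod_ring poly"
  assumes "prime P" and "i < j" and "j < degree P"
  shows "\<not> P dvd monom 1 1 ^ (CARD('a) ^ j) - monom 1 1 ^ (CARD('a) ^ i)"
proof
  assume "P dvd monom 1 1 ^ (CARD('a) ^ j) - monom 1 1 ^ (CARD('a) ^ i)"
  also have "monom 1 1 ^ (CARD('a) ^ j) - monom 1 1 ^ (CARD('a) ^ i) =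
      (monom 1 1 ^ (CARD('a) ^ (j - i)) - monom 1 1 :: 'a mod_ring poly) ^ (CARD('a) ^ i)"
    using assms(2) by (simp add: diff_power_CARD_poly power_mult[symmetric] power_add[symmetric])
  finally have "P dvd monom 1 1 ^ (CARD('a) ^ (j - i)) - monom 1 1"
    using assms(1) prime_dvd_power by blast
  moreover have "irreducible P" using assms(1) prime_elem_imp_irreducible prime_imp_prime_elem by blast
  moreover have "1 \<le> j - i" "j - i < degree P" using assms(2,3) by linarith+
  ultimately show False using degree_divisor2[OF _ refl] by blast
qed

text \<open>Modulo \<open>P\<close>, the roots of \<open>P\<close> are the \<open>X^(p^i)\<close> with \<open>i < degree P\<close>.\<close>

lemma trace_power_cong:
  fixes P :: "'a :: prime_card mod_ring poly"
  assumes P: "prime P" and k: "1 \<le> k"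
  shows "P dvd (\<Sum>i<degree P. (monom 1 1 ^ (CARD('a) ^ i)) ^ k) - [:fps_nth (root_power_sums P) k:]"
proof -
  define e where "e = degree P"
  define \<alpha> where "\<alpha> i = (monom 1 1 :: 'a mod_ring poly) ^ (CARD('a) ^ i)" for i
  define P' where "P' = map_poly (\<lambda>c. [:c:]) P"
  define R where "R = (\<Prod>i<e. [:- \<alpha> i, 1:])"
  have mP: "monic P" using P by (rule prime_poly_monic)
  have degR: "degree R = e" by (simp add: R_def degree_prod_eq_sum_degree)
  have mR: "monic R" by (simp add: R_def lead_coeff_prod)
  have cP': "coeff P' n = [:coeff P n:]" for n by (simp add: P'_def coeff_map_poly)
  \<comment> \<open>Both are monic of degree \<open>e\<close>, so the difference has smaller degree,
    and modulo \<open>P\<close> it vanishes at the \<open>e\<close> distinct conjugates.\<close>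
  have dvd: "[:P:] dvd P' - R"
  proof (rule const_dvd_of_distinct_roots[of P e _ \<alpha>])
    show "prime_elem P" using P by (rule prime_imp_prime_elem)
    fix i
    show "coeff (P' - R) i = 0" if "e \<le> i"
    proof (cases "i = e")
      case True
      have "coeff P e = 1" "coeff R e = 1" using mP mR degR by (simp_all add: e_def)
      then show ?thesis by (simp add: cP' True)
    next
      case False
      then show ?thesis using that degR by (simp add: cP' coeff_eq_0 e_def)
    qed
    show "\<not> P dvd \<alpha> j - \<alpha> i" if "i < j" "j < e" for j
      unfolding \<alpha>_def using prime_dvd_frobenius_diff[OF P that(1)] that(2) by (simp add: e_def)
    show "P dvd poly (P' - R) (\<alpha> i)" if "i < e"
    proof -
      have "poly R (\<alpha> i) = 0" unfolding R_def poly_prod using that by (intro prod_zero) auto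
      moreover have "poly P' (\<alpha> i) = P ^ (CARD('a) ^ i)"
        unfolding P'_def \<alpha>_def by (rule poly_map_const_power_CARD)
      ultimately show ?thesis by simp
    qed
  qed
  \<comment> \<open>\<open>H\<close> and \<open>S\<close> are the series of \<open>P\<close> with
    coefficients made constant polynomials, \<open>H'\<close> and \<open>S'\<close> those of
    \<open>R\<close>. Congruence of \<open>H\<close> and \<open>H'\<close> passes to the power
    sums.\<close>
  define H where "H = Abs_fps (\<lambda>n. [:fps_nth (fps_of_poly (reflect_poly P)) n:])"
  define S where "S = Abs_fps (\<lambda>n. [:fps_nth (root_power_sums P) n:])"
  define H' where "H' = (\<Prod>i\<in>{..<e}. 1 - fps_const (\<alpha> i) * fps_X)"
  define S' where "S' = Abs_fps (\<lambda>k. if k = 0 then 0 else \<Sum>i\<in>{..<e}. \<alpha> i ^ k)"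
  have rel: "log_deriv_rel H S"
    unfolding log_deriv_rel_def
  proof (rule fps_ext)
    fix n
    let ?h = "fps_of_poly (reflect_poly P)" and ?s = "root_power_sums P"
    have "fps_nth (H * S) n = [:fps_nth (?h * ?s) n:]"
      by (simp add: H_def S_def fps_mult_nth const_poly_sum mult.commute)
    also have "?h * ?s = - fps_X * fps_deriv ?h"
      using root_power_sums_rel(1)[OF mP] by (simp only: log_deriv_rel_def)
    also have "[:fps_nth (- fps_X * fps_deriv ?h) n:] = fps_nth (- fps_X * fps_deriv H) n"
    proof (cases n)
      case (Suc m)
      have "[:fps_nth (- fps_X * fps_deriv ?h) n:] = [:- (of_nat (Suc m) * fps_nth ?h (Suc m)):]"
        by (simp add: Suc)
      also have "\<dots> = - (of_nat (Suc m) * [:fps_nth ?h (Suc m):])"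
        unfolding of_nat_poly by simp
      also have "\<dots> = - (of_nat (Suc m) * fps_nth H (Suc m))"
        by (simp only: H_def fps_nth_Abs_fps)
      also have "\<dots> = fps_nth (- fps_X * fps_deriv H) n"
        by (simp add: Suc)
      finally show ?thesis .
    qed (simp add: H_def)
    finally show "fps_nth (H * S) n = fps_nth (- fps_X * fps_deriv H) n" .
  qed
  have rel': "log_deriv_rel H' S'" unfolding H'_def S'_def by (rule log_deriv_rel_prod) simp
  have H'R: "H' = fps_of_poly (reflect_poly R)"
    by (simp only: H'_def R_def reflect_poly_prod fps_of_poly_prod fps_of_poly_reflect_linear)
  have "P dvd fps_nth S' k - fps_nth S k"
  proof (rule log_deriv_rel_cong[OF rel' _ rel _ _ order_refl])
    show "fps_nth H' 0 = 1" using mR by (simp add: H'R)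
    show "fps_nth H 0 = 1" using mP by (simp add: H_def)
    fix i
    have "P dvd coeff (P' - R) (e - i)" using dvd by (simp only: const_poly_dvd_iff)
    then have "P dvd coeff R (e - i) - [:coeff P (e - i):]" by (simp add: cP' dvd_diff_commute)
    then show "P dvd fps_nth H' i - fps_nth H i"
      by (simp add: H'R H_def coeff_reflect_poly degR e_def)
  qed
  then show ?thesis using k by (simp add: S'_def S_def e_def \<alpha>_def)
qed

lemma sum_lessThan_add: "(\<Sum>i<a + b. f i) = (\<Sum>i<a. f i) + (\<Sum>i<b. f (a + i))"
  for f :: "nat \<Rightarrow> 'b :: comm_monoid_add"
  by (induction b) (simp_all add: add.assoc)

text \<open>Frobenius turns \<open>f(X)\<close> into \<open>f(X^(p^i))\<close>, so linearity reduces
  the trace to power sums of the conjugates of \<open>X\<close>.\<close>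

lemma trace_cong:
  fixes P f :: "'a :: prime_card mod_ring poly"
  assumes P: "prime P" and f0: "coeff f 0 = 0"
  shows "P dvd (\<Sum>i<degree P. f ^ (CARD('a) ^ i)) - [:root_sum f P:]"
proof -
  let ?X = "monom 1 1 :: 'a mod_ring poly" and ?p = "CARD('a)"
  have "f ^ (?p ^ i) = (\<Sum>k=1..degree f. [:coeff f k:] * (?X ^ (?p ^ i)) ^ k)" for i
  proof -
    let ?f' = "map_poly (\<lambda>c. [:c:]) f"
    have deg: "degree ?f' = degree f" by (rule degree_map_poly) simp
    have "f ^ (?p ^ i) = poly ?f' (?X ^ (?p ^ i))" by (rule poly_map_const_power_CARD[symmetric])
    also have "\<dots> = (\<Sum>k\<le>degree f. [:coeff f k:] * (?X ^ (?p ^ i)) ^ k)"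
      unfolding poly_altdef deg by (simp add: coeff_map_poly)
    also have "\<dots> = (\<Sum>k=1..degree f. [:coeff f k:] * (?X ^ (?p ^ i)) ^ k)"
      using f0 sum.atLeast_Suc_atMost[of 0 "degree f" "\<lambda>k. [:coeff f k:] * (?X ^ (?p ^ i)) ^ k"]
      by (simp add: atMost_atLeast0)
    finally show ?thesis .
  qed
  then have "(\<Sum>i<degree P. f ^ (?p ^ i)) = (\<Sum>k=1..degree f. [:coeff f k:] * (\<Sum>i<degree P. (?X ^ (?p ^ i)) ^ k))"
    by (simp only: sum_distrib_left) (rule sum.swap)
  moreover have "[:root_sum f P:] = (\<Sum>k=1..degree f. [:coeff f k:] * [:fps_nth (root_power_sums P) k:])"
    by (simp add: root_sum_def const_poly_sum mult.commute)
  ultimately have "(\<Sum>i<degree P. f ^ (?p ^ i)) - [:root_sum f P:] =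
      (\<Sum>k=1..degree f. [:coeff f k:] * ((\<Sum>i<degree P. (?X ^ (?p ^ i)) ^ k) - [:fps_nth (root_power_sums P) k:]))"
    by (simp only: sum_subtractf right_diff_distrib)
  also have "P dvd \<dots>"
    by (intro dvd_sum dvd_mult trace_power_cong[OF P]) simp
  finally show ?thesis .
qed

lemma prime_dvd_frobenius:
  fixes P :: "'a :: prime_card mod_ring poly"
  assumes P: "prime P" and "degree P dvd n"
  shows "P dvd monom 1 1 ^ (CARD('a) ^ n) - monom 1 1"
proof -
  let ?X = "monom 1 1 :: 'a mod_ring poly" and ?p = "CARD('a)"
  have "irreducible P" using P prime_elem_imp_irreducible prime_imp_prime_elem by blast
  then have d: "P dvd ?X ^ (?p ^ degree P) - ?X" using degree_divisor1 by blast
  have "P dvd ?X ^ (?p ^ (degree P * k)) - ?X" for k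
  proof (induction k)
    case (Suc k)
    have "(?X ^ (?p ^ (degree P * k))) ^ (?p ^ degree P) = ?X ^ (?p ^ (degree P * Suc k))"
      by (simp add: power_mult[symmetric] power_add[symmetric] add.commute)
    then have "P dvd ?X ^ (?p ^ (degree P * Suc k)) - ?X ^ (?p ^ (degree P * k))"
      using dvd_power_CARD_minus_self[OF d, of "?X ^ (?p ^ (degree P * k))"] by simp
    then show ?case using dvd_add[OF _ Suc] by fastforce
  qed simp
  then show ?thesis using assms(2) by (auto elim: dvdE)
qed

text \<open>Modulo \<open>P\<close>, raising to the power \<open>p^(degree P)\<close> is the
  identity, so the sum is \<open>k\<close> copies of the trace with \<open>degree P\<close>
  terms.\<close>

lemma trace_cong_mult:
  fixes P f :: "'a :: prime_card mod_ring poly"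
  assumes P: "prime P" and f0: "coeff f 0 = 0"
  shows "P dvd (\<Sum>i<k * degree P. f ^ (CARD('a) ^ i)) - [:of_nat k * root_sum f P:]"
proof (induction k)
  case 0
  then show ?case by simp
next
  case (Suc k)
  let ?p = "CARD('a)" and ?e = "degree P" and ?T = "\<Sum>i<degree P. f ^ (CARD('a) ^ i)"
  have "(\<Sum>i<Suc k * ?e. f ^ (?p ^ i)) = (\<Sum>i<k * ?e + ?e. f ^ (?p ^ i))"
    by (simp add: add.commute)
  also have "\<dots> = (\<Sum>i<k * ?e. f ^ (?p ^ i)) + (\<Sum>i<?e. f ^ (?p ^ (k * ?e + i)))"
    by (rule sum_lessThan_add)
  also have "(\<Sum>i<?e. f ^ (?p ^ (k * ?e + i))) = ?T ^ (?p ^ (k * ?e))"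
    by (simp add: sum_power_CARD_poly power_mult[symmetric] power_add[symmetric] add.commute)
  finally have eq: "(\<Sum>i<Suc k * ?e. f ^ (?p ^ i)) =
    (\<Sum>i<k * ?e. f ^ (?p ^ i)) + ?T ^ (?p ^ (k * ?e))" .
  have c: "[:of_nat (Suc k) * root_sum f P:] = [:of_nat k * root_sum f P:] + [:root_sum f P:]"
    by (simp add: distrib_right)
  have alg: "u + v - (w + x) = (u - w) + (v - y) + (y - x)" for u v w x y :: "'a mod_ring poly"
    by simp
  have split: "(\<Sum>i<Suc k * ?e. f ^ (?p ^ i)) - [:of_nat (Suc k) * root_sum f P:] =
     ((\<Sum>i<k * ?e. f ^ (?p ^ i)) - [:of_nat k * root_sum f P:]) +
     (?T ^ (?p ^ (k * ?e)) - ?T) + (?T - [:root_sum f P:])"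
    unfolding eq c by (rule alg)
  have d: "P dvd ?T ^ (?p ^ (k * ?e)) - ?T"
    by (rule dvd_power_CARD_minus_self[OF prime_dvd_frobenius[OF P]]) simp
  show ?case
    by (rule iffD2[OF arg_cong[OF split, of "\<lambda>u. P dvd u"] dvd_add[OF dvd_add[OF Suc d] trace_cong[OF P f0]]])
qed

section \<open>The Weil bound\<close>

lemma prod_primes_dvd_poly:
  fixes \<phi> :: "'a :: field_gcd poly"
  assumes "finite A" and "\<And>P. P \<in> A \<Longrightarrow> prime P" and "\<And>P. P \<in> A \<Longrightarrow> P dvd \<phi>"
  shows "\<Prod>A dvd \<phi>"
  using assms
proof (induction A)
  case (insert x F)
  then have "\<Prod>F dvd \<phi>" by auto
  then obtain k where k: "\<phi> = \<Prod>F * k" by (rule dvdE)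
  have x: "prime x" using insert.prems by simp
  have "\<not> x dvd \<Prod>F"
  proof
    assume "x dvd \<Prod>F"
    then obtain y where "y \<in> F" "x dvd y"
      using prime_dvd_prod_iff[OF insert.hyps(1) x, of "\<lambda>y. y"] by auto
    then have "x = y" using primes_dvd_imp_eq[OF x] insert.prems by auto
    then show False using \<open>y \<in> F\<close> insert.hyps by simp
  qed
  moreover have "x dvd \<Prod>F * k" using insert.prems k by simp
  ultimately have "x dvd k" using prime_dvd_mult_iff[OF x] by blast
  then have "x * \<Prod>F dvd k * \<Prod>F" by (rule mult_dvd_mono) simp
  then show ?case using insert.hyps k by (simp add: mult.commute)
qed simp

context additive_character begin

text \<open>By \<open>trace_cong_mult\<close> every \<open>P\<close> counted here divides Stepanov's
  polynomial for the value \<open>c\<close>. So does their product, whose degree is the left-hand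
  side.\<close>

lemma sum_degree_level_le:
  fixes f :: "'a mod_ring poly" and c :: "'a mod_ring"
  assumes "0 < degree f" and "degree f < CARD('a)" and f0: "coeff f 0 = 0" and "3 \<le> m"
  shows "(\<Sum>P | prime P \<and> degree P dvd 2 * m \<and> of_nat (2 * m div degree P) * root_sum f P = c. degree P)
    \<le> CARD('a) ^ (2 * m - 1) + (2 * degree f + 1) * CARD('a) ^ m"
proof -
  let ?p = "CARD('a)"
  let ?A = "{P. prime P \<and> degree P dvd 2 * m \<and> of_nat (2 * m div degree P) * root_sum f P = c}"
  let ?t = "\<Sum>i<m. f ^ (?p ^ i)"
  obtain \<phi> where \<phi>: "\<phi> \<noteq> 0" "degree \<phi> \<le> ?p ^ (m - 1) * ?p ^ m + (2 * degree f + 1) * ?p ^ m"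
    "\<And>P. prime_elem P \<Longrightarrow> P dvd monom 1 1 ^ (?p ^ (2 * m)) - monom 1 1 \<Longrightarrow>
           P dvd ?t ^ (?p ^ m) + ?t - [:c:] \<Longrightarrow> P dvd \<phi>"
    using stepanov_auxiliary_poly[OF assms(1,2,4), of c] by metis
  have finA: "finite ?A"
    by (rule finite_subset[OF _ finite_primes_dvd[of "2 * m"]]) (use assms(4) in auto)
  have "P dvd \<phi>" if "P \<in> ?A" for P
  proof (rule \<phi>(3))
    have P: "prime P" "degree P dvd 2 * m" "of_nat (2 * m div degree P) * root_sum f P = c"
      using that by auto
    show "prime_elem P" using P(1) by (rule prime_imp_prime_elem)
    show "P dvd monom 1 1 ^ (?p ^ (2 * m)) - monom 1 1" using P by (intro prime_dvd_frobenius)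
    \<comment> \<open>The last \<open>m\<close> of the \<open>2 * m\<close> Frobenius powers are
      obtained by raising the first \<open>m\<close> to the power \<open>p^m\<close>.\<close>
    have "?t ^ (?p ^ m) = (\<Sum>i<m. f ^ (?p ^ (m + i)))"
      by (simp add: sum_power_CARD_poly power_mult[symmetric] power_add[symmetric] add.commute)
    then have "?t ^ (?p ^ m) + ?t = (\<Sum>i<m + m. f ^ (?p ^ i))"
      by (simp only: sum_lessThan_add) (simp only: add.commute)
    also have "\<dots> = (\<Sum>i<(2 * m div degree P) * degree P. f ^ (?p ^ i))"
      using P(2) by (simp add: mult_2)
    finally show "P dvd ?t ^ (?p ^ m) + ?t - [:c:]"
      using trace_cong_mult[OF P(1) f0, of "2 * m div degree P"] P(3) by simp
  qed
  then have "\<Prod>?A dvd \<phi>" using finA by (intro prod_primes_dvd_poly) auto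
  then have "degree (\<Prod>?A) \<le> degree \<phi>" using \<phi>(1) by (rule dvd_imp_degree_le)
  moreover have "degree (\<Prod>P\<in>?A. P) = (\<Sum>P\<in>?A. degree P)"
    by (rule degree_prod_eq_sum_degree) auto
  moreover have "?p ^ (m - 1) * ?p ^ m = ?p ^ (2 * m - 1)"
    using assms(4) by (simp add: power_add[symmetric] mult_2)
  ultimately show ?thesis using \<phi>(2) by simp
qed

text \<open>Upper bounds for the counts \<open>N c\<close> suffice. Because \<open>\<psi>\<close>
  sums to 0, the counts may be replaced, up to sign, by the nonnegative gaps below their common
  bound, and these add up to \<open>p * E\<close> since the counts add up to
  \<open>p^(2 * m)\<close>.\<close>

lemma norm_prime_sum_le:
  fixes f :: "'a mod_ring poly"
  assumes "0 < degree f" and "degree f < CARD('a)" and f0: "coeff f 0 = 0" and m: "3 \<le> m"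
  shows "cmod (monic_character.prime_sum (\<lambda>h. \<psi> (root_sum f h)) (2 * m))
    \<le> (real CARD('a) * (2 * degree f + 1)) * real CARD('a) ^ m"
proof -
  interpret monic_character "\<lambda>h. \<psi> (root_sum f h)" by (rule monic_character_root_sum)
  let ?p = "CARD('a)"
  define \<Q> where "\<Q> = {P :: 'a mod_ring poly. prime P \<and> degree P dvd 2 * m}"
  define g where "g P = of_nat (2 * m div degree P) * root_sum f P" for P
  define N where "N c = (\<Sum>P | P \<in> \<Q> \<and> g P = c. degree P)" for c
  define E where "E = (2 * degree f + 1) * ?p ^ m"
  have fin: "finite \<Q>" unfolding \<Q>_def using m by (intro finite_primes_dvd) simp
  have p0: "0 < ?p" by simp
  have NE: "N c \<le> ?p ^ (2 * m - 1) + E" for c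
    using sum_degree_level_le[OF assms, of c] by (simp add: N_def \<Q>_def g_def E_def conj_assoc)
  have "(\<Sum>c\<in>UNIV. N c) = (\<Sum>P\<in>\<Q>. degree P)"
    unfolding N_def using fin by (intro sum.group) auto
  also have "\<dots> = ?p ^ (2 * m)" unfolding \<Q>_def using m by (intro sum_degree_primes) simp
  finally have sumN: "(\<Sum>c\<in>UNIV. N c) = ?p ^ (2 * m)" .
  have "prime_sum (2 * m) = (\<Sum>P\<in>\<Q>. of_nat (degree P) * \<psi> (g P))"
    unfolding prime_sum_def \<Q>_def g_def psi_of_nat_mult ..
  also have "\<dots> = (\<Sum>c\<in>UNIV. \<Sum>P | P \<in> \<Q> \<and> g P = c. of_nat (degree P) * \<psi> (g P))"
    using fin by (intro sum.group[symmetric]) auto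
  also have "\<dots> = (\<Sum>c\<in>UNIV. of_nat (N c) * \<psi> c)"
    unfolding N_def of_nat_sum sum_distrib_right by (intro sum.cong) auto
  also have "\<dots> = - (\<Sum>c\<in>UNIV. of_real (real (?p ^ (2 * m - 1) + E) - real (N c)) * \<psi> c)"
    by (simp add: left_diff_distrib sum_subtractf sum_psi flip: sum_distrib_left)
  finally have "cmod (prime_sum (2 * m)) \<le>
      (\<Sum>c\<in>UNIV. cmod (of_real (real (?p ^ (2 * m - 1) + E) - real (N c)) * \<psi> c))"
    by (simp only: norm_minus_cancel norm_sum)
  also have "\<dots> = (\<Sum>c\<in>(UNIV :: 'a mod_ring set). real (?p ^ (2 * m - 1) + E) - real (N c))"
  proof (rule sum.cong[OF refl])
    fix c :: "'a mod_ring"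
    have "real (N c) \<le> real (?p ^ (2 * m - 1) + E)" using NE[of c] by (simp only: of_nat_le_iff)
    then show "cmod (of_real (real (?p ^ (2 * m - 1) + E) - real (N c)) * \<psi> c) =
        real (?p ^ (2 * m - 1) + E) - real (N c)"
      by (simp only: norm_mult norm_psi norm_of_real) simp
  qed
  also have "\<dots> = real ?p * real (?p ^ (2 * m - 1) + E) - real (?p ^ (2 * m))"
    by (simp add: sum_subtractf sumN flip: of_nat_sum)
  also have "\<dots> = real ?p * real E"
  proof -
    have "2 * m = Suc (2 * m - 1)" using m by simp
    then have "?p * ?p ^ (2 * m - 1) = ?p ^ (2 * m)" by (metis power_Suc)
    then have "real ?p * real (?p ^ (2 * m - 1)) = real (?p ^ (2 * m))" by (metis of_nat_mult)
    then show ?thesis by (simp only: of_nat_add distrib_left)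
  qed
  finally show ?thesis by (simp add: E_def algebra_simps)
qed

end

text \<open>By simultaneous Diophantine approximation, all \<open>z i ^ n\<close> have nearly nonnegative real argument for
  suitable large \<open>n\<close>, so that there is no cancellation in the power sum.\<close>

lemma norm_le_of_power_sums:
  fixes z :: "nat \<Rightarrow> complex" and B C :: real
  assumes B: "0 < B" and bound: "\<And>m. b \<le> m \<Longrightarrow> cmod (\<Sum>i<r. z i ^ m) \<le> C * B ^ m" and i: "i < r"
  shows "cmod (z i) \<le> B"
proof (rule ccontr)
  assume "\<not> cmod (z i) \<le> B"
  then have gt: "1 < cmod (z i) / B" using B by simp
  obtain M0 where M0: "2 * C < (cmod (z i) / B) ^ M0" using real_arch_pow[OF gt] by blast
  \<comment> \<open>At every exponent \<open>n >= M\<close> the assumed bound applies and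
    \<open>(cmod (z i) / B) ^ n\<close> exceeds \<open>2 * C\<close>. The approximation concerns
    \<open>M\<close> times the angles, so that the exponent found is a positive multiple of
    \<open>M\<close>.\<close>
  define M where "M = Suc (max b M0)"
  have M: "2 * C < (cmod (z i) / B) ^ M"
    by (rule less_le_trans[OF M0 power_increasing]) (use gt in \<open>auto simp: M_def\<close>)
  \<comment> \<open>An error of 1/6 of a turn is an angle of \<open>pi / 3\<close>, where the cosine
    is still 1/2.\<close>
  obtain q h where q: "0 < q" and h: "\<And>j. j < r \<Longrightarrow>
      \<bar>real_of_int q * (real M * (Arg (z j) / (2 * pi))) - real_of_int (h j)\<bar> < 1 / real 6"
    by (rule Dirichlet_approx_simult[of 6 r "\<lambda>j. real M * (Arg (z j) / (2 * pi))"]) (simp, blast)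
  define n where "n = nat q * M"
  have "1 \<le> nat q" using q by linarith
  then have nM: "M \<le> n" by (simp add: n_def)
  have re: "cmod (z j) ^ n / 2 \<le> Re (z j ^ n)" if j: "j < r" for j
  proof -
    let ?x = "real_of_int q * (real M * (Arg (z j) / (2 * pi))) - real_of_int (h j)"
    have "z j ^ n = rcis (cmod (z j)) (Arg (z j)) ^ n" by (simp add: rcis_cmod_Arg)
    then have "Re (z j ^ n) = cmod (z j) ^ n * cos (real n * Arg (z j))"
      by (simp add: DeMoivre2)
    also have "real n * Arg (z j) = 2 * pi * ?x + 2 * pi * real_of_int (h j)"
      using q by (simp add: n_def field_simps)
    also have "cos (2 * pi * ?x + 2 * pi * real_of_int (h j)) = cos (2 * pi * ?x)"
      unfolding cos_add cos_int_2pin sin_int_2pin by simp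
    also have "cos (2 * pi * ?x) = cos \<bar>2 * pi * ?x\<bar>" by simp
    finally have eq: "Re (z j ^ n) = cmod (z j) ^ n * cos \<bar>2 * pi * ?x\<bar>" .
    have "\<bar>2 * pi * ?x\<bar> = 2 * pi * \<bar>?x\<bar>" by (simp add: abs_mult)
    also have "\<dots> \<le> 2 * pi * (1 / 6)" using h[OF j] by (intro mult_left_mono) auto
    finally have "\<bar>2 * pi * ?x\<bar> \<le> pi / 3" by simp
    then have "cos (pi / 3) \<le> cos \<bar>2 * pi * ?x\<bar>"
      using pi_gt_zero by (intro cos_monotone_0_pi_le) auto
    then have "1 / 2 \<le> cos \<bar>2 * pi * ?x\<bar>" by (simp add: cos_60)
    then have "cmod (z j) ^ n * (1 / 2) \<le> cmod (z j) ^ n * cos \<bar>2 * pi * ?x\<bar>"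
      by (intro mult_left_mono) auto
    then show ?thesis unfolding eq by simp
  qed
  have re0: "0 \<le> Re (z j ^ n)" if "j < r" for j
    using re[OF that] by (meson divide_nonneg_pos norm_ge_zero order_trans zero_le_power zero_less_numeral)
  have "cmod (z i) ^ n / 2 \<le> Re (z i ^ n)" using re i by blast
  also have "\<dots> \<le> (\<Sum>j<r. Re (z j ^ n))"
    using i re0 by (intro member_le_sum) auto
  also have "\<dots> = Re (\<Sum>j<r. z j ^ n)" by simp
  also have "\<dots> \<le> cmod (\<Sum>j<r. z j ^ n)" by (rule complex_Re_le_cmod)
  also have "\<dots> \<le> C * B ^ n" using nM by (intro bound) (simp add: M_def)
  finally have "(cmod (z i) / B) ^ n \<le> 2 * C" using B by (simp add: power_divide field_simps)
  moreover have "(cmod (z i) / B) ^ M \<le> (cmod (z i) / B) ^ n"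
    using gt nM by (intro power_increasing) auto
  ultimately show False using M by simp
qed

context additive_character begin

theorem weil_bound:
  fixes f :: "'a mod_ring poly"
  assumes "0 < degree f" and "degree f < CARD('a)" and f0: "coeff f 0 = 0"
  shows "cmod (\<Sum>x\<in>UNIV. \<psi> (poly f x)) \<le> real (degree f - 1) * sqrt (real CARD('a))"
proof -
  interpret monic_character "\<lambda>h. \<psi> (root_sum f h)" by (rule monic_character_root_sum)
  define d where "d = degree f"
  define c where "c = monic_sum"
  have d0: "0 < d" using assms by (simp add: d_def)
  have c0: "c 0 = 1" by (simp add: c_def monic_sum_0)
  have cz: "c n = 0" if "d \<le> n" for n
    unfolding c_def monic_sum_def using assms that by (intro sum_monics_eq_0) (auto simp: d_def)
  have c1: "c 1 = (\<Sum>x\<in>UNIV. \<psi> (poly f x))"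
  proof -
    have "c 1 = (\<Sum>x\<in>UNIV. \<psi> (root_sum f [:- x, 1:]))"
      unfolding c_def monic_sum_def
    proof (rule sum.reindex_bij_witness[of _ "\<lambda>x. [:- x, 1:]" "\<lambda>h. - coeff h 0"])
      fix h :: "'a mod_ring poly" assume "h \<in> monics 1"
      then have h: "monic h" "degree h = 1" unfolding monics_def by blast+
      have "h = [:coeff h 0, 1:]"
        by (rule poly_eqI) (use h in \<open>auto simp: coeff_pCons coeff_eq_0 split: nat.splits\<close>)
      then show e: "[:- (- coeff h 0), 1:] = h" by simp
      show "\<psi> (root_sum f [:- (- coeff h 0), 1:]) = \<psi> (root_sum f h)" by (simp only: e)
    qed (auto simp: monics_def)
    then show ?thesis by (simp only: root_sum_linear[OF f0])
  qed
  \<comment> \<open>\<open>Abs_fps c\<close> is the reflection of \<open>L\<close>, so it factors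
    into the \<open>1 - z i * X\<close> over the zeros of \<open>L\<close>.\<close>
  define L where "L = (\<Sum>n<d. monom (c n) (d - 1 - n))"
  have cL: "coeff L k = (if k < d then c (d - 1 - k) else 0)" for k
  proof -
    have "coeff L k = (\<Sum>n<d. if n = d - 1 - k \<and> k < d then c n else 0)"
      unfolding L_def coeff_sum by (intro sum.cong) auto
    also have "\<dots> = (if k < d then c (d - 1 - k) else 0)"
      using d0 by (cases "k < d") auto
    finally show ?thesis .
  qed
  have degL: "degree L = d - 1"
    by (rule antisym[OF degree_le le_degree]) (use d0 in \<open>auto simp: cL c0\<close>)
  have lcL: "lead_coeff L = 1" using d0 by (simp add: degL cL c0)
  obtain zs where zs: "(\<Prod>a\<leftarrow>zs. [:- a, 1:]) = L" "length zs = d - 1"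
    using fundamental_theorem_algebra_factorized[of L] lcL degL by auto
  define z where "z i = zs ! i" for i
  have Lz: "L = (\<Prod>i<d - 1. [:- z i, 1:])"
    unfolding zs(1)[symmetric] prod.list_conv_set_nth using zs(2)
    by (simp add: z_def atLeast0LessThan)
  have "Abs_fps c = fps_of_poly (reflect_poly L)"
    by (rule fps_ext) (use d0 in \<open>auto simp: coeff_reflect_poly degL cL cz\<close>)
  also have "\<dots> = (\<Prod>i<d - 1. 1 - fps_const (z i) * fps_X)"
    by (simp only: Lz reflect_poly_prod fps_of_poly_prod fps_of_poly_reflect_linear)
  finally have cprod: "Abs_fps c = (\<Prod>i\<in>{..<d - 1}. 1 - fps_const (z i) * fps_X)" .
  have rel1: "log_deriv_rel (Abs_fps c) (Abs_fps (\<lambda>k. if k = 0 then 0 else \<Sum>i<d - 1. z i ^ k))"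
    unfolding cprod by (rule log_deriv_rel_prod) simp
  have rel2: "log_deriv_rel (Abs_fps c) (Abs_fps (\<lambda>k. if k = 0 then 0 else - prime_sum k))"
    unfolding log_deriv_rel_def
  proof (rule fps_ext)
    fix n
    let ?S = "Abs_fps (\<lambda>k. if k = 0 then 0 else - prime_sum k)"
    have "fps_nth (?S * Abs_fps c) n = (\<Sum>k=1..n. - prime_sum k * c (n - k))"
      using sum.atLeast_Suc_atMost[of 0 n "\<lambda>k. fps_nth ?S k * c (n - k)"]
      by (simp add: fps_mult_nth)
    also have "\<dots> = - (of_nat n * c n)"
      using newton_identity[of n] by (simp add: c_def sum_negf)
    also have "\<dots> = fps_nth (- fps_X * fps_deriv (Abs_fps c)) n"
      by (cases n) simp_all
    finally show "fps_nth (Abs_fps c * ?S) n = fps_nth (- fps_X * fps_deriv (Abs_fps c)) n"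
      by (simp only: mult.commute)
  qed
  \<comment> \<open>Two expressions for the logarithmic derivative of the same series.\<close>
  have pse: "Abs_fps (\<lambda>k. if k = 0 then 0 else \<Sum>i<d - 1. z i ^ k) = Abs_fps (\<lambda>k. if k = 0 then 0 else - prime_sum k)"
    using log_deriv_rel_unique[OF rel1 _ rel2] c0 by simp
  have ps: "(\<Sum>i<d - 1. z i ^ k) = - prime_sum k" if "1 \<le> k" for k
    using that arg_cong[of _ _ "\<lambda>F. fps_nth F k", OF pse] by simp
  have zb: "cmod (z i) \<le> sqrt (real CARD('a))" if i: "i < d - 1" for i
  proof -
    \<comment> \<open>Stepanov's bound is available for even exponents, hence the squares.\<close>
    have "cmod (z i ^ 2) \<le> real CARD('a)"
    proof (rule norm_le_of_power_sums[where r = "d - 1" and z = "\<lambda>i. z i ^ 2" and b = 3])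
      fix m :: nat assume m: "3 \<le> m"
      have "(\<Sum>i<d - 1. (z i ^ 2) ^ m) = - prime_sum (2 * m)"
        using ps[of "2 * m"] m by (simp add: power_mult)
      then show "cmod (\<Sum>i<d - 1. (z i ^ 2) ^ m) \<le> (real CARD('a) * (2 * degree f + 1)) * real CARD('a) ^ m"
        using norm_prime_sum_le[OF assms m] by simp
    qed (use i in auto)
    then have "(cmod (z i))\<^sup>2 \<le> real CARD('a)" by (simp add: norm_power)
    then show ?thesis by (rule real_le_rsqrt)
  qed
  have "c 1 = prime_sum 1 * c 0" using newton_identity[of 1] by (simp add: c_def)
  then have "cmod (c 1) = cmod (\<Sum>i<d - 1. z i)" using ps[of 1] c0 by simp
  also have "\<dots> \<le> (\<Sum>i<d - 1. cmod (z i))" by (rule norm_sum)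
  also have "\<dots> \<le> real (card {..<d - 1}) * sqrt (real CARD('a))"
    by (rule sum_bounded_above) (use zb in auto)
  finally show ?thesis unfolding c1 by (simp add: d_def)
qed

end

section \<open>The Weil bound in terms of residues of integers\<close>

definition unit_char :: "nat \<Rightarrow> int \<Rightarrow> complex" where
  "unit_char p a = cis (2 * pi * real_of_int a / real p)"

lemma unit_char_add: "unit_char p (a + b) = unit_char p a * unit_char p b"
  by (simp add: unit_char_def cis_mult add_divide_distrib distrib_left)

lemma norm_unit_char [simp]: "cmod (unit_char p a) = 1"
  by (simp add: unit_char_def)

lemma unit_char_0 [simp]: "unit_char p 0 = 1"
  by (simp add: unit_char_def)

lemma unit_char_eq_1_iff:
  assumes "0 < p"
  shows "unit_char p a = 1 \<longleftrightarrow> int p dvd a"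
proof
  assume "unit_char p a = 1"
  then have "cos (2 * pi * real_of_int a / real p) = 1" by (simp add: unit_char_def complex_eq_iff)
  then obtain n :: int where "2 * pi * real_of_int a / real p = of_int n * (2 * pi)"
    by (auto simp: cos_one_2pi_int)
  then have "real_of_int a = real_of_int (int p * n)" using assms by (simp add: field_simps)
  then have "a = int p * n" by (simp only: of_int_eq_iff)
  then show "int p dvd a" by simp
next
  assume "int p dvd a"
  then obtain n where "a = int p * n" by (rule dvdE)
  then have "2 * pi * real_of_int a / real p = 2 * pi * real_of_int n" using assms by simp
  then have "unit_char p a = cis (2 * pi * real_of_int n)" by (simp only: unit_char_def)
  also have "\<dots> = 1" by (rule cis_multiple_2pi) simp
  finally show "unit_char p a = 1" .
qed

lemma unit_char_mod:
  assumes "0 < p"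
  shows "unit_char p (a mod int p) = unit_char p a"
proof -
  have "unit_char p a = unit_char p (int p * (a div int p) + a mod int p)" by simp
  also have "\<dots> = unit_char p (a mod int p)"
    unfolding unit_char_add using assms unit_char_eq_1_iff[of p "int p * (a div int p)"] by simp
  finally show ?thesis by simp
qed

lemma weil_bound_CARD:
  fixes g :: "nat \<Rightarrow> nat" and d :: nat
  assumes "0 < d" and "d < CARD('a :: prime_card)" and "\<not> CARD('a) dvd g d"
  shows "cmod (\<Sum>j<CARD('a). unit_char CARD('a) (int (\<Sum>s=1..d. g s * j ^ s))) \<le> real (d - 1) * sqrt (real CARD('a))"
proof -
  let ?p = "CARD('a)"
  have p1: "1 < ?p" using prime_gt_1_nat[OF prime_card[where ?'a = 'a]] by simp
  define \<psi> where "\<psi> x = unit_char ?p (to_int_mod_ring (x :: 'a mod_ring))" for x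
  interpret additive_character \<psi>
  proof
    fix x y :: "'a mod_ring"
    show "\<psi> (x + y) = \<psi> x * \<psi> y"
      using p1 by (simp add: \<psi>_def to_int_mod_ring_add unit_char_mod unit_char_add)
    show "cmod (\<psi> x) = 1" by (simp add: \<psi>_def)
  next
    have "to_int_mod_ring (1 :: 'a mod_ring) = 1" using p1 by transfer simp
    then show "\<psi> 1 \<noteq> 1" using p1 unit_char_eq_1_iff[of ?p 1] by (simp add: \<psi>_def)
  qed
  have \<psi>_of_nat: "\<psi> (of_nat n) = unit_char ?p (int n)" for n
  proof -
    have "to_int_mod_ring (of_nat n :: 'a mod_ring) = int n mod int ?p"
      by (simp add: of_nat_of_int_mod_ring of_int_mod_ring.rep_eq to_int_mod_ring.rep_eq)
    then show ?thesis using p1 by (simp add: \<psi>_def unit_char_mod)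
  qed
  define f :: "'a mod_ring poly" where "f = (\<Sum>s=1..d. monom (of_nat (g s)) s)"
  have cf: "coeff f k = (if 1 \<le> k \<and> k \<le> d then of_nat (g k) else 0)" for k
    by (simp add: f_def coeff_sum)
  have "of_nat (g d) \<noteq> (0 :: 'a mod_ring)" using assms(3) of_nat_0_mod_ring_dvd by blast
  then have deg: "degree f = d"
    using assms(1) by (intro antisym[OF degree_le le_degree]) (auto simp: cf)
  have "(\<Sum>x\<in>UNIV. \<psi> (poly f x)) = (\<Sum>j<?p. \<psi> (poly f (of_nat j)))"
  proof (rule sum.reindex_bij_betw[symmetric])
    have inj: "inj_on (of_nat :: nat \<Rightarrow> 'a mod_ring) {..<?p}"
    proof (rule inj_onI)
      fix x y assume xy: "x \<in> {..<?p}" "y \<in> {..<?p}" "(of_nat x :: 'a mod_ring) = of_nat y"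
      have "to_int_mod_ring (of_nat n :: 'a mod_ring) = int n mod int ?p" for n
        by (simp add: of_nat_of_int_mod_ring of_int_mod_ring.rep_eq to_int_mod_ring.rep_eq)
      then have "int x mod int ?p = int y mod int ?p" using xy(3) by metis
      then show "x = y" using xy by simp
    qed
    then have "card ((of_nat :: nat \<Rightarrow> 'a mod_ring) ` {..<?p}) = ?p" by (simp add: card_image)
    then have "(of_nat :: nat \<Rightarrow> 'a mod_ring) ` {..<?p} = UNIV"
      by (intro card_subset_eq) simp_all
    then show "bij_betw (of_nat :: nat \<Rightarrow> 'a mod_ring) {..<?p} UNIV" using inj by (simp add: bij_betw_def)
  qed
  also have "\<dots> = (\<Sum>j<?p. unit_char ?p (int (\<Sum>s=1..d. g s * j ^ s)))"
  proof (rule sum.cong[OF refl])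
    fix j
    have "poly f (of_nat j) = of_nat (\<Sum>s=1..d. g s * j ^ s)"
      by (simp add: f_def poly_sum poly_monom)
    then show "\<psi> (poly f (of_nat j)) = unit_char ?p (int (\<Sum>s=1..d. g s * j ^ s))"
      by (simp only: \<psi>_of_nat)
  qed
  finally show ?thesis using weil_bound[of f] deg assms cf[of 0] by simp
qed

section \<open>Transfer to all primes\<close>

definition weil_bound_fails :: "nat \<Rightarrow> bool" where
  "weil_bound_fails p \<longleftrightarrow> (\<exists>d g. 0 < d \<and> d < p \<and> \<not> p dvd g d \<and>
     real (d - 1) * sqrt (real p) < cmod (\<Sum>j<p. unit_char p (int (\<Sum>s=1..d. g s * j ^ s))))"

text \<open>The default 2 keeps this a prime when no bound fails, as the type built on it must have
  prime cardinality in either case.\<close>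

definition exceptional_prime :: nat where
  "exceptional_prime = (if \<exists>p. prime p \<and> weil_bound_fails p then SOME p. prime p \<and> weil_bound_fails p else 2)"

lemma prime_exceptional: "prime exceptional_prime"
  unfolding exceptional_prime_def using someI_ex[of "\<lambda>p. prime p \<and> weil_bound_fails p"] by auto

text \<open>The theory of \<open>mod_ring\<close> needs a type with \<open>p\<close> elements. A single type suffices
  for all primes: if some prime violated the bound, we could choose a type with that many elements.\<close>

typedef exceptional = "{0..<exceptional_prime}"
  using prime_gt_0_nat[OF prime_exceptional] by auto

lemma CARD_exceptional: "CARD(exceptional) = exceptional_prime"
  using type_definition.card[OF type_definition_exceptional] by simp

instance exceptional :: prime_card
  by standard (simp add: CARD_exceptional prime_exceptional)

theorem weil_bound_prime:
  fixes g :: "nat \<Rightarrow> nat" and d p :: nat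
  assumes "prime p" and "0 < d" and "d < p" and "\<not> p dvd g d"
  shows "cmod (\<Sum>j<p. unit_char p (int (\<Sum>s=1..d. g s * j ^ s))) \<le> real (d - 1) * sqrt (real p)"
proof (rule ccontr)
  assume "\<not> ?thesis"
  then have "weil_bound_fails p" using assms unfolding weil_bound_fails_def by (meson not_le)
  then have ex: "\<exists>p. prime p \<and> weil_bound_fails p" using assms(1) by blast
  then have "weil_bound_fails exceptional_prime"
    unfolding exceptional_prime_def using someI_ex[OF ex] by simp
  then show False
    unfolding weil_bound_fails_def CARD_exceptional[symmetric] using weil_bound_CARD[where ?'a = exceptional] by (meson not_le)
qed

section \<open>Averages over the moment curve\<close>

lemma cnj_unit_char: "cnj (unit_char p a) = unit_char p (- a)"
  by (simp add: unit_char_def cis_cnj)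

lemma unit_char_cong: "0 < p \<Longrightarrow> a mod int p = b mod int p \<Longrightarrow> unit_char p a = unit_char p b"
  by (metis unit_char_mod)

lemma unit_char_of_nat_mult: "unit_char p (int t * a) = unit_char p a ^ t"
  by (induction t) (simp_all add: unit_char_add distrib_right)

lemma unit_char_sum: "unit_char p (sum f A) = (\<Prod>x\<in>A. unit_char p (f x))"
  by (induction A rule: infinite_finite_induct) (simp_all add: unit_char_add)

lemma sum_unit_char:
  assumes "0 < p"
  shows "(\<Sum>t<p. unit_char p (int t * a)) = (if int p dvd a then of_nat p else 0)"
proof (cases "int p dvd a")
  case True
  then have "unit_char p a = 1" using assms by (simp add: unit_char_eq_1_iff)
  then show ?thesis using True by (simp add: unit_char_of_nat_mult)
next
  case False
  have "unit_char p a ^ p = unit_char p (int p * a)" by (simp only: unit_char_of_nat_mult)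
  also have "\<dots> = 1" using assms by (simp add: unit_char_eq_1_iff)
  finally have "(\<Sum>t<p. unit_char p a ^ t) = 0"
    using False assms by (simp add: sum_gp_strict unit_char_eq_1_iff)
  then show ?thesis using False by (simp add: unit_char_of_nat_mult)
qed

text \<open>The group of vectors modulo \<open>p\<close>, as extensional functions so that it is
  finite. It doubles as its own dual group and, for \<open>p = 2\<close>, as the set of carry
  patterns.\<close>

abbreviation residue_vecs :: "nat \<Rightarrow> nat \<Rightarrow> (nat \<Rightarrow> nat) set" where
  "residue_vecs p D \<equiv> {..<D} \<rightarrow>\<^sub>E {..<p}"

definition residue_add :: "nat \<Rightarrow> nat \<Rightarrow> (nat \<Rightarrow> nat) \<Rightarrow> (nat \<Rightarrow> nat) \<Rightarrow> nat \<Rightarrow> nat" where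
  "residue_add p D y z = (\<lambda>s\<in>{..<D}. (y s + z s) mod p)"

definition moment_curve :: "nat \<Rightarrow> nat \<Rightarrow> nat \<Rightarrow> nat \<Rightarrow> nat" where
  "moment_curve p D j = (\<lambda>s\<in>{..<D}. j ^ (s + 1) mod p)"

definition residue_char :: "nat \<Rightarrow> nat \<Rightarrow> (nat \<Rightarrow> nat) \<Rightarrow> (nat \<Rightarrow> nat) \<Rightarrow> complex" where
  "residue_char p D \<xi> y = unit_char p (int (\<Sum>s<D. \<xi> s * y s))"

lemma residue_add_in: "0 < p \<Longrightarrow> residue_add p D y z \<in> residue_vecs p D"
  by (auto simp: residue_add_def)

lemma bij_betw_residue_add:
  assumes "0 < p"
  shows "bij_betw (\<lambda>y. residue_add p D y z) (residue_vecs p D) (residue_vecs p D)"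
proof -
  have inj: "inj_on (\<lambda>y. residue_add p D y z) (residue_vecs p D)"
  proof (rule inj_onI)
    fix y y' assume y: "y \<in> residue_vecs p D" "y' \<in> residue_vecs p D" "residue_add p D y z = residue_add p D y' z"
    show "y = y'"
    proof (rule PiE_ext[OF y(1,2)])
      fix s assume s: "s \<in> {..<D}"
      have "[y s + z s = y' s + z s] (mod p)"
        using fun_cong[OF y(3), of s] s by (simp add: residue_add_def Cong.cong_def)
      then have "[y s = y' s] (mod p)" by (simp add: cong_add_rcancel_nat)
      then show "y s = y' s" using y s by (auto simp: Cong.cong_def PiE_iff)
    qed
  qed
  have sub: "(\<lambda>y. residue_add p D y z) ` residue_vecs p D \<subseteq> residue_vecs p D"
    using residue_add_in[OF assms] by (rule image_subsetI)
  have "finite (residue_vecs p D)" by (rule finite_PiE) auto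
  then have "(\<lambda>y. residue_add p D y z) ` residue_vecs p D = residue_vecs p D"
    using sub inj by (rule endo_inj_surj)
  with inj show ?thesis by (rule bij_betw_imageI)
qed

lemma norm_residue_char [simp]: "cmod (residue_char p D \<xi> y) = 1"
  by (simp add: residue_char_def)

lemma residue_char_commute: "residue_char p D \<xi> y = residue_char p D y \<xi>"
  by (simp add: residue_char_def mult.commute)

lemma residue_char_add:
  assumes "0 < p"
  shows "residue_char p D \<xi> (residue_add p D y z) = residue_char p D \<xi> y * residue_char p D \<xi> z"
proof -
  have "(\<Sum>s<D. \<xi> s * residue_add p D y z s) mod p = (\<Sum>s<D. \<xi> s * residue_add p D y z s mod p) mod p"
    by (rule mod_sum_eq[symmetric])
  also have "\<dots> = (\<Sum>s<D. \<xi> s * (y s + z s) mod p) mod p"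
  proof -
    have "\<xi> s * residue_add p D y z s mod p = \<xi> s * (y s + z s) mod p" if "s < D" for s
      using that by (simp add: residue_add_def mod_mult_right_eq)
    then show ?thesis by simp
  qed
  also have "\<dots> = (\<Sum>s<D. \<xi> s * (y s + z s)) mod p"
    by (rule mod_sum_eq)
  finally have "int (\<Sum>s<D. \<xi> s * residue_add p D y z s) mod int p = int (\<Sum>s<D. \<xi> s * (y s + z s)) mod int p"
    by (metis of_nat_mod)
  then have "residue_char p D \<xi> (residue_add p D y z) = unit_char p (int (\<Sum>s<D. \<xi> s * (y s + z s)))"
    unfolding residue_char_def by (rule unit_char_cong[OF assms])
  then show ?thesis
    by (simp add: residue_char_def distrib_left sum.distrib unit_char_add)
qed

lemma residue_char_orthogonal:
  assumes "0 < p" and "y \<in> residue_vecs p D" and "z \<in> residue_vecs p D"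
  shows "(\<Sum>\<xi>\<in>residue_vecs p D. residue_char p D \<xi> y * cnj (residue_char p D \<xi> z)) = (if y = z then of_nat (p ^ D) else 0)"
proof -
  have "residue_char p D \<xi> y * cnj (residue_char p D \<xi> z) =
      (\<Prod>s<D. unit_char p (int (\<xi> s) * (int (y s) - int (z s))))" for \<xi>
  proof -
    have "residue_char p D \<xi> y * cnj (residue_char p D \<xi> z) =
        unit_char p (int (\<Sum>s<D. \<xi> s * y s) + - int (\<Sum>s<D. \<xi> s * z s))"
      by (simp only: residue_char_def cnj_unit_char unit_char_add)
    also have "int (\<Sum>s<D. \<xi> s * y s) + - int (\<Sum>s<D. \<xi> s * z s) = (\<Sum>s<D. int (\<xi> s) * (int (y s) - int (z s)))"
      by (simp add: sum_subtractf right_diff_distrib)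
    finally show ?thesis by (simp only: unit_char_sum)
  qed
  then have "(\<Sum>\<xi>\<in>residue_vecs p D. residue_char p D \<xi> y * cnj (residue_char p D \<xi> z)) =
      (\<Sum>\<xi>\<in>residue_vecs p D. \<Prod>s<D. unit_char p (int (\<xi> s) * (int (y s) - int (z s))))"
    by simp
  also have "\<dots> = (\<Prod>s<D. \<Sum>t<p. unit_char p (int t * (int (y s) - int (z s))))"
    by (rule prod_sum_PiE[symmetric]) auto
  also have "\<dots> = (\<Prod>s<D. if y s = z s then of_nat p else 0)"
  proof (rule prod.cong[OF refl])
    fix s assume "s \<in> {..<D}"
    then have yz: "y s < p" "z s < p" using assms by (auto simp: PiE_iff)
    have "int p dvd int (y s) - int (z s) \<longleftrightarrow> y s = z s"
    proof
      assume "int p dvd int (y s) - int (z s)"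
      then have "int (y s) mod int p = int (z s) mod int p" by (simp add: mod_eq_dvd_iff)
      then show "y s = z s" using yz by simp
    qed simp
    then show "(\<Sum>t<p. unit_char p (int t * (int (y s) - int (z s)))) = (if y s = z s then of_nat p else 0)"
      using assms(1) by (simp add: sum_unit_char)
  qed
  also have "\<dots> = (if y = z then of_nat (p ^ D) else 0)"
  proof (cases "y = z")
    case False
    then obtain s where "s < D" "y s \<noteq> z s" using PiE_ext[OF assms(2,3)] by auto
    then have "(\<Prod>s<D. if y s = z s then of_nat p else 0 :: complex) = 0" by (intro prod_zero) auto
    then show ?thesis using False by simp
  qed simp
  finally show ?thesis .
qed

definition residue_fourier :: "nat \<Rightarrow> nat \<Rightarrow> ((nat \<Rightarrow> nat) \<Rightarrow> real) \<Rightarrow> (nat \<Rightarrow> nat) \<Rightarrow> complex" where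
  "residue_fourier p D F \<xi> = (\<Sum>y\<in>residue_vecs p D. of_real (F y) * residue_char p D \<xi> y)"

lemma residue_parseval:
  assumes "0 < p"
  shows "(\<Sum>\<xi>\<in>residue_vecs p D. (cmod (residue_fourier p D F \<xi>))\<^sup>2) = real (p ^ D) * (\<Sum>y\<in>residue_vecs p D. (F y)\<^sup>2)"
proof -
  let ?G = "residue_vecs p D"
  have "complex_of_real (\<Sum>\<xi>\<in>?G. (cmod (residue_fourier p D F \<xi>))\<^sup>2) =
      (\<Sum>\<xi>\<in>?G. residue_fourier p D F \<xi> * cnj (residue_fourier p D F \<xi>))"
    unfolding of_real_sum complex_norm_square ..
  also have "\<dots> = (\<Sum>\<xi>\<in>?G. \<Sum>y\<in>?G. \<Sum>z\<in>?G. of_real (F y * F z) * (residue_char p D \<xi> y * cnj (residue_char p D \<xi> z)))"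
    unfolding residue_fourier_def cnj_sum sum_product
    by (intro sum.cong refl) (simp add: mult_ac)
  also have "\<dots> = (\<Sum>y\<in>?G. \<Sum>\<xi>\<in>?G. \<Sum>z\<in>?G. of_real (F y * F z) * (residue_char p D \<xi> y * cnj (residue_char p D \<xi> z)))"
    by (rule sum.swap)
  also have "\<dots> = (\<Sum>y\<in>?G. \<Sum>z\<in>?G. of_real (F y * F z) * (\<Sum>\<xi>\<in>?G. residue_char p D \<xi> y * cnj (residue_char p D \<xi> z)))"
    unfolding sum_distrib_left by (intro sum.cong refl sum.swap)
  also have "\<dots> = (\<Sum>y\<in>?G. \<Sum>z\<in>?G. if y = z then of_real (F y * F z) * of_nat (p ^ D) else 0)"
    by (intro sum.cong refl) (simp add: residue_char_orthogonal[OF assms])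
  also have "\<dots> = (\<Sum>y\<in>?G. of_real (F y * F y) * of_nat (p ^ D))"
    by (intro sum.cong refl) (simp add: sum.delta' finite_PiE)
  also have "\<dots> = complex_of_real (real (p ^ D) * (\<Sum>y\<in>?G. (F y)\<^sup>2))"
    by (simp add: sum_distrib_left power2_eq_square mult_ac)
  finally show ?thesis by (simp only: of_real_eq_iff)
qed

definition curve_average :: "nat \<Rightarrow> nat \<Rightarrow> ((nat \<Rightarrow> nat) \<Rightarrow> real) \<Rightarrow> (nat \<Rightarrow> nat) \<Rightarrow> real" where
  "curve_average p D F y = (\<Sum>j<p. F (residue_add p D y (moment_curve p D j))) / real p"

definition curve_discrepancy :: "nat \<Rightarrow> nat \<Rightarrow> ((nat \<Rightarrow> nat) \<Rightarrow> real) \<Rightarrow> (nat \<Rightarrow> nat) \<Rightarrow> real" where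
  "curve_discrepancy p D F y = curve_average p D F y - (\<Sum>z\<in>residue_vecs p D. F z) / real (p ^ D)"

definition curve_char_sum :: "nat \<Rightarrow> nat \<Rightarrow> (nat \<Rightarrow> nat) \<Rightarrow> complex" where
  "curve_char_sum p D \<xi> = (\<Sum>j<p. residue_char p D \<xi> (moment_curve p D j)) / of_nat p"

text \<open>Characters diagonalise averages over translates, and \<open>curve_char_sum\<close> is
  the Fourier multiplier up to conjugation.\<close>

lemma residue_fourier_curve_average:
  assumes "0 < p"
  shows "residue_fourier p D (curve_average p D F) \<xi> = residue_fourier p D F \<xi> * cnj (curve_char_sum p D \<xi>)"
proof -
  let ?G = "residue_vecs p D" and ?\<gamma> = "moment_curve p D" and ?\<chi> = "residue_char p D \<xi>"
  have shift: "(\<Sum>y\<in>?G. of_real (F (residue_add p D y z)) * ?\<chi> y) = residue_fourier p D F \<xi> * cnj (?\<chi> z)" for z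
  proof -
    have eq: "?\<chi> y = ?\<chi> (residue_add p D y z) * cnj (?\<chi> z)" for y
    proof -
      have "?\<chi> z * cnj (?\<chi> z) = 1" using norm_residue_char[of p D \<xi> z] by (simp add: complex_norm_square[symmetric])
      then show ?thesis by (simp add: residue_char_add[OF assms] mult.assoc)
    qed
    have "(\<Sum>y\<in>?G. of_real (F (residue_add p D y z)) * ?\<chi> y) =
        (\<Sum>y\<in>?G. of_real (F (residue_add p D y z)) * ?\<chi> (residue_add p D y z) * cnj (?\<chi> z))"
    proof (rule sum.cong[OF refl])
      fix y
      show "of_real (F (residue_add p D y z)) * ?\<chi> y =
          of_real (F (residue_add p D y z)) * ?\<chi> (residue_add p D y z) * cnj (?\<chi> z)"
        unfolding mult.assoc eq[of y, symmetric] ..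
    qed
    also have "\<dots> = (\<Sum>y\<in>?G. of_real (F y) * ?\<chi> y * cnj (?\<chi> z))"
      using sum.reindex_bij_betw[OF bij_betw_residue_add[OF assms, of D z], of "\<lambda>y. of_real (F y) * ?\<chi> y * cnj (?\<chi> z)"] .
    finally show ?thesis by (simp add: residue_fourier_def sum_distrib_right)
  qed
  have "residue_fourier p D (curve_average p D F) \<xi> =
      (\<Sum>y\<in>?G. \<Sum>j<p. of_real (F (residue_add p D y (?\<gamma> j))) * ?\<chi> y) / of_nat p"
    by (simp add: residue_fourier_def curve_average_def sum_divide_distrib sum_distrib_right)
  also have "(\<Sum>y\<in>?G. \<Sum>j<p. of_real (F (residue_add p D y (?\<gamma> j))) * ?\<chi> y) =
      (\<Sum>j<p. \<Sum>y\<in>?G. of_real (F (residue_add p D y (?\<gamma> j))) * ?\<chi> y)"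
    by (rule sum.swap)
  also have "\<dots> = residue_fourier p D F \<xi> * (\<Sum>j<p. cnj (?\<chi> (?\<gamma> j)))"
    by (simp only: shift sum_distrib_left)
  finally show ?thesis by (simp add: curve_char_sum_def)
qed

text \<open>If \<open>m\<close> is the last index with \<open>\<xi> m\<close> nonzero, the phase is
  a polynomial of degree \<open>m + 1\<close> in \<open>j\<close> with leading coefficient nonzero
  modulo \<open>p\<close>, and the Weil bound gives \<open>m * sqrt p\<close>. That bound needs
  degree below \<open>p\<close>; for \<open>D >= p\<close> the trivial bound 1 is enough, as
  \<open>sqrt p <= D\<close>.\<close>

lemma norm_curve_char_sum_le:
  assumes p: "prime p" and \<xi>: "\<xi> \<in> residue_vecs p D" and s: "s < D" "\<xi> s \<noteq> 0"
  shows "cmod (curve_char_sum p D \<xi>) \<le> real D / sqrt (real p)"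
proof (cases "D < p")
  case True
  have p0: "0 < p" using p by (simp add: prime_gt_0_nat)
  define m where "m = Max {s. s < D \<and> \<xi> s \<noteq> 0}"
  have "m \<in> {s. s < D \<and> \<xi> s \<noteq> 0}" unfolding m_def using s by (intro Max_in) auto
  then have m: "m < D" "\<xi> m \<noteq> 0" by auto
  have zero: "\<xi> k = 0" if "m < k" "k < D" for k
  proof (rule ccontr)
    assume "\<xi> k \<noteq> 0"
    then have "k \<le> m" unfolding m_def using that by (intro Max_ge) auto
    then show False using that by simp
  qed
  have "residue_char p D \<xi> (moment_curve p D j) = unit_char p (int (\<Sum>i=1..Suc m. \<xi> (i - 1) * j ^ i))" for j
  proof -
    have "(\<Sum>s<D. \<xi> s * moment_curve p D j s) mod p = (\<Sum>s<D. \<xi> s * moment_curve p D j s mod p) mod p"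
      by (rule mod_sum_eq[symmetric])
    also have "\<dots> = (\<Sum>s<D. \<xi> s * j ^ (s + 1) mod p) mod p"
    proof -
      have "\<xi> s * moment_curve p D j s mod p = \<xi> s * j ^ (s + 1) mod p" if "s < D" for s
        using that by (simp add: moment_curve_def mod_mult_right_eq)
      then show ?thesis by simp
    qed
    also have "\<dots> = (\<Sum>s<D. \<xi> s * j ^ (s + 1)) mod p"
      by (rule mod_sum_eq)
    also have "(\<Sum>s<D. \<xi> s * j ^ (s + 1)) = (\<Sum>s<Suc m. \<xi> s * j ^ (s + 1))"
      using m zero by (intro sum.mono_neutral_right) auto
    also have "\<dots> = (\<Sum>i=1..Suc m. \<xi> (i - 1) * j ^ i)"
      by (rule sum.reindex_bij_witness[of _ "\<lambda>i. i - 1" Suc]) auto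
    finally have "int (\<Sum>s<D. \<xi> s * moment_curve p D j s) mod int p = int (\<Sum>i=1..Suc m. \<xi> (i - 1) * j ^ i) mod int p"
      by (metis of_nat_mod)
    then show ?thesis unfolding residue_char_def by (rule unit_char_cong[OF p0])
  qed
  moreover have "cmod (\<Sum>j<p. unit_char p (int (\<Sum>i=1..Suc m. \<xi> (i - 1) * j ^ i))) \<le> real (Suc m - 1) * sqrt (real p)"
  proof (rule weil_bound_prime[OF p, of "Suc m" "\<lambda>i. \<xi> (i - 1)"])
    have "\<xi> m < p" using \<xi> m by (auto simp: PiE_iff)
    then show "\<not> p dvd \<xi> (Suc m - 1)" using m by (simp add: nat_dvd_not_less)
  qed (use m True in auto)
  ultimately have "cmod (\<Sum>j<p. residue_char p D \<xi> (moment_curve p D j)) \<le> real D * sqrt (real p)"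
    using m mult_right_mono[of "real m" "real D" "sqrt (real p)"] by simp
  then have "cmod (curve_char_sum p D \<xi>) \<le> real D * sqrt (real p) / real p"
    using p0 by (simp add: curve_char_sum_def norm_divide divide_right_mono)
  also have "\<dots> = real D / sqrt (real p)"
    using p0 by (simp add: field_simps flip: power2_eq_square)
  finally show ?thesis .
next
  case False
  have p0: "0 < p" using p by (simp add: prime_gt_0_nat)
  have "cmod (\<Sum>j<p. residue_char p D \<xi> (moment_curve p D j)) \<le> (\<Sum>j<p. cmod (residue_char p D \<xi> (moment_curve p D j)))"
    by (rule norm_sum)
  then have "cmod (curve_char_sum p D \<xi>) \<le> 1"
    using p0 by (simp add: curve_char_sum_def norm_divide)
  also have "1 \<le> real D / sqrt (real p)"
  proof -
    have "real p * 1 \<le> real p * real p" using p0 by (intro mult_left_mono) auto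
    then have "sqrt (real p) \<le> real p" by (intro real_le_lsqrt) (auto simp: power2_eq_square)
    then have "sqrt (real p) \<le> real D" using False by linarith
    then show ?thesis using p0 by simp
  qed
  finally show ?thesis .
qed

text \<open>By Parseval it is enough to compare Fourier coefficients. At frequency 0 the subtracted
  mean removes everything; elsewhere it is invisible, and averaging multiplies by at most
  \<open>D / sqrt p\<close>.\<close>

theorem sum_curve_discrepancy_le:
  assumes p: "prime p"
  shows "(\<Sum>y\<in>residue_vecs p D. (curve_discrepancy p D F y)\<^sup>2) \<le> (real D)\<^sup>2 / real p * (\<Sum>y\<in>residue_vecs p D. (F y)\<^sup>2)"
proof -
  let ?G = "residue_vecs p D"
  have p0: "0 < p" using p by (simp add: prime_gt_0_nat)
  have le: "(cmod (residue_fourier p D (curve_discrepancy p D F) \<xi>))\<^sup>2 \<le>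
      (real D)\<^sup>2 / real p * (cmod (residue_fourier p D F \<xi>))\<^sup>2" if \<xi>: "\<xi> \<in> ?G" for \<xi>
  proof -
    let ?avg = "(\<Sum>z\<in>?G. F z) / real (p ^ D)"
    define zv where "zv = (\<lambda>s\<in>{..<D}. 0 :: nat)"
    have oG: "zv \<in> ?G" using p0 by (auto simp: zv_def)
    have \<chi>o: "residue_char p D y zv = 1" for y by (simp add: residue_char_def zv_def)
    have sum\<chi>: "(\<Sum>y\<in>?G. residue_char p D \<xi> y) = (if \<xi> = zv then of_nat (p ^ D) else 0)"
      using residue_char_orthogonal[OF p0 \<xi> oG] by (simp add: \<chi>o residue_char_commute[of p D \<xi>])
    have eq: "residue_fourier p D (curve_discrepancy p D F) \<xi> =
        residue_fourier p D F \<xi> * cnj (curve_char_sum p D \<xi>) - of_real ?avg * (\<Sum>y\<in>?G. residue_char p D \<xi> y)"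
      unfolding residue_fourier_curve_average[OF p0, symmetric]
      by (simp add: residue_fourier_def curve_discrepancy_def left_diff_distrib sum_subtractf sum_distrib_left)
    show ?thesis
    proof (cases "\<xi> = zv")
      case True
      have "curve_char_sum p D zv = 1"
        using p0 by (simp add: curve_char_sum_def residue_char_commute[of p D zv] \<chi>o)
      moreover have "residue_fourier p D F zv = of_real (\<Sum>z\<in>?G. F z)"
        by (simp add: residue_fourier_def residue_char_commute[of p D zv] \<chi>o)
      ultimately have "residue_fourier p D (curve_discrepancy p D F) \<xi> = 0"
        using eq sum\<chi> True p0 by simp
      then show ?thesis by simp
    next
      case False
      then obtain s where s: "s < D" "\<xi> s \<noteq> 0"
        using PiE_ext[OF \<xi> oG] by (auto simp: zv_def)
      have "cmod (residue_fourier p D (curve_discrepancy p D F) \<xi>) = cmod (residue_fourier p D F \<xi>) * cmod (curve_char_sum p D \<xi>)"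
        using eq sum\<chi> False by (simp add: norm_mult)
      also have "\<dots> \<le> cmod (residue_fourier p D F \<xi>) * (real D / sqrt (real p))"
        by (intro mult_left_mono norm_curve_char_sum_le[OF p \<xi> s]) simp
      finally have "(cmod (residue_fourier p D (curve_discrepancy p D F) \<xi>))\<^sup>2 \<le>
          (cmod (residue_fourier p D F \<xi>) * (real D / sqrt (real p)))\<^sup>2"
        by (rule power_mono) simp
      also have "\<dots> = (real D)\<^sup>2 / real p * (cmod (residue_fourier p D F \<xi>))\<^sup>2"
        by (simp add: power_mult_distrib power_divide)
      finally show ?thesis .
    qed
  qed
  have "real (p ^ D) * (\<Sum>y\<in>?G. (curve_discrepancy p D F y)\<^sup>2) =
      (\<Sum>\<xi>\<in>?G. (cmod (residue_fourier p D (curve_discrepancy p D F) \<xi>))\<^sup>2)"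
    by (rule residue_parseval[OF p0, symmetric])
  also have "\<dots> \<le> (\<Sum>\<xi>\<in>?G. (real D)\<^sup>2 / real p * (cmod (residue_fourier p D F \<xi>))\<^sup>2)"
    by (rule sum_mono[OF le])
  also have "\<dots> = real (p ^ D) * ((real D)\<^sup>2 / real p * (\<Sum>y\<in>?G. (F y)\<^sup>2))"
    unfolding sum_distrib_left[symmetric] residue_parseval[OF p0] by (simp add: mult_ac)
  finally show ?thesis by (rule mult_left_le_imp_le) (use p0 in simp)
qed

section \<open>Covering lemmas and geometric sums\<close>

lemma card_lattice_box:
  assumes "S \<subseteq> int_lattice d" and "\<And>w r. w \<in> S \<Longrightarrow> r < d \<Longrightarrow> w r \<in> A r" and "\<And>r. r < d \<Longrightarrow> finite (A r)"
  shows "finite S" and "card S \<le> (\<Prod>r<d. card (A r))"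
proof -
  let ?f = "\<lambda>w. restrict w {..<d}"
  have inj: "inj_on ?f S"
  proof (rule inj_onI)
    fix v w assume vw: "v \<in> S" "w \<in> S" "?f v = ?f w"
    show "v = w"
    proof
      fix r
      show "v r = w r"
      proof (cases "r < d")
        case True
        then show ?thesis using fun_cong[OF vw(3), of r] by simp
      next
        case False
        have "v \<in> int_lattice d" "w \<in> int_lattice d" using vw(1,2) assms(1) by blast+
        then show ?thesis using False by (simp add: int_lattice_def)
      qed
    qed
  qed
  have sub: "?f ` S \<subseteq> PiE {..<d} A" by (intro image_subsetI) (simp add: restrict_PiE_iff assms(2))
  have fin: "finite (PiE {..<d} A)" using assms(3) by (intro finite_PiE) auto
  show "finite S" using inj sub fin by (meson finite_imageD finite_subset)
  have "card S = card (?f ` S)" using inj by (simp add: card_image)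
  also have "\<dots> \<le> card (PiE {..<d} A)" using sub fin by (intro card_mono)
  finally show "card S \<le> (\<Prod>r<d. card (A r))" by (simp add: card_PiE)
qed

definition lattice_cube :: "nat \<Rightarrow> (nat \<Rightarrow> int) \<Rightarrow> nat \<Rightarrow> (nat \<Rightarrow> int) set" where
  "lattice_cube d n \<rho> = {m \<in> int_lattice d. \<forall>r<d. \<bar>m r - n r\<bar> \<le> int \<rho>}"

lemma finite_lattice_cube: "finite (lattice_cube d n \<rho>)"
  and card_lattice_cube_le: "card (lattice_cube d n \<rho>) \<le> (2 * \<rho> + 1) ^ d"
proof -
  have sub: "lattice_cube d n \<rho> \<subseteq> int_lattice d" by (auto simp: lattice_cube_def)
  have mem: "w r \<in> {n r - int \<rho>..n r + int \<rho>}" if "w \<in> lattice_cube d n \<rho>" "r < d" for w r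
    using that by (auto simp: lattice_cube_def abs_le_iff)
  let ?A = "\<lambda>r. {n r - int \<rho>..n r + int \<rho>}"
  show "finite (lattice_cube d n \<rho>)"
    by (rule card_lattice_box(1)[OF sub, of ?A]) (erule (1) mem, simp)
  have "card (lattice_cube d n \<rho>) \<le> (\<Prod>r<d. card (?A r))"
    by (rule card_lattice_box(2)[OF sub, of ?A]) (erule (1) mem, simp)
  also have "\<dots> = (2 * \<rho> + 1) ^ d" by (simp add: nat_add_distrib nat_mult_distrib flip: numeral_2_eq_2)
  finally show "card (lattice_cube d n \<rho>) \<le> (2 * \<rho> + 1) ^ d" .
qed

text \<open>Greedy choice of the largest radius: a discarded cube meets a chosen one that is at
  least as large, so its centre is within twice, hence three times, the chosen radius.\<close>

lemma vitali_lattice_cubes: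
  assumes "finite X" and "X \<subseteq> int_lattice d"
  shows "\<exists>Y\<subseteq>X. disjoint_family_on (\<lambda>y. lattice_cube d y (\<rho> y)) Y \<and> X \<subseteq> (\<Union>y\<in>Y. lattice_cube d y (3 * \<rho> y))"
  using assms
proof (induction X rule: finite_psubset_induct)
  case (psubset X)
  show ?case
  proof (cases "X = {}")
    case True
    then show ?thesis by (auto simp: disjoint_family_on_def)
  next
    case False
    have "Max (\<rho> ` X) \<in> \<rho> ` X" using False psubset.hyps by (intro Max_in) auto
    then obtain x0 where x0: "x0 \<in> X" "\<rho> x0 = Max (\<rho> ` X)" by auto
    have max: "\<rho> x \<le> \<rho> x0" if "x \<in> X" for x
      unfolding x0(2) using that psubset.hyps by (intro Max_ge) auto
    define X' where "X' = {x \<in> X. lattice_cube d x (\<rho> x) \<inter> lattice_cube d x0 (\<rho> x0) = {}}"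
    have "x0 \<in> lattice_cube d x0 (\<rho> x0)" using x0 psubset.prems by (auto simp: lattice_cube_def)
    then have "x0 \<notin> X'" unfolding X'_def by blast
    moreover have "X' \<subseteq> X" by (auto simp: X'_def)
    ultimately have "X' \<subset> X" using x0(1) by blast
    then obtain Y where Y: "Y \<subseteq> X'" "disjoint_family_on (\<lambda>y. lattice_cube d y (\<rho> y)) Y"
      "X' \<subseteq> (\<Union>y\<in>Y. lattice_cube d y (3 * \<rho> y))"
      using psubset.IH[of X'] psubset.prems by blast
    have "disjoint_family_on (\<lambda>y. lattice_cube d y (\<rho> y)) (insert x0 Y)"
      using Y(1,2) by (auto simp: disjoint_family_on_def X'_def)
    moreover have "x \<in> lattice_cube d x0 (3 * \<rho> x0)" if x: "x \<in> X - X'" for x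
    proof -
      obtain z where z: "z \<in> lattice_cube d x (\<rho> x)" "z \<in> lattice_cube d x0 (\<rho> x0)"
        using x by (auto simp: X'_def)
      have "\<bar>x r - x0 r\<bar> \<le> int (3 * \<rho> x0)" if "r < d" for r
      proof -
        have "\<bar>z r - x r\<bar> \<le> int (\<rho> x)" "\<bar>z r - x0 r\<bar> \<le> int (\<rho> x0)"
          using z that by (auto simp: lattice_cube_def)
        then show ?thesis using max[of x] x by simp
      qed
      then show ?thesis using x psubset.prems by (auto simp: lattice_cube_def)
    qed
    ultimately show ?thesis using Y x0 \<open>X' \<subset> X\<close> by (intro exI[of _ "insert x0 Y"]) auto
  qed
qed

text \<open>The disjoint cubes carry separate parts of the mass \<open>A\<close>, and their triples
  cover \<open>X\<close>. A cube of radius \<open>3 * \<rho>\<close> has side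
  \<open>6 * \<rho> + 1\<close>, at most \<open>7 * \<rho>\<close> because
  \<open>\<rho> >= 1\<close>; hence \<open>7 ^ d\<close>. A radius attached to each point takes the
  place of the maximal function.\<close>

lemma hardy_littlewood_lattice:
  fixes f :: "(nat \<Rightarrow> int) \<Rightarrow> real"
  assumes X: "finite X" "X \<subseteq> int_lattice d" and f: "\<And>m. 0 \<le> f m" and s: "0 < s"
    and A: "\<And>W. finite W \<Longrightarrow> W \<subseteq> int_lattice d \<Longrightarrow> sum f W \<le> A"
    and \<rho>: "\<And>x. x \<in> X \<Longrightarrow> 1 \<le> \<rho> x"
    and big: "\<And>x. x \<in> X \<Longrightarrow> s * real (\<rho> x) ^ d \<le> (\<Sum>m\<in>lattice_cube d x (\<rho> x). f m)"
  shows "real (card X) \<le> 7 ^ d / s * A"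
proof -
  obtain Y where Y: "Y \<subseteq> X" "disjoint_family_on (\<lambda>y. lattice_cube d y (\<rho> y)) Y"
      "X \<subseteq> (\<Union>y\<in>Y. lattice_cube d y (3 * \<rho> y))"
    using vitali_lattice_cubes[OF X] by blast
  have finY: "finite Y" using Y X finite_subset by blast
  have "card X \<le> card (\<Union>y\<in>Y. lattice_cube d y (3 * \<rho> y))"
    using Y finY finite_lattice_cube by (intro card_mono) auto
  also have "\<dots> \<le> (\<Sum>y\<in>Y. card (lattice_cube d y (3 * \<rho> y)))"
    using finY by (rule card_UN_le)
  also have "\<dots> \<le> (\<Sum>y\<in>Y. (7 * \<rho> y) ^ d)"
  proof (rule sum_mono)
    fix y assume "y \<in> Y"
    then have "1 \<le> \<rho> y" using \<rho> Y by auto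
    then have "2 * (3 * \<rho> y) + 1 \<le> 7 * \<rho> y" by simp
    then have "(2 * (3 * \<rho> y) + 1) ^ d \<le> (7 * \<rho> y) ^ d" by (rule power_mono) simp
    with card_lattice_cube_le show "card (lattice_cube d y (3 * \<rho> y)) \<le> (7 * \<rho> y) ^ d"
      by (rule order_trans)
  qed
  finally have "real (card X) \<le> (\<Sum>y\<in>Y. 7 ^ d * real (\<rho> y) ^ d)"
    by (simp add: power_mult_distrib flip: of_nat_le_iff[where ?'a = real])
  also have "\<dots> \<le> (\<Sum>y\<in>Y. 7 ^ d / s * (\<Sum>m\<in>lattice_cube d y (\<rho> y). f m))"
  proof (rule sum_mono)
    fix y assume "y \<in> Y"
    then have "7 ^ d / s * (s * real (\<rho> y) ^ d) \<le> 7 ^ d / s * (\<Sum>m\<in>lattice_cube d y (\<rho> y). f m)"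
      using big Y s by (intro mult_left_mono) auto
    then show "7 ^ d * real (\<rho> y) ^ d \<le> 7 ^ d / s * (\<Sum>m\<in>lattice_cube d y (\<rho> y). f m)"
      using s by simp
  qed
  also have "\<dots> = 7 ^ d / s * (\<Sum>m\<in>(\<Union>y\<in>Y. lattice_cube d y (\<rho> y)). f m)"
  proof -
    have "(\<Sum>m\<in>(\<Union>y\<in>Y. lattice_cube d y (\<rho> y)). f m) = (\<Sum>y\<in>Y. \<Sum>m\<in>lattice_cube d y (\<rho> y). f m)"
      by (rule sum.UNION_disjoint_family[OF finY _ Y(2)]) (simp add: finite_lattice_cube)
    then show ?thesis by (simp only: sum_distrib_left)
  qed
  also have "\<dots> \<le> 7 ^ d / s * A"
    using s finY finite_lattice_cube by (intro mult_left_mono A) (auto simp: lattice_cube_def)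
  finally show ?thesis .
qed

text \<open>Going down from \<open>K\<close>, each term shrinks at least by \<open>1 / c\<close>,
  and \<open>c / (c - 1)\<close> is the sum of that geometric series.\<close>

lemma sum_prefix_geometric:
  fixes P :: "nat \<Rightarrow> real"
  assumes c: "1 < c" and P: "\<And>k. 1 \<le> k \<Longrightarrow> 0 < P k" "\<And>k. 1 \<le> k \<Longrightarrow> c * P k \<le> P (k + 1)" and "1 \<le> K"
  shows "(\<Sum>k=1..K. P k) \<le> c / (c - 1) * P K"
  using \<open>1 \<le> K\<close>
proof (induction K rule: dec_induct)
  case base
  have "1 \<le> c / (c - 1)" using c by simp
  then have "1 * P 1 \<le> c / (c - 1) * P 1" using P(1)[of 1] by (intro mult_right_mono) auto
  then show ?case by simp
next
  case (step K)
  have "c / (c - 1) * P K = 1 / (c - 1) * (c * P K)" by simp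
  also have "\<dots> \<le> 1 / (c - 1) * P (Suc K)"
    using P(2)[of K] step c by (intro mult_left_mono) auto
  finally have "(\<Sum>k=1..Suc K. P k) \<le> (1 / (c - 1) + 1) * P (Suc K)"
    using step by (simp add: algebra_simps)
  also have "1 / (c - 1) + 1 = c / (c - 1)" using c by (simp add: field_simps)
  finally show ?case .
qed

text \<open>The last term below \<open>y\<close> dominates. With \<open>y = f m / t\<close> this
  handles the values above the splitting height.\<close>

lemma sum_below_geometric:
  fixes P :: "nat \<Rightarrow> real"
  assumes c: "1 < c" and P: "\<And>k. 1 \<le> k \<Longrightarrow> 0 < P k" "\<And>k. 1 \<le> k \<Longrightarrow> c * P k \<le> P (k + 1)" and y: "0 \<le> y"
  shows "(\<Sum>k=1..K. if P k < y then P k else 0) \<le> c / (c - 1) * y"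
proof (induction K)
  case 0
  then show ?case using c y by simp
next
  case (Suc K)
  show ?case
  proof (cases "P (Suc K) < y")
    case True
    have "(\<Sum>k=1..Suc K. if P k < y then P k else 0) \<le> (\<Sum>k=1..Suc K. P k)"
      using P(1) by (intro sum_mono) (auto intro: less_imp_le)
    also have "\<dots> \<le> c / (c - 1) * P (Suc K)" by (rule sum_prefix_geometric[where c = c and P = P, OF c P]) auto
    also have "\<dots> \<le> c / (c - 1) * y" using True c by (intro mult_left_mono) auto
    finally show ?thesis .
  qed (use Suc in simp)
qed

text \<open>The first term reaching \<open>y\<close> dominates, as the reciprocals decay
  geometrically from there on. With \<open>y = f m / t\<close> this handles the values below the
  splitting height.\<close>

lemma sum_above_geometric:
  fixes P :: "nat \<Rightarrow> real"
  assumes c: "1 < c" and P: "\<And>k. 1 \<le> k \<Longrightarrow> 0 < P k" "\<And>k. 1 \<le> k \<Longrightarrow> c * P k \<le> P (k + 1)" and y: "0 < y"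
  shows "(\<Sum>k=1..K. if y \<le> P k then 1 / P k else 0) \<le> c / (c - 1) / y"
proof -
  have full: "(\<Sum>k=i..K. 1 / P k) \<le> c / (c - 1) / P i" if "1 \<le> i" for i
    using that
  proof (induction "Suc K - i" arbitrary: i)
    case 0
    then have "K < i" by simp
    then show ?case using c P(1)[OF 0(2)] by simp
  next
    case (Suc n)
    then have iK: "i \<le> K" by simp
    have "(\<Sum>k=Suc i..K. 1 / P k) \<le> c / (c - 1) / P (Suc i)"
      using Suc by (intro Suc.hyps(1)) auto
    also have "\<dots> \<le> c / (c - 1) / (c * P i)"
      using P(2)[OF Suc.prems] P(1)[OF Suc.prems] P(1)[of "Suc i"] c
      by (intro divide_left_mono mult_pos_pos) auto
    also have "\<dots> = 1 / (c - 1) / P i" using c by simp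
    finally have "(\<Sum>k=i..K. 1 / P k) \<le> (1 + 1 / (c - 1)) / P i"
      using iK by (simp add: sum.atLeast_Suc_atMost add_divide_distrib)
    also have "1 + 1 / (c - 1) = c / (c - 1)" using c by (simp add: field_simps)
    finally show ?case .
  qed
  have "(\<Sum>k=i..K. if y \<le> P k then 1 / P k else 0) \<le> c / (c - 1) / y" if "1 \<le> i" for i
    using that
  proof (induction "Suc K - i" arbitrary: i)
    case 0
    then have "K < i" by simp
    then show ?case using c y by simp
  next
    case (Suc n)
    then have iK: "i \<le> K" by simp
    show ?case
    proof (cases "y \<le> P i")
      case True
      have "(\<Sum>k=i..K. if y \<le> P k then 1 / P k else 0) \<le> (\<Sum>k=i..K. 1 / P k)"
        using P(1) Suc.prems by (intro sum_mono) (auto simp: less_imp_le[OF P(1)])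
      also have "\<dots> \<le> c / (c - 1) / P i" by (rule full[OF Suc.prems])
      also have "\<dots> \<le> c / (c - 1) / y" using True y P(1)[OF Suc.prems] c
        by (intro divide_left_mono mult_pos_pos) auto
      finally show ?thesis .
    next
      case False
      have "(\<Sum>k=Suc i..K. if y \<le> P k then 1 / P k else 0) \<le> c / (c - 1) / y"
        using Suc by (intro Suc.hyps(1)) auto
      then show ?thesis using iK False by (simp add: sum.atLeast_Suc_atMost)
    qed
  qed
  then show ?thesis by simp
qed

section \<open>Digits of lattice points\<close>

text \<open>Position \<open>s = r * q + i\<close> holds digit \<open>i\<close> of coordinate
  \<open>r\<close>. In this numbering the digits of \<open>residue_point\<close> are the
  \<open>j ^ (s + 1) mod p\<close>, that is, the point of \<open>moment_curve\<close>.\<close>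

definition lattice_digits :: "nat \<Rightarrow> nat \<Rightarrow> nat \<Rightarrow> (nat \<Rightarrow> int) \<Rightarrow> nat \<Rightarrow> nat" where
  "lattice_digits p d q n = (\<lambda>s\<in>{..<d * q}. nat (n (s div q) div int p ^ (s mod q) mod int p))"

definition lattice_cell :: "nat \<Rightarrow> nat \<Rightarrow> (nat \<Rightarrow> int) \<Rightarrow> nat \<Rightarrow> int" where
  "lattice_cell p q n = (\<lambda>r. n r div int p ^ q)"

text \<open>The coordinates of \<open>residue_point\<close> lie between 0 and
  \<open>p^q - 1\<close>, so adding it keeps each coordinate in its cell or moves it to the next
  one.\<close>

definition nearby :: "nat \<Rightarrow> nat \<Rightarrow> nat \<Rightarrow> (nat \<Rightarrow> int) \<Rightarrow> (nat \<Rightarrow> int) set" where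
  "nearby p d q w = {m \<in> int_lattice d. \<forall>r<d. lattice_cell p q m r \<in> {w r, w r + 1}}"

text \<open>The nearby cells are folded onto one copy of the digit vectors. A point that leaves its
  cell is thus still seen, and overflow of the top digit becomes addition modulo
  \<open>p\<close>.\<close>

definition digit_fun :: "nat \<Rightarrow> nat \<Rightarrow> nat \<Rightarrow> ((nat \<Rightarrow> int) \<Rightarrow> real) \<Rightarrow> (nat \<Rightarrow> int) \<Rightarrow> (nat \<Rightarrow> nat) \<Rightarrow> real" where
  "digit_fun p d q f w y = (\<Sum>m | m \<in> nearby p d q w \<and> lattice_digits p d q m = y. f m)"

lemma div_add_carry:
  fixes u x P :: int
  assumes "0 \<le> x" and "x < P"
  obtains e :: nat where "e < 2" and "(u + x) div P = u div P + int e"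
proof -
  have P: "0 < P" using assms by simp
  have "(u + x) div P = (u div P * P + (u mod P + x)) div P" by (simp add: algebra_simps)
  also have "\<dots> = u div P + (u mod P + x) div P" using P by (intro div_mult_self3) simp
  finally have eq: "(u + x) div P = u div P + (u mod P + x) div P" .
  show ?thesis
  proof (cases "u mod P + x < P")
    case True
    then have "(u mod P + x) div P = 0" using assms P by (simp add: div_pos_pos_trivial)
    then show ?thesis using eq that[of 0] by simp
  next
    case False
    have "u mod P < P" using P by simp
    then have "(u mod P + x) div P = 1"
      by (intro int_div_pos_eq[where r = "u mod P + x - P"]) (use False assms in linarith)+
    then show ?thesis using eq that[of 1] by simp
  qed
qed

lemma digit_sum_less:
  fixes c :: "nat \<Rightarrow> nat"
  assumes "\<And>i. i < q \<Longrightarrow> c i < p"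
  shows "(\<Sum>i<q. p ^ i * c i) < p ^ q"
  using assms
proof (induction q)
  case (Suc q)
  have "(\<Sum>i<Suc q. p ^ i * c i) < p ^ q + p ^ q * c q" using Suc by simp
  also have "\<dots> = p ^ q * Suc (c q)" by simp
  also have "\<dots> \<le> p ^ q * p" using Suc.prems[of q] by (intro mult_le_mono2) simp
  finally show ?case by (simp add: mult.commute)
qed simp

text \<open>The digits \<open>c\<close> below position \<open>i\<close> add up to less than
  \<open>p^i\<close>, hence to a carry of at most 1; those above contribute multiples of
  \<open>p^(i + 1)\<close>, invisible in digit \<open>i\<close>.\<close>

lemma digit_add_carry:
  fixes c :: "nat \<Rightarrow> nat" and u :: int
  assumes c: "\<And>i. i < q \<Longrightarrow> c i < p" and i: "i < q"
  obtains e :: nat where "e < 2"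
    and "nat ((u + int (\<Sum>i<q. p ^ i * c i)) div int p ^ i mod int p) = (nat (u div int p ^ i mod int p) + e + c i) mod p"
proof -
  have p0: "0 < p" using c[OF i] by simp
  define lo where "lo = (\<Sum>k<i. p ^ k * c k)"
  define hi where "hi = (\<Sum>k<q - Suc i. p ^ k * c (Suc i + k))"
  have "(\<Sum>k<q. p ^ k * c k) = (\<Sum>k<i + Suc (q - Suc i). p ^ k * c k)" using i by simp
  also have "\<dots> = lo + (\<Sum>k<Suc (q - Suc i). p ^ (i + k) * c (i + k))"
    unfolding lo_def by (rule sum_lessThan_add)
  also have "(\<Sum>k<Suc (q - Suc i). p ^ (i + k) * c (i + k)) =
      p ^ i * c i + (\<Sum>k<q - Suc i. p ^ (i + Suc k) * c (i + Suc k))"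
    by (subst sum.lessThan_Suc_shift) simp
  also have "(\<Sum>k<q - Suc i. p ^ (i + Suc k) * c (i + Suc k)) = p ^ i * (p * hi)"
    by (simp add: hi_def sum_distrib_left power_add mult_ac)
  finally have x: "u + int (\<Sum>k<q. p ^ k * c k) = (u + int lo) + int p ^ i * (int (c i) + int p * int hi)"
    by (simp add: algebra_simps)
  have "lo < p ^ i" unfolding lo_def by (rule digit_sum_less) (use c i in auto)
  then have "int lo < int p ^ i" by (metis of_nat_less_iff of_nat_power)
  then obtain e :: nat where e: "e < 2" "(u + int lo) div int p ^ i = u div int p ^ i + int e"
    using div_add_carry[of "int lo" "int p ^ i" u] by auto
  have "(u + int (\<Sum>k<q. p ^ k * c k)) div int p ^ i = u div int p ^ i + int e + (int (c i) + int p * int hi)"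
    unfolding x using p0 e(2) by simp
  then have "(u + int (\<Sum>k<q. p ^ k * c k)) div int p ^ i mod int p = (u div int p ^ i + int e + int (c i) + int p * int hi) mod int p"
    by (simp add: add.assoc)
  also have "\<dots> = (u div int p ^ i + int e + int (c i)) mod int p" by simp
  also have "\<dots> = (u div int p ^ i mod int p + int e + int (c i)) mod int p"
    unfolding add.assoc by (rule mod_add_left_eq[symmetric])
  also have "\<dots> = int ((nat (u div int p ^ i mod int p) + e + c i) mod p)"
    using p0 by (simp add: zmod_int)
  finally show ?thesis using e(1) that[of e] by simp
qed

lemma int_eq_of_digits:
  fixes u v :: int
  assumes "u div int p ^ q = v div int p ^ q"
    and "\<And>i. i < q \<Longrightarrow> u div int p ^ i mod int p = v div int p ^ i mod int p"
  shows "u = v"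
  using assms
proof (induction q)
  case (Suc q)
  have "z div int p ^ q = int p * (z div int p ^ Suc q) + z div int p ^ q mod int p" for z :: int
  proof -
    have "z div int p ^ Suc q = z div int p ^ q div int p"
      by (simp add: power_Suc2 zdiv_zmult2_eq del: power_Suc)
    then show ?thesis by simp
  qed
  then have "u div int p ^ q = v div int p ^ q" using Suc.prems(1) Suc.prems(2)[of q] by (metis lessI)
  then show ?case using Suc by simp
qed simp

lemma lattice_digits_in: "0 < p \<Longrightarrow> lattice_digits p d q n \<in> residue_vecs p (d * q)"
  by (auto simp: lattice_digits_def nat_less_iff)

lemma lattice_eq_of_digits:
  assumes p: "0 < p" and n: "n \<in> int_lattice d" "n' \<in> int_lattice d"
    and cell: "\<And>r. r < d \<Longrightarrow> lattice_cell p q n r = lattice_cell p q n' r"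
    and digits: "lattice_digits p d q n = lattice_digits p d q n'"
  shows "n = n'"
proof
  fix r
  show "n r = n' r"
  proof (cases "r < d")
    case True
    show ?thesis
    proof (rule int_eq_of_digits)
      show "n r div int p ^ q = n' r div int p ^ q" using cell[OF True] by (simp add: lattice_cell_def)
      fix i assume i: "i < q"
      have "r * q + i < Suc r * q" using i by simp
      also have "\<dots> \<le> d * q" using True by (intro mult_le_mono1) simp
      finally have s: "r * q + i < d * q" .
      have "(r * q + i) div q = r" "(r * q + i) mod q = i" using i by auto
      then have "nat (n r div int p ^ i mod int p) = nat (n' r div int p ^ i mod int p)"
        using fun_cong[OF digits, of "r * q + i"] s by (simp add: lattice_digits_def)
      moreover have "0 \<le> n r div int p ^ i mod int p" "0 \<le> n' r div int p ^ i mod int p"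
        using p by simp_all
      ultimately show "n r div int p ^ i mod int p = n' r div int p ^ i mod int p"
        by (simp only: eq_nat_nat_iff)
    qed
  next
    case False
    then show ?thesis using n by (simp add: int_lattice_def)
  qed
qed

lemma finite_nearby:
  assumes "0 < p"
  shows "finite (nearby p d q w)"
proof (rule card_lattice_box(1)[of _ d "\<lambda>r. {w r * int p ^ q..(w r + 2) * int p ^ q}"])
  fix m r assume m: "m \<in> nearby p d q w" "r < d"
  let ?L = "int p ^ q"
  have L: "0 < ?L" using assms by simp
  define v e where "v = m r div ?L" and "e = m r mod ?L"
  have "m r = v * ?L + e" unfolding v_def e_def by (rule div_mult_mod_eq[symmetric])
  moreover have "0 \<le> e" "e < ?L" using L by (auto simp: e_def)
  moreover have "v = w r \<or> v = w r + 1"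
    using m by (auto simp: nearby_def lattice_cell_def v_def)
  ultimately show "m r \<in> {w r * ?L..(w r + 2) * ?L}"
    using L by (auto simp: algebra_simps)
qed (auto simp: nearby_def)

text \<open>A point is determined by its digits and its cell, and there are only
  \<open>2 ^ d\<close> cells to choose from.\<close>

lemma card_nearby_digits_le:
  assumes "0 < p"
  shows "card {m. m \<in> nearby p d q w \<and> lattice_digits p d q m = y} \<le> 2 ^ d"
proof -
  let ?S = "{m. m \<in> nearby p d q w \<and> lattice_digits p d q m = y}"
  have inj: "inj_on (lattice_cell p q) ?S"
  proof (rule inj_onI)
    fix m m' assume mm: "m \<in> ?S" "m' \<in> ?S" and cell: "lattice_cell p q m = lattice_cell p q m'"
    show "m = m'"
    proof (rule lattice_eq_of_digits[OF assms])
      show "m \<in> int_lattice d" "m' \<in> int_lattice d" using mm by (simp_all add: nearby_def)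
      show "lattice_digits p d q m = lattice_digits p d q m'" using mm by simp
      show "lattice_cell p q m r = lattice_cell p q m' r" for r using cell by (rule fun_cong)
    qed
  qed
  have "card ?S = card (lattice_cell p q ` ?S)" using inj by (simp add: card_image)
  also have "\<dots> \<le> (\<Prod>r<d. card {w r, w r + 1})"
    by (rule card_lattice_box(2)) (auto simp: nearby_def int_lattice_def lattice_cell_def)
  finally show ?thesis by (simp add: numeral_2_eq_2)
qed

text \<open>In each coordinate the cell of \<open>m\<close> leaves two choices for
  \<open>w\<close>.\<close>

lemma card_cells_le:
  assumes "W \<subseteq> int_lattice d"
  shows "card {w \<in> W. m \<in> nearby p d q w} \<le> 2 ^ d"
proof -
  have "card {w \<in> W. m \<in> nearby p d q w} \<le> (\<Prod>r<d. card {lattice_cell p q m r, lattice_cell p q m r - 1})"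
    by (rule card_lattice_box(2)) (use assms in \<open>auto simp: nearby_def\<close>)
  then show ?thesis by (simp add: numeral_2_eq_2)
qed

lemma sum_digit_fun:
  assumes "0 < p"
  shows "(\<Sum>y\<in>residue_vecs p (d * q). digit_fun p d q f w y) = (\<Sum>m\<in>nearby p d q w. f m)"
  unfolding digit_fun_def
  by (rule sum.group) (use assms in \<open>auto simp: finite_nearby intro!: finite_PiE lattice_digits_in\<close>)

text \<open>Cauchy-Schwarz on each fibre of \<open>lattice_digits\<close>, which has at most
  \<open>2 ^ d\<close> points.\<close>

lemma sum_digit_fun_squares_le:
  assumes "0 < p"
  shows "(\<Sum>y\<in>residue_vecs p (d * q). (digit_fun p d q f w y)\<^sup>2) \<le> 2 ^ d * (\<Sum>m\<in>nearby p d q w. (f m)\<^sup>2)"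
proof -
  have "(digit_fun p d q f w y)\<^sup>2 \<le> 2 ^ d * digit_fun p d q (\<lambda>m. (f m)\<^sup>2) w y" for y
  proof -
    let ?S = "{m. m \<in> nearby p d q w \<and> lattice_digits p d q m = y}"
    have "(digit_fun p d q f w y)\<^sup>2 \<le> (\<Sum>m\<in>?S. (f m)\<^sup>2) * real (card ?S)"
      unfolding digit_fun_def by (rule sum_squared_le_sum_of_squares)
    also have "\<dots> \<le> (\<Sum>m\<in>?S. (f m)\<^sup>2) * 2 ^ d"
    proof (rule mult_left_mono)
      show "real (card ?S) \<le> 2 ^ d"
        using of_nat_mono[OF card_nearby_digits_le[OF assms, of d q w y], where ?'a = real] by simp
    qed (simp add: sum_nonneg)
    finally show ?thesis by (simp add: digit_fun_def mult.commute)
  qed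
  then have "(\<Sum>y\<in>residue_vecs p (d * q). (digit_fun p d q f w y)\<^sup>2) \<le>
      (\<Sum>y\<in>residue_vecs p (d * q). 2 ^ d * digit_fun p d q (\<lambda>m. (f m)\<^sup>2) w y)"
    by (intro sum_mono)
  then show ?thesis by (simp only: sum_distrib_left[symmetric] sum_digit_fun[OF assms])
qed

definition discrepancy_at :: "nat \<Rightarrow> nat \<Rightarrow> nat \<Rightarrow> ((nat \<Rightarrow> int) \<Rightarrow> real) \<Rightarrow> (nat \<Rightarrow> nat) \<Rightarrow> (nat \<Rightarrow> int) \<Rightarrow> real" where
  "discrepancy_at p d q f \<epsilon> n = curve_discrepancy p (d * q) (digit_fun p d q f (lattice_cell p q n))
     (residue_add p (d * q) (lattice_digits p d q n) \<epsilon>)"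

lemma residue_point_digits:
  "residue_point d q p j r = (if r < d then int (\<Sum>i<q. p ^ i * (j ^ (r * q + i + 1) mod p)) else 0)"
proof -
  have "(\<Sum>i=1..q. p ^ (i - 1) * (j ^ (r * q + i) mod p)) = (\<Sum>i<q. p ^ i * (j ^ (r * q + i + 1) mod p))"
    by (rule sum.reindex_bij_witness[of _ Suc "\<lambda>i. i - 1"]) auto
  then show ?thesis by (simp add: residue_point_def)
qed

text \<open>Adding a point of the curve moves a lattice point by at most one cell and changes its digits by
  the digits of the curve point up to carries; the sum over all carry patterns \<open>\<epsilon>\<close> dominates.\<close>

lemma curve_sum_le:
  fixes f :: "(nat \<Rightarrow> int) \<Rightarrow> real"
  assumes p: "0 < p" and q: "0 < q" and f: "\<And>m. 0 \<le> f m" and n: "n \<in> int_lattice d"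
  shows "(\<Sum>j<p. f (vec_add n (residue_point d q p j))) / real p \<le>
    2 ^ (d * q) * ((\<Sum>m\<in>nearby p d q (lattice_cell p q n). f m) / real (p ^ (d * q))) +
    (\<Sum>\<epsilon>\<in>residue_vecs 2 (d * q). discrepancy_at p d q f \<epsilon> n)"
proof -
  let ?D = "d * q" and ?w = "lattice_cell p q n"
  let ?F = "digit_fun p d q f ?w" and ?E = "residue_vecs 2 (d * q)"
  have F0: "0 \<le> ?F y" for y unfolding digit_fun_def by (intro sum_nonneg f)
  have finE: "finite ?E" by (rule finite_PiE) auto
  have "f (vec_add n (residue_point d q p j)) \<le>
      (\<Sum>\<epsilon>\<in>?E. ?F (residue_add p ?D (residue_add p ?D (lattice_digits p d q n) \<epsilon>) (moment_curve p ?D j)))" for j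
  proof -
    let ?m = "vec_add n (residue_point d q p j)"
    let ?c = "\<lambda>r i. j ^ (r * q + i + 1) mod p"
    have c: "?c r i < p" for r i using p by simp
    have mr: "?m r = n r + int (\<Sum>i<q. p ^ i * ?c r i)" if "r < d" for r
      using that by (simp add: vec_add_def residue_point_digits)
    have near: "?m \<in> nearby p d q ?w"
      unfolding nearby_def
    proof (intro CollectI conjI allI impI)
      show "?m \<in> int_lattice d" using n by (simp add: int_lattice_def vec_add_def residue_point_def)
      fix r assume r: "r < d"
      have "(\<Sum>i<q. p ^ i * ?c r i) < p ^ q" by (rule digit_sum_less) (rule c)
      then have lt: "int (\<Sum>i<q. p ^ i * ?c r i) < int p ^ q" by (metis of_nat_less_iff of_nat_power)
      obtain e :: nat where "e < 2" "(n r + int (\<Sum>i<q. p ^ i * ?c r i)) div int p ^ q = n r div int p ^ q + int e"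
        by (rule div_add_carry[OF of_nat_0_le_iff lt])
      then show "lattice_cell p q ?m r \<in> {?w r, ?w r + 1}"
        unfolding lattice_cell_def mr[OF r] by (auto simp: less_2_cases_iff)
    qed
    \<comment> \<open>Each digit receives its own carry, which depends on \<open>j\<close> and
      \<open>n\<close>; over all \<open>s\<close> the carries form a pattern.\<close>
    have "\<exists>e. \<forall>s<?D. e s < 2 \<and> lattice_digits p d q ?m s = (lattice_digits p d q n s + e s + moment_curve p ?D j s) mod p"
    proof (intro choice allI)
      fix s
      show "\<exists>e. s < ?D \<longrightarrow> e < 2 \<and> lattice_digits p d q ?m s = (lattice_digits p d q n s + e + moment_curve p ?D j s) mod p"
      proof (cases "s < ?D")
        case True
        define r i where "r = s div q" and "i = s mod q"
        have i: "i < q" using q by (simp add: i_def)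
        have r: "r < d" using True by (simp add: r_def less_mult_imp_div_less)
        have s: "r * q + i + 1 = s + 1" by (simp add: r_def i_def)
        obtain e :: nat where e: "e < 2"
          "nat ((n r + int (\<Sum>i<q. p ^ i * ?c r i)) div int p ^ i mod int p) = (nat (n r div int p ^ i mod int p) + e + ?c r i) mod p"
          by (rule digit_add_carry[of q "?c r" p i "n r", OF c i])
        have "lattice_digits p d q ?m s = (lattice_digits p d q n s + e + moment_curve p ?D j s) mod p"
          using e(2) True unfolding mr[OF r, symmetric] s
          by (simp add: lattice_digits_def moment_curve_def r_def[symmetric] i_def[symmetric])
        then show ?thesis using e(1) by blast
      qed simp
    qed
    then obtain e where e: "\<And>s. s < ?D \<Longrightarrow> e s < 2 \<and>
        lattice_digits p d q ?m s = (lattice_digits p d q n s + e s + moment_curve p ?D j s) mod p"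
      by blast
    let ?\<epsilon> = "restrict e {..<?D}"
    have \<epsilon>: "?\<epsilon> \<in> ?E" using e by auto
    have dig: "residue_add p ?D (residue_add p ?D (lattice_digits p d q n) ?\<epsilon>) (moment_curve p ?D j) = lattice_digits p d q ?m"
    proof
      fix s
      show "residue_add p ?D (residue_add p ?D (lattice_digits p d q n) ?\<epsilon>) (moment_curve p ?D j) s = lattice_digits p d q ?m s"
      proof (cases "s < ?D")
        case True
        then show ?thesis using e[OF True] by (simp add: residue_add_def mod_add_left_eq)
      qed (simp add: residue_add_def lattice_digits_def)
    qed
    have "f ?m \<le> ?F (lattice_digits p d q ?m)"
      unfolding digit_fun_def using near f
      by (intro member_le_sum) (auto intro: finite_subset[OF _ finite_nearby[OF p, of d q ?w]])
    also have "\<dots> = ?F (residue_add p ?D (residue_add p ?D (lattice_digits p d q n) ?\<epsilon>) (moment_curve p ?D j))"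
      by (simp only: dig)
    also have "\<dots> \<le> (\<Sum>\<epsilon>\<in>?E. ?F (residue_add p ?D (residue_add p ?D (lattice_digits p d q n) \<epsilon>) (moment_curve p ?D j)))"
      by (rule member_le_sum[OF \<epsilon> F0 finE])
    finally show ?thesis .
  qed
  then have "(\<Sum>j<p. f (vec_add n (residue_point d q p j))) \<le>
      (\<Sum>j<p. \<Sum>\<epsilon>\<in>?E. ?F (residue_add p ?D (residue_add p ?D (lattice_digits p d q n) \<epsilon>) (moment_curve p ?D j)))"
    by (intro sum_mono)
  also have "\<dots> = (\<Sum>\<epsilon>\<in>?E. \<Sum>j<p. ?F (residue_add p ?D (residue_add p ?D (lattice_digits p d q n) \<epsilon>) (moment_curve p ?D j)))"
    by (rule sum.swap)
  finally have "(\<Sum>j<p. f (vec_add n (residue_point d q p j))) / real p \<le>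
      (\<Sum>\<epsilon>\<in>?E. curve_average p ?D ?F (residue_add p ?D (lattice_digits p d q n) \<epsilon>))"
    by (simp add: curve_average_def divide_right_mono flip: sum_divide_distrib)
  \<comment> \<open>The mean of \<open>?F\<close> is the same for every carry pattern, so it will be
    counted \<open>2 ^ (d * q)\<close> times.\<close>
  also have "\<dots> = (\<Sum>\<epsilon>\<in>?E. (\<Sum>m\<in>nearby p d q ?w. f m) / real (p ^ ?D) + discrepancy_at p d q f \<epsilon> n)"
    by (intro sum.cong refl) (simp add: discrepancy_at_def curve_discrepancy_def sum_digit_fun[OF p])
  also have "\<dots> = 2 ^ ?D * ((\<Sum>m\<in>nearby p d q ?w. f m) / real (p ^ ?D)) + (\<Sum>\<epsilon>\<in>?E. discrepancy_at p d q f \<epsilon> n)"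
    by (simp add: sum.distrib card_PiE)
  finally show ?thesis .
qed

text \<open>Within one cell distinct points have distinct shifted digits, so the l^2 bound on
  residue vectors applies cell by cell. One factor \<open>2 ^ d\<close> comes from the fibres of the
  digit map, another from the overlap of the sets \<open>nearby\<close>.\<close>

lemma sum_discrepancy_squares_le:
  fixes f :: "(nat \<Rightarrow> int) \<Rightarrow> real"
  assumes p: "prime p" and B: "finite B" "\<And>m. m \<notin> B \<Longrightarrow> f m = 0" and X: "finite X" "X \<subseteq> int_lattice d"
  shows "(\<Sum>n\<in>X. (discrepancy_at p d q f \<epsilon> n)\<^sup>2) \<le> (real (d * q))\<^sup>2 * 4 ^ d / real p * (\<Sum>m\<in>B. (f m)\<^sup>2)"
proof -
  let ?D = "d * q" and ?G = "residue_vecs p (d * q)" and ?W = "lattice_cell p q ` X"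
  have p0: "0 < p" using p by (simp add: prime_gt_0_nat)
  have finW: "finite ?W" using X by simp
  have W: "?W \<subseteq> int_lattice d" using X(2) by (auto simp: int_lattice_def lattice_cell_def)
  have finG: "finite ?G" by (rule finite_PiE) auto
  have cell: "(\<Sum>n | n \<in> X \<and> lattice_cell p q n = w. (discrepancy_at p d q f \<epsilon> n)\<^sup>2) \<le>
      (real ?D)\<^sup>2 / real p * (2 ^ d * (\<Sum>m\<in>nearby p d q w. (f m)\<^sup>2))" for w
  proof -
    let ?S = "{n. n \<in> X \<and> lattice_cell p q n = w}"
    let ?g = "\<lambda>n. residue_add p ?D (lattice_digits p d q n) \<epsilon>"
    let ?h = "\<lambda>y. (curve_discrepancy p ?D (digit_fun p d q f w) y)\<^sup>2"
    have inj: "inj_on ?g ?S"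
    proof (rule inj_onI)
      fix n n' assume nn: "n \<in> ?S" "n' \<in> ?S" "?g n = ?g n'"
      have "inj_on (\<lambda>y. residue_add p ?D y \<epsilon>) ?G"
        using bij_betw_residue_add[OF p0] by (rule bij_betw_imp_inj_on)
      then have "lattice_digits p d q n = lattice_digits p d q n'"
        by (rule inj_onD[OF _ nn(3) lattice_digits_in[OF p0] lattice_digits_in[OF p0]])
      then show "n = n'"
        using nn X by (intro lattice_eq_of_digits[OF p0, of n d n' q]) auto
    qed
    have "(\<Sum>n\<in>?S. (discrepancy_at p d q f \<epsilon> n)\<^sup>2) = (\<Sum>n\<in>?S. ?h (?g n))"
      by (intro sum.cong) (auto simp: discrepancy_at_def)
    also have "\<dots> = sum ?h (?g ` ?S)" by (simp only: sum.reindex[OF inj] o_def)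
    also have "\<dots> \<le> sum ?h ?G"
    proof (rule sum_mono2[OF finG])
      show "?g ` ?S \<subseteq> ?G" by (intro image_subsetI residue_add_in[OF p0])
    qed simp
    also have "\<dots> \<le> (real ?D)\<^sup>2 / real p * (\<Sum>y\<in>?G. (digit_fun p d q f w y)\<^sup>2)"
      by (rule sum_curve_discrepancy_le[OF p])
    also have "\<dots> \<le> (real ?D)\<^sup>2 / real p * (2 ^ d * (\<Sum>m\<in>nearby p d q w. (f m)\<^sup>2))"
      by (intro mult_left_mono sum_digit_fun_squares_le[OF p0]) simp
    finally show ?thesis .
  qed
  have near: "(\<Sum>w\<in>?W. \<Sum>m\<in>nearby p d q w. (f m)\<^sup>2) \<le> 2 ^ d * (\<Sum>m\<in>B. (f m)\<^sup>2)"
  proof -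
    have "(\<Sum>m\<in>nearby p d q w. (f m)\<^sup>2) = (\<Sum>m\<in>B. if m \<in> nearby p d q w then (f m)\<^sup>2 else 0)" for w
    proof -
      have "(\<Sum>m\<in>nearby p d q w. (f m)\<^sup>2) = (\<Sum>m\<in>nearby p d q w \<inter> B. (f m)\<^sup>2)"
        using B finite_nearby[OF p0] by (intro sum.mono_neutral_right) auto
      also have "\<dots> = (\<Sum>m\<in>B. if m \<in> nearby p d q w then (f m)\<^sup>2 else 0)"
        using B(1) by (simp add: sum.inter_restrict Int_commute)
      finally show ?thesis .
    qed
    then have "(\<Sum>w\<in>?W. \<Sum>m\<in>nearby p d q w. (f m)\<^sup>2) = (\<Sum>w\<in>?W. \<Sum>m\<in>B. if m \<in> nearby p d q w then (f m)\<^sup>2 else 0)"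
      by simp
    also have "\<dots> = (\<Sum>m\<in>B. \<Sum>w\<in>?W. if m \<in> nearby p d q w then (f m)\<^sup>2 else 0)"
      by (rule sum.swap)
    also have "\<dots> = (\<Sum>m\<in>B. real (card {w \<in> ?W. m \<in> nearby p d q w}) * (f m)\<^sup>2)"
      using finW by (simp add: sum.inter_filter[symmetric])
    also have "\<dots> \<le> (\<Sum>m\<in>B. 2 ^ d * (f m)\<^sup>2)"
    proof (intro sum_mono mult_right_mono)
      fix m
      show "real (card {w \<in> ?W. m \<in> nearby p d q w}) \<le> 2 ^ d"
        using of_nat_mono[OF card_cells_le[OF W, of m p q], where ?'a = real] by simp
    qed simp
    finally show ?thesis by (simp add: sum_distrib_left)
  qed
  have "(\<Sum>n\<in>X. (discrepancy_at p d q f \<epsilon> n)\<^sup>2) = (\<Sum>w\<in>?W. \<Sum>n | n \<in> X \<and> lattice_cell p q n = w. (discrepancy_at p d q f \<epsilon> n)\<^sup>2)"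
    by (rule sum.group[symmetric]) (use X in auto)
  also have "\<dots> \<le> (\<Sum>w\<in>?W. (real ?D)\<^sup>2 / real p * (2 ^ d * (\<Sum>m\<in>nearby p d q w. (f m)\<^sup>2)))"
    by (rule sum_mono[OF cell])
  also have "\<dots> = (real ?D)\<^sup>2 / real p * (2 ^ d * (\<Sum>w\<in>?W. \<Sum>m\<in>nearby p d q w. (f m)\<^sup>2))"
    by (simp only: sum_distrib_left)
  also have "\<dots> \<le> (real ?D)\<^sup>2 / real p * (2 ^ d * (2 ^ d * (\<Sum>m\<in>B. (f m)\<^sup>2)))"
    by (intro mult_left_mono near) auto
  also have "\<dots> = (real ?D)\<^sup>2 * 4 ^ d / real p * (\<Sum>m\<in>B. (f m)\<^sup>2)"
    by (simp add: power_mult_distrib[symmetric] flip: mult.assoc)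
  finally show ?thesis .
qed

section \<open>The weak-type inequality\<close>

definition curve_mean ::
  "nat \<Rightarrow> nat \<Rightarrow> nat \<Rightarrow> (nat \<Rightarrow> int) \<Rightarrow> ((nat \<Rightarrow> int) \<Rightarrow> real) \<Rightarrow> (nat \<Rightarrow> int) \<Rightarrow> real" where
  "curve_mean d q p b f n = (\<Sum>j<p. f (vec_add n (vec_add b (residue_point d q p j)))) / real p"

lemma vec_add_assoc: "vec_add (vec_add u v) w = vec_add u (vec_add v w)"
  by (simp add: vec_add_def add.assoc)

lemma vec_add_in_lattice: "u \<in> int_lattice d \<Longrightarrow> v \<in> int_lattice d \<Longrightarrow> vec_add u v \<in> int_lattice d"
  by (simp add: int_lattice_def vec_add_def)

lemma residue_point_in_lattice: "residue_point d q p j \<in> int_lattice d"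
  by (simp add: int_lattice_def residue_point_def)

lemma inj_vec_add_right: "inj (\<lambda>n. vec_add n b)"
  by (rule injI) (auto simp: vec_add_def fun_eq_iff)

lemma abs_le_euclid_norm: "r < d \<Longrightarrow> \<bar>real_of_int (v r)\<bar> \<le> euclid_norm d v"
proof -
  assume r: "r < d"
  have "\<bar>real_of_int (v r)\<bar> = sqrt ((real_of_int (v r))\<^sup>2)" by simp
  also have "\<dots> \<le> sqrt (\<Sum>r<d. (real_of_int (v r))\<^sup>2)"
    using r by (intro real_sqrt_le_mono member_le_sum) auto
  finally show ?thesis by (simp add: euclid_norm_def L2_set_def)
qed

text \<open>Points in equal or adjacent cells differ by less than 2 sides in each coordinate, and
  \<open>b\<close> adds at most \<open>K\<close> sides.\<close>

lemma nearby_subset_cube: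
  assumes p: "0 < p" and b: "\<And>r. r < d \<Longrightarrow> \<bar>b r\<bar> \<le> int K * int p ^ q"
  shows "nearby p d q (lattice_cell p q (vec_add n b)) \<subseteq> lattice_cube d n ((K + 2) * p ^ q)"
proof
  fix m assume m: "m \<in> nearby p d q (lattice_cell p q (vec_add n b))"
  have "\<bar>m r - n r\<bar> \<le> int ((K + 2) * p ^ q)" if r: "r < d" for r
  proof -
    let ?L = "int p ^ q"
    have L: "0 < ?L" using p by simp
    define v e v' e' where "v = m r div ?L" and "e = m r mod ?L"
      and "v' = (n r + b r) div ?L" and "e' = (n r + b r) mod ?L"
    have "v = v' \<or> v = v' + 1"
      using m r by (auto simp: nearby_def lattice_cell_def vec_add_def v_def v'_def)
    moreover have "m r = v * ?L + e" unfolding v_def e_def by (rule div_mult_mod_eq[symmetric])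
    moreover have "n r + b r = v' * ?L + e'" unfolding v'_def e'_def by (rule div_mult_mod_eq[symmetric])
    moreover have "0 \<le> e" "e < ?L" "0 \<le> e'" "e' < ?L"
      using L by (auto simp: e_def e'_def)
    ultimately have "\<bar>m r - (n r + b r)\<bar> \<le> 2 * ?L"
      by (elim disjE) (simp_all add: algebra_simps abs_le_iff)
    then show ?thesis using b[OF r] by (simp add: algebra_simps)
  qed
  then show "m \<in> lattice_cube d n ((K + 2) * p ^ q)"
    using m by (simp add: lattice_cube_def nearby_def)
qed

text \<open>The height \<open>t / 2\<close> gives the factor 4. Cauchy-Schwarz over the
  \<open>2 ^ (d * q)\<close> carry patterns and the sum over them together give
  \<open>4 ^ (d * q)\<close>; the rest comes from \<open>sum_discrepancy_squares_le\<close>.\<close>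

lemma markov_discrepancy:
  fixes f :: "(nat \<Rightarrow> int) \<Rightarrow> real"
  assumes p: "prime p" and B: "finite B" "\<And>m. m \<notin> B \<Longrightarrow> f m = 0" and X: "finite X" "X \<subseteq> int_lattice d"
    and b: "b \<in> int_lattice d" and t: "0 < t"
    and big: "\<And>n. n \<in> X \<Longrightarrow> t / 2 < (\<Sum>\<epsilon>\<in>residue_vecs 2 (d * q). discrepancy_at p d q f \<epsilon> (vec_add n b))"
  shows "real (card X) \<le> 4 * 4 ^ (d * q) * (real (d * q))\<^sup>2 * 4 ^ d / t\<^sup>2 * ((\<Sum>m\<in>B. (f m)\<^sup>2) / real p)"
proof -
  let ?E = "residue_vecs 2 (d * q)" and ?R = "\<lambda>\<epsilon> n. discrepancy_at p d q f \<epsilon> (vec_add n b)"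
  let ?M = "(real (d * q))\<^sup>2 * 4 ^ d / real p * (\<Sum>m\<in>B. (f m)\<^sup>2)"
  have cardE: "card ?E = 2 ^ (d * q)" by (simp add: card_PiE)
  have "real (card X) * (t / 2)\<^sup>2 = (\<Sum>n\<in>X. (t / 2)\<^sup>2)" by simp
  also have "\<dots> \<le> (\<Sum>n\<in>X. (\<Sum>\<epsilon>\<in>?E. ?R \<epsilon> n)\<^sup>2)"
    using big t by (intro sum_mono power_mono) (auto intro: less_imp_le)
  also have "\<dots> \<le> (\<Sum>n\<in>X. (\<Sum>\<epsilon>\<in>?E. (?R \<epsilon> n)\<^sup>2) * real (card ?E))"
    by (intro sum_mono sum_squared_le_sum_of_squares)
  also have "\<dots> = 2 ^ (d * q) * (\<Sum>\<epsilon>\<in>?E. \<Sum>n\<in>X. (?R \<epsilon> n)\<^sup>2)"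
    unfolding cardE sum_distrib_right[symmetric] by (subst sum.swap) (simp only: of_nat_power of_nat_numeral mult.commute)
  also have "\<dots> \<le> 2 ^ (d * q) * (\<Sum>\<epsilon>\<in>?E. ?M)"
  proof (intro mult_left_mono sum_mono)
    fix \<epsilon>
    have "(\<Sum>n\<in>X. (?R \<epsilon> n)\<^sup>2) = (\<Sum>n\<in>(\<lambda>n. vec_add n b) ` X. (discrepancy_at p d q f \<epsilon> n)\<^sup>2)"
      by (subst sum.reindex) (auto intro: inj_on_subset[OF inj_vec_add_right])
    also have "\<dots> \<le> ?M"
      by (rule sum_discrepancy_squares_le[OF p B]) (use X b vec_add_in_lattice in auto)
    finally show "(\<Sum>n\<in>X. (?R \<epsilon> n)\<^sup>2) \<le> ?M" .
  qed simp
  also have "\<dots> = 4 ^ (d * q) * ?M"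
    by (simp add: cardE power_mult_distrib[symmetric] flip: mult.assoc)
  finally have le: "real (card X) * (t / 2)\<^sup>2 \<le> 4 ^ (d * q) * ?M" .
  have "0 < (t / 2)\<^sup>2" using t by simp
  then have "real (card X) \<le> 4 ^ (d * q) * ?M / (t / 2)\<^sup>2"
    using le by (rule pos_le_divide_eq[THEN iffD2])
  also have "\<dots> = 4 * 4 ^ (d * q) * (real (d * q))\<^sup>2 * 4 ^ d / t\<^sup>2 * ((\<Sum>m\<in>B. (f m)\<^sup>2) / real p)"
    by (simp add: power_divide mult_ac)
  finally show ?thesis .
qed

text \<open>The three terms of the constant belong to the high values, the box means and the
  discrepancies. Finite \<open>X\<close> and finite support keep every sum finite; the passage to
  l^1 is left to the final theorem.\<close>

lemma weak_type_curve_means: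
  fixes f :: "(nat \<Rightarrow> int) \<Rightarrow> real" and p :: "nat \<Rightarrow> nat" and a :: "nat \<Rightarrow> nat \<Rightarrow> int"
  assumes q: "0 < q" and c: "1 < c"
    and prime: "\<And>k. 1 \<le> k \<Longrightarrow> prime (p k)"
    and growth: "\<And>k. 1 \<le> k \<Longrightarrow> c * real (p k) \<le> real (p (k + 1))"
    and a: "\<And>k. 1 \<le> k \<Longrightarrow> a k \<in> int_lattice d"
    and a_le: "\<And>k r. 1 \<le> k \<Longrightarrow> r < d \<Longrightarrow> \<bar>a k r\<bar> \<le> int K * int (p k) ^ q"
    and f: "\<And>m. 0 \<le> f m" and B: "finite B" "\<And>m. m \<notin> B \<Longrightarrow> f m = 0"
    and t: "0 < t" and X: "finite X" "X \<subseteq> int_lattice d"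
    and big: "\<And>n. n \<in> X \<Longrightarrow> \<exists>k\<ge>1. t < curve_mean d q (p k) (a k) f n"
  shows "real (card X) \<le> (c / (c - 1) + 7 ^ d * (2 * 2 ^ (d * q) * real (K + 2) ^ d) +
      4 * 4 ^ (d * q) * (real (d * q))\<^sup>2 * 4 ^ d * (c / (c - 1))) / t * sum f B"
proof -
  let ?G = "c / (c - 1)" and ?D = "d * q"
  have p0: "0 < p k" if "1 \<le> k" for k using prime[OF that] by (simp add: prime_gt_0_nat)
  have P0: "0 < real (p k)" if "1 \<le> k" for k using p0[OF that] by simp
  define near where "near k n = nearby (p k) d q (lattice_cell (p k) q (vec_add n (a k)))" for k n
  define g where "g k m = (if f m \<le> t * real (p k) then f m else 0)" for k m
  obtain \<kappa> where \<kappa>: "\<And>n. n \<in> X \<Longrightarrow> 1 \<le> \<kappa> n" "\<And>n. n \<in> X \<Longrightarrow> t < curve_mean d q (p (\<kappa> n)) (a (\<kappa> n)) f n"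
    using big by metis
  \<comment> \<open>As \<open>X\<close> is finite, only finitely many of the chosen scales
    occur.\<close>
  obtain N where N: "\<And>n. n \<in> X \<Longrightarrow> \<kappa> n \<le> N"
  proof
    show "\<kappa> n \<le> Max (\<kappa> ` X)" if "n \<in> X" for n using that X(1) by simp
  qed
  let ?pt = "\<lambda>k j n. vec_add n (vec_add (a k) (residue_point d q (p k) j))"
  \<comment> \<open>Outside \<open>X1 k\<close> the truncation \<open>g k\<close> may replace
    \<open>f\<close> in the average at scale \<open>k\<close>, and then \<open>t / 2\<close> must
    come from the box mean (\<open>X2\<close>) or from the discrepancies (\<open>X3 k\<close>).
    \<open>X2\<close> is one set for all scales, because the maximal inequality handles them
    together.\<close>
  define X1 where "X1 k = (\<Union>j<p k. {n \<in> X. t * real (p k) < f (?pt k j n)})" for k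
  define X2 where "X2 = {n \<in> X. \<exists>k\<ge>1. t / 2 < 2 ^ ?D * (sum f (near k n) / real (p k ^ ?D))}"
  define X3 where "X3 k = {n \<in> X. t / 2 < (\<Sum>\<epsilon>\<in>residue_vecs 2 ?D. discrepancy_at (p k) d q (g k) \<epsilon> (vec_add n (a k)))}" for k
  have cover: "X \<subseteq> (\<Union>k\<in>{1..N}. X1 k) \<union> X2 \<union> (\<Union>k\<in>{1..N}. X3 k)"
  proof
    fix n assume n: "n \<in> X"
    let ?k = "\<kappa> n"
    have k: "1 \<le> ?k" "?k \<in> {1..N}" using \<kappa>(1)[OF n] N[OF n] by auto
    show "n \<in> (\<Union>k\<in>{1..N}. X1 k) \<union> X2 \<union> (\<Union>k\<in>{1..N}. X3 k)"
    proof (cases "n \<in> X1 ?k")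
      case False
      have n': "vec_add n (a ?k) \<in> int_lattice d" using n X a[OF k(1)] by (auto intro: vec_add_in_lattice)
      have "g ?k (?pt ?k j n) = f (?pt ?k j n)" if "j < p ?k" for j
      proof -
        have "\<not> t * real (p ?k) < f (?pt ?k j n)" using False that n unfolding X1_def by blast
        then show ?thesis by (simp add: g_def)
      qed
      then have "t < curve_mean d q (p ?k) (a ?k) (g ?k) n"
        using \<kappa>(2)[OF n] by (simp add: curve_mean_def)
      also have "\<dots> = (\<Sum>j<p ?k. g ?k (vec_add (vec_add n (a ?k)) (residue_point d q (p ?k) j))) / real (p ?k)"
        by (simp add: curve_mean_def vec_add_assoc)
      also have "\<dots> \<le> 2 ^ ?D * (sum (g ?k) (near ?k n) / real (p ?k ^ ?D)) +
          (\<Sum>\<epsilon>\<in>residue_vecs 2 ?D. discrepancy_at (p ?k) d q (g ?k) \<epsilon> (vec_add n (a ?k)))"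
        unfolding near_def by (rule curve_sum_le[OF p0[OF k(1)] q _ n']) (use f in \<open>simp add: g_def\<close>)
      also have "2 ^ ?D * (sum (g ?k) (near ?k n) / real (p ?k ^ ?D)) \<le> 2 ^ ?D * (sum f (near ?k n) / real (p ?k ^ ?D))"
        using f by (intro mult_left_mono divide_right_mono sum_mono) (auto simp: g_def)
      finally have "t / 2 < 2 ^ ?D * (sum f (near ?k n) / real (p ?k ^ ?D)) \<or>
          t / 2 < (\<Sum>\<epsilon>\<in>residue_vecs 2 ?D. discrepancy_at (p ?k) d q (g ?k) \<epsilon> (vec_add n (a ?k)))"
        by linarith
      then have "n \<in> X2 \<or> n \<in> X3 ?k" using n k(1) unfolding X2_def X3_def by blast
      then show ?thesis using k(2) by blast
    qed (use k in blast)
  qed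
  have fin: "finite (X1 k)" "finite X2" "finite (X3 k)" for k
    using X(1) by (auto simp: X1_def X2_def X3_def)
  have c1: "real (card (X1 k)) \<le> real (p k) * real (card {m \<in> B. t * real (p k) < f m})" for k
  proof -
    \<comment> \<open>For fixed \<open>j\<close> the sampled point determines \<open>n\<close>, so
      each of the \<open>p k\<close> sets is at most as large as the superlevel set.\<close>
    have "card (X1 k) \<le> (\<Sum>j<p k. card {n \<in> X. t * real (p k) < f (?pt k j n)})"
      unfolding X1_def by (rule card_UN_le) simp
    also have "\<dots> \<le> (\<Sum>j<p k. card {m \<in> B. t * real (p k) < f m})"
    proof (rule sum_mono)
      fix j
      have "?pt k j ` {n \<in> X. t * real (p k) < f (?pt k j n)} \<subseteq> {m \<in> B. t * real (p k) < f m}"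
      proof clarify
        fix n assume "t * real (p k) < f (?pt k j n)"
        moreover have "0 \<le> t * real (p k)" using t by simp
        ultimately have "f (?pt k j n) \<noteq> 0" by linarith
        then show "?pt k j n \<in> B" using B(2) by blast
      qed
      then show "card {n \<in> X. t * real (p k) < f (?pt k j n)} \<le> card {m \<in> B. t * real (p k) < f m}"
        using B(1) by (intro card_inj_on_le[OF inj_on_subset[OF inj_vec_add_right]]) auto
    qed
    also have "\<dots> = p k * card {m \<in> B. t * real (p k) < f m}" by simp
    finally show ?thesis by (metis of_nat_le_iff of_nat_mult)
  qed
  have "(\<Sum>k=1..N. real (card (X1 k))) \<le> (\<Sum>k=1..N. real (p k) * real (card {m \<in> B. t * real (p k) < f m}))"
    by (intro sum_mono c1)
  also have "\<dots> = (\<Sum>k=1..N. \<Sum>m\<in>B. if real (p k) < f m / t then real (p k) else 0)"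
    using B(1) t by (intro sum.cong refl) (simp add: sum.inter_filter[symmetric] pos_less_divide_eq mult.commute)
  also have "\<dots> = (\<Sum>m\<in>B. \<Sum>k=1..N. if real (p k) < f m / t then real (p k) else 0)"
    by (rule sum.swap)
  also have "\<dots> \<le> (\<Sum>m\<in>B. ?G * (f m / t))"
    using f t by (intro sum_mono sum_below_geometric[where P = "\<lambda>k. real (p k)", OF c P0 growth]) auto
  also have "\<dots> = ?G / t * sum f B"
    by (simp add: sum_distrib_left)
  finally have b1: "(\<Sum>k=1..N. real (card (X1 k))) \<le> ?G / t * sum f B" .
  have b2: "real (card X2) \<le> 7 ^ d * (2 * 2 ^ ?D * real (K + 2) ^ d) / t * sum f B"
  proof -
    \<comment> \<open>This \<open>s\<close> turns the condition in \<open>X2\<close> into a lower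
      bound \<open>s * \<rho> ^ d\<close> for the sum over the cube of radius
      \<open>\<rho> = (K + 2) * p ^ q\<close> that contains the box.\<close>
    define s where "s = t / (2 * 2 ^ ?D * real (K + 2) ^ d)"
    obtain \<nu> where \<nu>: "\<And>n. n \<in> X2 \<Longrightarrow> 1 \<le> \<nu> n"
        "\<And>n. n \<in> X2 \<Longrightarrow> t / 2 < 2 ^ ?D * (sum f (near (\<nu> n) n) / real (p (\<nu> n) ^ ?D))"
    proof -
      have "\<forall>n\<in>X2. \<exists>k. 1 \<le> k \<and> t / 2 < 2 ^ ?D * (sum f (near k n) / real (p k ^ ?D))"
        by (auto simp: X2_def)
      then show ?thesis using that by metis
    qed
    have "real (card X2) \<le> 7 ^ d / s * sum f B"
    proof (rule hardy_littlewood_lattice[where \<rho> = "\<lambda>n. (K + 2) * p (\<nu> n) ^ q" and f = f])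
      show "finite X2" "X2 \<subseteq> int_lattice d" using X by (auto simp: X2_def)
      show "0 < s" using t by (simp add: s_def)
      show "0 \<le> f m" for m by (rule f)
      show "sum f W \<le> sum f B" if "finite W" for W
      proof -
        have "sum f W = sum f (W \<inter> B)" using that B by (intro sum.mono_neutral_right) auto
        also have "\<dots> \<le> sum f B" using B f by (intro sum_mono2) auto
        finally show ?thesis .
      qed
      fix n assume n: "n \<in> X2"
      have k: "1 \<le> \<nu> n" by (rule \<nu>(1)[OF n])
      let ?L = "p (\<nu> n) ^ q"
      have L: "0 < ?L" using p0[OF k] by simp
      then have "0 < (K + 2) * ?L" by (intro mult_pos_pos) auto
      then show "1 \<le> (K + 2) * ?L" by (simp only: One_nat_def Suc_le_eq)
      have pw: "real (p (\<nu> n) ^ ?D) = real ?L ^ d" by (simp add: power_mult[symmetric] mult.commute)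
      have "t / 2 < 2 ^ ?D * (sum f (near (\<nu> n) n) / real ?L ^ d)"
        using \<nu>(2)[OF n] unfolding pw .
      then have "t / (2 * 2 ^ ?D) * real ?L ^ d < sum f (near (\<nu> n) n)"
        using L by (simp add: field_simps)
      also have "\<dots> \<le> sum f (lattice_cube d n ((K + 2) * ?L))"
        unfolding near_def using f a_le[OF k]
        by (intro sum_mono2 finite_lattice_cube nearby_subset_cube[OF p0[OF k]]) auto
      also have "t / (2 * 2 ^ ?D) * real ?L ^ d = s * real ((K + 2) * ?L) ^ d"
        unfolding s_def of_nat_mult power_mult_distrib by simp
      finally show "s * real ((K + 2) * ?L) ^ d \<le> sum f (lattice_cube d n ((K + 2) * ?L))" by simp
    qed
    then show ?thesis by (simp add: s_def)
  qed
  let ?c3 = "4 * 4 ^ ?D * (real ?D)\<^sup>2 * 4 ^ d"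
  have c3: "real (card (X3 k)) \<le> ?c3 / t\<^sup>2 * ((\<Sum>m\<in>B. (g k m)\<^sup>2) / real (p k))" if k: "1 \<le> k" for k
  proof (rule markov_discrepancy[OF prime[OF k] B(1) _ fin(3) _ a[OF k] t])
    show "g k m = 0" if "m \<notin> B" for m using B(2)[OF that] by (simp add: g_def)
    show "X3 k \<subseteq> int_lattice d" using X(2) by (auto simp: X3_def)
    show "t / 2 < (\<Sum>\<epsilon>\<in>residue_vecs 2 ?D. discrepancy_at (p k) d q (g k) \<epsilon> (vec_add n (a k)))"
      if "n \<in> X3 k" for n
      using that unfolding X3_def by blast
  qed
  have "(\<Sum>k=1..N. real (card (X3 k))) \<le> (\<Sum>k=1..N. ?c3 / t\<^sup>2 * ((\<Sum>m\<in>B. (g k m)\<^sup>2) / real (p k)))"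
    by (intro sum_mono c3) simp
  also have "\<dots> = ?c3 / t\<^sup>2 * (\<Sum>k=1..N. \<Sum>m\<in>B. (f m)\<^sup>2 * (if f m / t \<le> real (p k) then 1 / real (p k) else 0))"
    unfolding sum_distrib_left[symmetric] sum_divide_distrib using t
    by (intro arg_cong2[of _ _ _ _ "(*)"] sum.cong refl) (auto simp: g_def pos_divide_le_eq mult.commute)
  also have "(\<Sum>k=1..N. \<Sum>m\<in>B. (f m)\<^sup>2 * (if f m / t \<le> real (p k) then 1 / real (p k) else 0)) =
      (\<Sum>m\<in>B. (f m)\<^sup>2 * (\<Sum>k=1..N. if f m / t \<le> real (p k) then 1 / real (p k) else 0))"
    by (subst sum.swap) (simp only: sum_distrib_left)
  \<comment> \<open>Only scales with \<open>p k >= f m / t\<close> contribute, so the inner sum is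
    at most \<open>?G * t / f m\<close>: one factor \<open>f m\<close> of the square is traded for
    \<open>t\<close>.\<close>
  also have "?c3 / t\<^sup>2 * \<dots> \<le> ?c3 / t\<^sup>2 * (\<Sum>m\<in>B. ?G * t * f m)"
  proof (intro mult_left_mono sum_mono)
    fix m
    show "(f m)\<^sup>2 * (\<Sum>k=1..N. if f m / t \<le> real (p k) then 1 / real (p k) else 0) \<le> ?G * t * f m"
    proof (cases "f m = 0")
      case False
      then have fm: "0 < f m" using f[of m] by simp
      have "(f m)\<^sup>2 * (\<Sum>k=1..N. if f m / t \<le> real (p k) then 1 / real (p k) else 0) \<le> (f m)\<^sup>2 * (?G / (f m / t))"
        using fm t by (intro mult_left_mono sum_above_geometric[where P = "\<lambda>k. real (p k)", OF c P0 growth]) auto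
      also have "\<dots> = ?G * t * f m" using fm t by (simp add: power2_eq_square)
      finally show ?thesis .
    qed simp
  qed simp
  also have "\<dots> = ?c3 * ?G / t * sum f B"
  proof -
    have "u / t\<^sup>2 * (v * t * w) = u * v / t * w" for u v w :: real
      using t by (simp add: power2_eq_square)
    then show ?thesis unfolding sum_distrib_left[symmetric] .
  qed
  finally have b3: "(\<Sum>k=1..N. real (card (X3 k))) \<le> ?c3 * ?G / t * sum f B" .
  have "card X \<le> card ((\<Union>k\<in>{1..N}. X1 k) \<union> X2 \<union> (\<Union>k\<in>{1..N}. X3 k))"
    using cover fin by (intro card_mono) auto
  also have "\<dots> \<le> card (\<Union>k\<in>{1..N}. X1 k) + card X2 + card (\<Union>k\<in>{1..N}. X3 k)"
    by (meson add_le_mono1 card_Un_le le_trans)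
  also have "\<dots> \<le> (\<Sum>k=1..N. card (X1 k)) + card X2 + (\<Sum>k=1..N. card (X3 k))"
    by (intro add_mono card_UN_le) auto
  finally have "real (card X) \<le> (\<Sum>k=1..N. real (card (X1 k))) + real (card X2) + (\<Sum>k=1..N. real (card (X3 k)))"
    by (simp flip: of_nat_sum of_nat_add)
  also have "\<dots> \<le> ?G / t * sum f B + 7 ^ d * (2 * 2 ^ ?D * real (K + 2) ^ d) / t * sum f B + ?c3 * ?G / t * sum f B"
    by (intro add_mono b1 b2 b3)
  also have "\<dots> = (?G + 7 ^ d * (2 * 2 ^ ?D * real (K + 2) ^ d) + ?c3 * ?G) / t * sum f B"
    by (simp only: add_divide_distrib distrib_right)
  finally show ?thesis .
qed

text \<open>The lowest base-\<open>p\<close> digit of coordinate 0 is \<open>j\<close>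
  itself.\<close>

lemma inj_on_residue_point:
  assumes "0 < d" and "0 < q"
  shows "inj_on (\<lambda>j. vec_add b (residue_point d q p j)) {..<p}"
proof (rule inj_onI)
  fix j j' assume jj: "j \<in> {..<p}" "j' \<in> {..<p}"
    "vec_add b (residue_point d q p j) = vec_add b (residue_point d q p j')"
  obtain q' where q': "q = Suc q'" using assms(2) gr0_implies_Suc by blast
  have low: "(\<Sum>i<q. p ^ i * (j ^ (0 * q + i + 1) mod p)) mod p = j mod p" for j
  proof -
    have "(\<Sum>i<q. p ^ i * (j ^ (0 * q + i + 1) mod p)) = j mod p + p * (\<Sum>i<q'. p ^ i * (j ^ (i + 2) mod p))"
      unfolding q' by (subst sum.lessThan_Suc_shift) (simp add: sum_distrib_left mult.assoc)
    then show ?thesis by simp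
  qed
  have eq: "(\<Sum>i<q. p ^ i * (j ^ (0 * q + i + 1) mod p)) = (\<Sum>i<q. p ^ i * (j' ^ (0 * q + i + 1) mod p))"
  proof -
    have "residue_point d q p j 0 = residue_point d q p j' 0"
      using fun_cong[OF jj(3), of 0] by (simp only: vec_add_def add_left_cancel)
    then show ?thesis
      unfolding residue_point_digits if_P[OF assms(1)] of_nat_eq_iff .
  qed
  have "j mod p = j' mod p" unfolding low[of j, symmetric] low[of j', symmetric] eq ..
  then show "j = j'" using jj by simp
qed

text \<open>The last block alone has \<open>p N\<close> points, while all blocks together have at
  most \<open>c / (c - 1) * p N\<close>, with multiplicity. Since \<open>f >= 0\<close>, points
  shared by several blocks only enlarge the sum over blocks, so some block mean exceeds
  \<open>t / (c / (c - 1))\<close>.\<close>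

lemma exists_large_curve_mean:
  fixes f :: "(nat \<Rightarrow> int) \<Rightarrow> real"
  assumes d: "0 < d" and q: "0 < q" and c: "1 < c" and p: "\<And>k. 1 \<le> k \<Longrightarrow> 0 < p k"
    and growth: "\<And>k. 1 \<le> k \<Longrightarrow> c * real (p k) \<le> real (p (k + 1))"
    and f: "\<And>m. 0 \<le> f m" and t: "0 < t" and N: "1 \<le> N"
    and big: "t < 1 / real (card (\<Union>k\<in>{1..N}. block d q p a k)) * (\<Sum>m\<in>(\<Union>k\<in>{1..N}. block d q p a k). f (vec_add n m))"
  shows "\<exists>k\<ge>1. t / (c / (c - 1)) < curve_mean d q (p k) (a k) f n"
proof (rule ccontr)
  let ?U = "\<Union>k\<in>{1..N}. block d q p a k" and ?t = "t / (c / (c - 1))"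
  let ?S = "SIGMA k:{1..N}. {..<p k}" and ?h = "\<lambda>(k, j). vec_add (a k) (residue_point d q (p k) j)"
  assume neg: "\<not> (\<exists>k\<ge>1. ?t < curve_mean d q (p k) (a k) f n)"
  have U: "?U = ?h ` ?S" by (auto simp: block_def image_iff)
  have finU: "finite ?U" unfolding U by simp
  have "(\<Sum>m\<in>?U. f (vec_add n m)) \<le> (\<Sum>x\<in>?S. f (vec_add n (?h x)))"
    unfolding U using f by (intro sum_image_le[unfolded o_def]) auto
  also have "\<dots> = (\<Sum>k=1..N. real (p k) * curve_mean d q (p k) (a k) f n)"
  proof -
    have "(\<Sum>x\<in>?S. f (vec_add n (?h x))) = (\<Sum>(k, j)\<in>?S. f (vec_add n (vec_add (a k) (residue_point d q (p k) j))))"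
      by (intro sum.cong) auto
    also have "\<dots> = (\<Sum>k=1..N. \<Sum>j<p k. f (vec_add n (vec_add (a k) (residue_point d q (p k) j))))"
      by (rule sum.Sigma[symmetric]) auto
    also have "\<dots> = (\<Sum>k=1..N. real (p k) * curve_mean d q (p k) (a k) f n)"
    proof (rule sum.cong[OF refl])
      fix k assume "k \<in> {1..N}"
      then have "0 < p k" using p by simp
      then show "(\<Sum>j<p k. f (vec_add n (vec_add (a k) (residue_point d q (p k) j)))) = real (p k) * curve_mean d q (p k) (a k) f n"
        by (simp add: curve_mean_def)
    qed
    finally show ?thesis .
  qed
  also have "\<dots> \<le> (\<Sum>k=1..N. real (p k) * ?t)"
    using neg by (intro sum_mono mult_left_mono) (auto simp: not_less)
  also have "\<dots> = (\<Sum>k=1..N. real (p k)) * ?t" by (simp only: sum_distrib_right)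
  also have "\<dots> \<le> (c / (c - 1) * real (p N)) * ?t"
    using t c p growth N by (intro mult_right_mono sum_prefix_geometric[OF c]) auto
  also have "\<dots> = t * real (p N)" using c by simp
  also have "\<dots> \<le> t * real (card ?U)"
  proof -
    have "card (block d q p a N) = p N"
    proof -
      have "block d q p a N = (\<lambda>j. vec_add (a N) (residue_point d q (p N) j)) ` {..<p N}"
        by (auto simp: block_def)
      then show ?thesis using inj_on_residue_point[OF d q] by (simp add: card_image)
    qed
    moreover have "card (block d q p a N) \<le> card ?U"
      using N by (intro card_mono finU) auto
    ultimately show ?thesis using t by simp
  qed
  finally have le: "(\<Sum>m\<in>?U. f (vec_add n m)) \<le> t * real (card ?U)" .
  show False
  \<comment> \<open>For cardinality 0 the average is 0 by the convention on division, which
    contradicts \<open>t < 0\<close>.\<close>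
  proof (cases "card ?U = 0")
    case True
    then show False using big t by simp
  next
    case False
    then have "1 / real (card ?U) * (\<Sum>m\<in>?U. f (vec_add n m)) \<le> t"
      using le by (simp add: pos_divide_le_eq)
    then show False using big by simp
  qed
qed

theorem theorem4p4:
  fixes d q :: nat and c C :: real
    and p :: "nat \<Rightarrow> nat" and a :: "nat \<Rightarrow> nat \<Rightarrow> int"
  assumes "d \<ge> 1" and "q \<ge> 1" and "c > 1" and "C > 1"
    and "\<And>k. k \<ge> 1 \<Longrightarrow> prime (p k)"
    and "\<And>k. k \<ge> 1 \<Longrightarrow> c * real (p k) \<le> real (p (k + 1)) \<and> real (p (k + 1)) < C * real (p k)"
    and "\<And>k. k \<ge> 1 \<Longrightarrow> a k \<in> int_lattice d"
    and "\<And>k. k \<ge> 2 \<Longrightarrow> euclid_norm d (a (k - 1)) + real (p (k - 1)) ^ q < euclid_norm d (a k)"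
    and "\<And>k. k \<ge> 1 \<Longrightarrow> euclid_norm d (a k) \<le> C * real (p k) ^ q"
  shows "\<exists>C'::real. \<forall>(f :: (nat \<Rightarrow> int) \<Rightarrow> complex) (t::real).
           (\<lambda>n. cmod (f n)) summable_on int_lattice d \<longrightarrow> t > 0 \<longrightarrow>
             finite {n \<in> int_lattice d. maximal_fun (block d q p a) f n > ereal t} \<and>
             real (card {n \<in> int_lattice d. maximal_fun (block d q p a) f n > ereal t})
               \<le> C' / t * (\<Sum>\<^sub>\<infinity>n\<in>int_lattice d. cmod (f n))"
proof -
  let ?G = "c / (c - 1)"
  \<comment> \<open>An integer in place of \<open>C\<close>, since it enters the radii of lattice
    cubes.\<close>
  define K where "K = nat \<lceil>C\<rceil>"
  define A where "A = c / (c - 1) + 7 ^ d * (2 * 2 ^ (d * q) * real (K + 2) ^ d) +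
      4 * 4 ^ (d * q) * (real (d * q))\<^sup>2 * 4 ^ d * (c / (c - 1))"
  have G0: "0 < ?G" using assms(3) by simp
  have p0: "0 < p k" if "1 \<le> k" for k using assms(5)[OF that] by (simp add: prime_gt_0_nat)
  have growth: "c * real (p k) \<le> real (p (k + 1))" if "1 \<le> k" for k using assms(6)[OF that] by simp
  have a_le: "\<bar>a k r\<bar> \<le> int K * int (p k) ^ q" if k: "1 \<le> k" and r: "r < d" for k r
  proof -
    have "real_of_int \<bar>a k r\<bar> \<le> euclid_norm d (a k)" using abs_le_euclid_norm[OF r] by simp
    also have "\<dots> \<le> C * real (p k) ^ q" by (rule assms(9)[OF k])
    also have "\<dots> \<le> real K * real (p k) ^ q" unfolding K_def by (intro mult_right_mono) (auto simp: real_nat_ceiling_ge)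
    finally have "real_of_int \<bar>a k r\<bar> \<le> real_of_int (int K * int (p k) ^ q)" by simp
    then show ?thesis by (simp only: of_int_le_iff)
  qed
  show ?thesis
  proof (intro exI[of _ "A * ?G"] allI impI)
    fix f :: "(nat \<Rightarrow> int) \<Rightarrow> complex" and t :: real
    assume summable: "(\<lambda>n. cmod (f n)) summable_on int_lattice d" and t: "0 < t"
    let ?E = "{n \<in> int_lattice d. maximal_fun (block d q p a) f n > ereal t}"
    let ?I = "\<Sum>\<^sub>\<infinity>n\<in>int_lattice d. cmod (f n)"
    \<comment> \<open>Finite subsets come first, because finiteness of \<open>?E\<close> is deduced
      from a bound uniform over them.\<close>
    have bound: "real (card X) \<le> A * ?G / t * ?I" if X: "X \<subseteq> ?E" "finite X" for X
    proof -
      have "\<exists>k\<ge>1. t / ?G < curve_mean d q (p k) (a k) (\<lambda>m. cmod (f m)) n" if n: "n \<in> X" for n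
      proof -
        have "ereal t < maximal_fun (block d q p a) f n" using n X by auto
        then obtain N where N: "1 \<le> N" "t < 1 / real (card (\<Union>k\<in>{1..N}. block d q p a k)) *
            (\<Sum>m\<in>(\<Union>k\<in>{1..N}. block d q p a k). cmod (f (vec_add n m)))"
          unfolding maximal_fun_def by (auto simp: less_SUP_iff)
        show ?thesis
          by (rule exists_large_curve_mean[OF _ _ assms(3) p0 growth _ t N]) (use assms(1,2) in auto)
      qed
      then obtain \<kappa> where \<kappa>: "\<And>n. n \<in> X \<Longrightarrow> 1 \<le> \<kappa> n"
          "\<And>n. n \<in> X \<Longrightarrow> t / ?G < curve_mean d q (p (\<kappa> n)) (a (\<kappa> n)) (\<lambda>m. cmod (f m)) n"
        by metis
      let ?pt = "\<lambda>n j. vec_add n (vec_add (a (\<kappa> n)) (residue_point d q (p (\<kappa> n)) j))"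
      \<comment> \<open>These are all the points that the chosen averages sample. Cutting
        \<open>f\<close> off outside \<open>B\<close> changes none of them, gives finite support,
        and leaves a sum bounded by the l^1 norm.\<close>
      define B where "B = (\<Union>n\<in>X. ?pt n ` {..<p (\<kappa> n)})"
      have finB: "finite B" using X(2) by (simp add: B_def)
      have B: "B \<subseteq> int_lattice d"
        using X(1) assms(7) \<kappa>(1) by (auto simp: B_def intro!: vec_add_in_lattice residue_point_in_lattice)
      define g where "g m = (if m \<in> B then cmod (f m) else 0)" for m
      have "real (card X) \<le> A / (t / ?G) * sum g B"
        unfolding A_def
      proof (rule weak_type_curve_means[where p = p and a = a])
        show "0 < q" using assms(2) by simp
        show "1 < c" by (rule assms(3))
        show "prime (p k)" if "1 \<le> k" for k by (rule assms(5)[OF that])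
        show "c * real (p k) \<le> real (p (k + 1))" if "1 \<le> k" for k by (rule growth[OF that])
        show "a k \<in> int_lattice d" if "1 \<le> k" for k by (rule assms(7)[OF that])
        show "\<bar>a k r\<bar> \<le> int K * int (p k) ^ q" if "1 \<le> k" "r < d" for k r by (rule a_le[OF that])
        show "0 < t / ?G" using t G0 by (rule divide_pos_pos)
        show "\<exists>k\<ge>1. t / ?G < curve_mean d q (p k) (a k) g n" if n: "n \<in> X" for n
        proof (intro exI conjI)
          show "1 \<le> \<kappa> n" by (rule \<kappa>(1)[OF n])
          have "g (?pt n j) = cmod (f (?pt n j))" if "j < p (\<kappa> n)" for j
            using n that by (auto simp: g_def B_def)
          then show "t / ?G < curve_mean d q (p (\<kappa> n)) (a (\<kappa> n)) g n"
            using \<kappa>(2)[OF n] by (simp add: curve_mean_def)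
        qed
      qed (use X finB in \<open>auto simp: g_def\<close>)
      also have "sum g B = (\<Sum>m\<in>B. cmod (f m))" by (simp add: g_def)
      also have "A / (t / ?G) * \<dots> \<le> A / (t / ?G) * ?I"
      proof (intro mult_left_mono finite_sum_le_infsum[OF summable finB B])
        show "0 \<le> A / (t / ?G)" using t G0 assms(3) by (simp add: A_def)
      qed simp
      also have "\<dots> = A * ?G / t * ?I" by simp
      finally show ?thesis .
    qed
    have "finite ?E \<and> card ?E \<le> nat \<lfloor>A * ?G / t * ?I\<rfloor>"
      by (rule finite_if_finite_subsets_card_bdd) (use bound in \<open>auto simp: le_nat_floor\<close>)
    then show "finite ?E \<and> real (card ?E) \<le> A * ?G / t * ?I" using bound[of ?E] by blast
  qed
qed

end
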